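(* Let $(\mathbf{X},d,\mu)$ be a compact metric measure space and let $\mathcal{L}$ be an operator in the real space $L_2(\mathbf{X},\mu)$ such that Assumptions A, B, C, D, E stated in the context are satisfied. Then there are constants $0<c=c(\mathbf{X})<1$ and $0<\gamma=\gamma(\mathbf{X})<1$, independent of $\omega$, such that for all sufficiently large $\omega$ $$c\,\sup\,\mathrm{card}\left(\mathcal{X}_{\omega^{-1/2}}\right)\le\mathcal{N}_\omega(\mathcal{L})\le\inf\,\mathrm{card}\left(\mathcal{X}_{\gamma\omega^{-1/2}}\right),$$ where $\mathcal{N}_\omega(\mathcal{L})$ is the number of eigenvalues of $\mathcal{L}$ in $[0,\omega]$ (counted with multiplicities), and the supremum and infimum are taken over all metric $(\omega^{-1/2},N)$-lattices $\mathcal{X}_{\omega^{-1/2}}$ and all metric $(\gamma\omega^{-1/2},N)$-lattices $\mathcal{X}_{\gamma\omega^{-1/2}}$ in $\mathbf{X}$, respectively.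
   Context: Setting. $(\mathbf{X},d)$ is a compact metric space with a positive Radon measure $\mu$; $B(x,r)$ is the open ball with center $x$ and radius $r$, and $|B(x,r)|=\mu(B(x,r))$. $\|\cdot\|$ and $\langle\cdot,\cdot\rangle$ are the norm and inner product of the real space $L_2(\mathbf{X},\mu)$. Assumption A (doubling). There is $D>0$ such that $0<|B(x,2r)|\le 2^{D}|B(x,r)|$ for all $x\in\mathbf{X}$, $r>0$. Assumption B. $L_2(\mathbf{X},\mu)$ is equipped with a densely defined, non-negative symmetric operator whose closure is self-adjoint; $\mathcal{L}$ denotes this self-adjoint non-negative operator, with domain $\mathcal{D}(\mathcal{L})$. The set $\mathcal{D}^\infty(\mathcal{L})=\bigcap_{k\in\mathbb{N}}\mathcal{D}(\mathcal{L}^k)$ is a subalgebra of the algebra $C(\mathbf{X})$ of continuous functions. For $f,g\in\mathcal{D}^\infty(\mathcal{L})$ put $$\Gamma(f,g)=\tfrac12\left(f\mathcal{L}g+g\mathcal{L}f-\mathcal{L}(fg)\right)\in L_1(\mathbf{X},\mu).$$ Assumption C. There is a constant $c_0>0$ such that $\int_{\mathbf{X}}\Gamma(f,f)\,d\mu\le c_0\,\|\mathcal{L}^{1/2}f\|^2$ for all $f\in\mathcal{D}^\infty(\mathcal{L})$, where $\mathcal{L}^{1/2}$ is the non-negative square root. Assumption D (local Poincaré inequality). There are constants $C>0$ and $\rho_0>0$ such that for all $f\in\mathcal{D}^\infty(\mathcal{L})$, all $x\in\mathbf{X}$ and all $0<\rho<\rho_0$, $$\int_{B(x,\rho)}|f-f_B|^2\,d\mu\le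 C\rho^2\int_{B(x,\rho)}\Gamma(f,f)\,d\mu,\qquad f_B=\frac{1}{|B(x,\rho)|}\int_{B(x,\rho)}f\,d\mu .$$ Assumption E (short-time Gaussian estimates). The heat semigroup has a heat kernel $P_t(x,y)$, i.e. $e^{-t\mathcal{L}}f(x)=\int_{\mathbf{X}}P_t(x,y)f(y)\,d\mu(y)$, and there are positive constants $C_1,C_2,c_1,c_2$ such that for all $0<t<1$ and $x,y\in\mathbf{X}$ $$\frac{C_1e^{-c_1 d(x,y)^2/t}}{\sqrt{|B(x,\sqrt t)|\,|B(y,\sqrt t)|}}\le P_t(x,y)\le\frac{C_2e^{-c_2 d(x,y)^2/t}}{\sqrt{|B(x,\sqrt t)|\,|B(y,\sqrt t)|}} .$$ Under Assumptions A–D the spectrum of $\mathcal{L}$ is discrete (eigenvalues of finite multiplicity without finite accumulation points), so $\mathcal{N}_\omega(\mathcal{L})$ is well defined and finite. Lattices. For $\rho>0$, a set of points $\mathcal{X}_\rho=\{x_j\}\subset\mathbf{X}$ is a metric $(\rho,N)$-lattice if the balls $B(x_j,\rho/2)$ are pairwise disjoint, and the balls $B(x_j,\rho)$ cover $\mathbf{X}$ with multiplicity at most $N$ (every point lies in at most $N$ of these balls). Here $N=N(\mathbf{X})$ is a fixed constant, depending only on $\mathbf{X}$, for which a $(\rho,N)$-lattice exists for every sufficiently small $\rho>0$.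
   Formalization: The constants c and γ are independent of ω but may depend on the operator as well as on the space; constants depending on the space alone are impossible, as replacing the operator on the circle by its positive multiples shows. *)

theory Defs
  imports "HOL-Analysis.Analysis"
begin

definition radon_measure :: "'a::topological_space measure \<Rightarrow> bool" where
  "radon_measure M \<longleftrightarrow>
     sets M = sets borel \<and>
     (\<forall>K. compact K \<longrightarrow> emeasure M K < \<infinity>) \<and>
     (\<forall>A\<in>sets M. emeasure M A = (SUP K\<in>{K. compact K \<and> K \<subseteq> A}. emeasure M K))"

definition doubling :: "'a::metric_space measure \<Rightarrow> bool" where
  "doubling M \<longleftrightarrow> (\<exists>D>0. \<forall>x r. r > 0 \<longrightarrow>
     0 < measure M (ball x (2 * r)) \<and>
     measure M (ball x (2 * r)) \<le> 2 powr D * measure M (ball x r))"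

text \<open>
  The real Hilbert space $L_2$ is handled through representatives: its elements are the
  square-integrable functions, and two of them are the same vector iff they are equal almost
  everywhere.
\<close>

definition L2 :: "'a measure \<Rightarrow> ('a \<Rightarrow> real) set" where
  "L2 M = {f \<in> borel_measurable M. integrable M (\<lambda>x. (f x)\<^sup>2)}"

definition l2_inner :: "'a measure \<Rightarrow> ('a \<Rightarrow> real) \<Rightarrow> ('a \<Rightarrow> real) \<Rightarrow> real" where
  "l2_inner M f g = (LINT x|M. f x * g x)"

definition l2_norm :: "'a measure \<Rightarrow> ('a \<Rightarrow> real) \<Rightarrow> real" where
  "l2_norm M f = sqrt (l2_inner M f f)"

text \<open>
  A possibly unbounded linear operator in $L_2$ is given by its graph: a linear set of pairs of
  representatives that is saturated under almost-everywhere equality and single-valued up to it.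
  Because of the saturation, relational composition, powers and \<^const>\<open>Domain\<close> of graphs are the
  composition, powers and domain of operators.
\<close>

definition l2_operator :: "'a measure \<Rightarrow> ('a \<Rightarrow> real) rel \<Rightarrow> bool" where
  "l2_operator M T \<longleftrightarrow>
     T \<subseteq> L2 M \<times> L2 M \<and>
     (\<forall>f g f' g'. (f, g) \<in> T \<and> f' \<in> L2 M \<and> g' \<in> L2 M \<and>
        (AE x in M. f x = f' x) \<and> (AE x in M. g x = g' x) \<longrightarrow> (f', g') \<in> T) \<and>
     ((\<lambda>x. 0), (\<lambda>x. 0)) \<in> T \<and>
     (\<forall>f g f' g' a b. (f, g) \<in> T \<and> (f', g') \<in> T \<longrightarrow>
        ((\<lambda>x. a * f x + b * f' x), (\<lambda>x. a * g x + b * g' x)) \<in> T) \<and>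
     (\<forall>f g g'. (f, g) \<in> T \<and> (f, g') \<in> T \<longrightarrow> (AE x in M. g x = g' x))"

definition densely_defined :: "'a measure \<Rightarrow> ('a \<Rightarrow> real) rel \<Rightarrow> bool" where
  "densely_defined M T \<longleftrightarrow>
     (\<forall>f\<in>L2 M. \<forall>e>0. \<exists>u\<in>Domain T. l2_norm M (\<lambda>x. f x - u x) < e)"

definition l2_adjoint :: "'a measure \<Rightarrow> ('a \<Rightarrow> real) rel \<Rightarrow> ('a \<Rightarrow> real) rel" where
  "l2_adjoint M T = {(f, h). f \<in> L2 M \<and> h \<in> L2 M \<and>
     (\<forall>(u, v)\<in>T. l2_inner M v f = l2_inner M u h)}"

definition l2_closure :: "'a measure \<Rightarrow> ('a \<Rightarrow> real) rel \<Rightarrow> ('a \<Rightarrow> real) rel" where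
  "l2_closure M T = {(f, g). f \<in> L2 M \<and> g \<in> L2 M \<and>
     (\<exists>u v. (\<forall>n::nat. (u n, v n) \<in> T) \<and>
        (\<lambda>n. l2_norm M (\<lambda>x. u n x - f x)) \<longlonglongrightarrow> 0 \<and>
        (\<lambda>n. l2_norm M (\<lambda>x. v n x - g x)) \<longlonglongrightarrow> 0)}"

definition symmetric_operator :: "'a measure \<Rightarrow> ('a \<Rightarrow> real) rel \<Rightarrow> bool" where
  "symmetric_operator M T \<longleftrightarrow>
     (\<forall>(f, g)\<in>T. \<forall>(u, v)\<in>T. l2_inner M g u = l2_inner M f v)"

definition nonneg_operator :: "'a measure \<Rightarrow> ('a \<Rightarrow> real) rel \<Rightarrow> bool" where
  "nonneg_operator M T \<longleftrightarrow> (\<forall>(f, g)\<in>T. 0 \<le> l2_inner M g f)"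

definition selfadjoint_operator :: "'a measure \<Rightarrow> ('a \<Rightarrow> real) rel \<Rightarrow> bool" where
  "selfadjoint_operator M T \<longleftrightarrow>
     l2_operator M T \<and> densely_defined M T \<and> l2_adjoint M T = T"

definition nonneg_sqrt :: "'a measure \<Rightarrow> ('a \<Rightarrow> real) rel \<Rightarrow> ('a \<Rightarrow> real) rel \<Rightarrow> bool" where
  "nonneg_sqrt M L S \<longleftrightarrow>
     selfadjoint_operator M S \<and> nonneg_operator M S \<and> S O S = L"

definition smooth_domain :: "('a \<Rightarrow> real) rel \<Rightarrow> ('a \<Rightarrow> real) set" where
  "smooth_domain L = (\<Inter>k\<in>{1..}. Domain (L ^^ k))"

text \<open>
  A set of $L_2$-vectors is a subalgebra (not necessarily unital) of the continuous functions if
  every vector has a continuous representative and the set is closed under the algebra operations.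
\<close>

definition subalgebra_of_continuous ::
    "'a::topological_space measure \<Rightarrow> ('a \<Rightarrow> real) set \<Rightarrow> bool" where
  "subalgebra_of_continuous M A \<longleftrightarrow>
     (\<forall>f\<in>A. \<exists>g. continuous_on UNIV g \<and> (AE x in M. f x = g x)) \<and>
     (\<forall>f\<in>A. \<forall>g\<in>A. \<forall>a b. (\<lambda>x. a * f x + b * g x) \<in> A) \<and>
     (\<forall>f\<in>A. \<forall>g\<in>A. (\<lambda>x. f x * g x) \<in> A)"

text \<open>A representative of the value of the operator; unique up to almost-everywhere equality.\<close>

definition l2_apply :: "('a \<Rightarrow> real) rel \<Rightarrow> ('a \<Rightarrow> real) \<Rightarrow> ('a \<Rightarrow> real)" where
  "l2_apply T f = (SOME g. (f, g) \<in> T)"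

definition carre_du_champ ::
    "('a \<Rightarrow> real) rel \<Rightarrow> ('a \<Rightarrow> real) \<Rightarrow> ('a \<Rightarrow> real) \<Rightarrow> 'a \<Rightarrow> real" where
  "carre_du_champ L f g x =
     1 / 2 * (f x * l2_apply L g x + g x * l2_apply L f x - l2_apply L (\<lambda>y. f y * g y) x)"

definition energy_bound ::
    "'a measure \<Rightarrow> ('a \<Rightarrow> real) rel \<Rightarrow> ('a \<Rightarrow> real) rel \<Rightarrow> bool" where
  "energy_bound M L S \<longleftrightarrow> (\<exists>c0>0. \<forall>f\<in>smooth_domain L.
     (LINT x|M. carre_du_champ L f f x) \<le> c0 * (l2_norm M (l2_apply S f))\<^sup>2)"

definition ball_mean :: "'a::metric_space measure \<Rightarrow> 'a \<Rightarrow> real \<Rightarrow> ('a \<Rightarrow> real) \<Rightarrow> real" where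
  "ball_mean M x r f = 1 / measure M (ball x r) * (LINT y:ball x r|M. f y)"

definition local_poincare :: "'a::metric_space measure \<Rightarrow> ('a \<Rightarrow> real) rel \<Rightarrow> bool" where
  "local_poincare M L \<longleftrightarrow> (\<exists>C>0. \<exists>r0>0. \<forall>f\<in>smooth_domain L. \<forall>x r. 0 < r \<and> r < r0 \<longrightarrow>
     (LINT y:ball x r|M. \<bar>f y - ball_mean M x r f\<bar>\<^sup>2)
       \<le> C * r\<^sup>2 * (LINT y:ball x r|M. carre_du_champ L f f y))"

definition l2_bounded_operator ::
    "'a measure \<Rightarrow> (('a \<Rightarrow> real) \<Rightarrow> ('a \<Rightarrow> real)) \<Rightarrow> bool" where
  "l2_bounded_operator M A \<longleftrightarrow>
     (\<forall>f\<in>L2 M. A f \<in> L2 M) \<and>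
     (\<forall>f\<in>L2 M. \<forall>g\<in>L2 M. \<forall>a b.
        AE x in M. A (\<lambda>y. a * f y + b * g y) x = a * A f x + b * A g x) \<and>
     (\<exists>K. \<forall>f\<in>L2 M. l2_norm M (A f) \<le> K * l2_norm M f)"

text \<open>
  $T_t = e^{-tL}$ is the strongly continuous semigroup of bounded operators whose infinitesimal
  generator, with its full domain, is $-L$.
\<close>

definition heat_semigroup ::
    "'a measure \<Rightarrow> ('a \<Rightarrow> real) rel \<Rightarrow> (real \<Rightarrow> ('a \<Rightarrow> real) \<Rightarrow> ('a \<Rightarrow> real)) \<Rightarrow> bool" where
  "heat_semigroup M L T \<longleftrightarrow>
     (\<forall>t\<ge>0. l2_bounded_operator M (T t)) \<and>
     (\<forall>f\<in>L2 M. AE x in M. T 0 f x = f x) \<and>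
     (\<forall>s\<ge>0. \<forall>t\<ge>0. \<forall>f\<in>L2 M. AE x in M. T (s + t) f x = T s (T t f) x) \<and>
     (\<forall>f\<in>L2 M. ((\<lambda>t. l2_norm M (\<lambda>x. T t f x - f x)) \<longlongrightarrow> 0) (at_right 0)) \<and>
     L = {(f, h). f \<in> L2 M \<and> h \<in> L2 M \<and>
       ((\<lambda>t. l2_norm M (\<lambda>x. (T t f x - f x) / t - (- h x))) \<longlongrightarrow> 0) (at_right 0)}"

definition heat_kernel ::
    "'a measure \<Rightarrow> (real \<Rightarrow> ('a \<Rightarrow> real) \<Rightarrow> ('a \<Rightarrow> real)) \<Rightarrow> (real \<Rightarrow> 'a \<Rightarrow> 'a \<Rightarrow> real) \<Rightarrow> bool" where
  "heat_kernel M T P \<longleftrightarrow> (\<forall>t>0.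
     (\<lambda>(x, y). P t x y) \<in> borel_measurable (M \<Otimes>\<^sub>M M) \<and>
     (\<forall>f\<in>L2 M. AE x in M.
        integrable M (\<lambda>y. P t x y * f y) \<and> T t f x = (LINT y|M. P t x y * f y)))"

definition short_time_gaussian ::
    "'a::metric_space measure \<Rightarrow> (real \<Rightarrow> 'a \<Rightarrow> 'a \<Rightarrow> real) \<Rightarrow> bool" where
  "short_time_gaussian M P \<longleftrightarrow> (\<exists>C1>0. \<exists>C2>0. \<exists>c1>0. \<exists>c2>0. \<forall>t x y. 0 < t \<and> t < 1 \<longrightarrow>
     C1 * exp (- c1 * (dist x y)\<^sup>2 / t)
         / sqrt (measure M (ball x (sqrt t)) * measure M (ball y (sqrt t))) \<le> P t x y \<and>
     P t x y \<le> C2 * exp (- c2 * (dist x y)\<^sup>2 / t)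
         / sqrt (measure M (ball x (sqrt t)) * measure M (ball y (sqrt t))))"

text \<open>The multiplicity is the dimension of the eigenspace modulo almost-everywhere equality.\<close>

definition eigenspace :: "('a \<Rightarrow> real) rel \<Rightarrow> real \<Rightarrow> ('a \<Rightarrow> real) set" where
  "eigenspace L l = {f. (f, (\<lambda>x. l * f x)) \<in> L}"

definition eigenvalues :: "'a measure \<Rightarrow> ('a \<Rightarrow> real) rel \<Rightarrow> real set" where
  "eigenvalues M L = {l. \<exists>f\<in>eigenspace L l. \<not> (AE x in M. f x = 0)}"

definition ae_independent :: "'a measure \<Rightarrow> ('a \<Rightarrow> real) set \<Rightarrow> bool" where
  "ae_independent M F \<longleftrightarrow> finite F \<and>
     (\<forall>a. (AE x in M. (\<Sum>f\<in>F. a f * f x) = 0) \<longrightarrow> (\<forall>f\<in>F. a f = 0))"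

definition multiplicity_of :: "'a measure \<Rightarrow> ('a \<Rightarrow> real) rel \<Rightarrow> real \<Rightarrow> enat" where
  "multiplicity_of M L l =
     (SUP F\<in>{F. F \<subseteq> eigenspace L l \<and> ae_independent M F}. enat (card F))"

definition eigenvalue_count :: "'a measure \<Rightarrow> ('a \<Rightarrow> real) rel \<Rightarrow> real \<Rightarrow> enat" where
  "eigenvalue_count M L w =
     (if finite (eigenvalues M L \<inter> {0..w})
      then \<Sum>l\<in>eigenvalues M L \<inter> {0..w}. multiplicity_of M L l else \<infinity>)"

text \<open>In a compact space the disjointness condition makes every such set finite.\<close>

definition metric_lattice :: "real \<Rightarrow> nat \<Rightarrow> 'a::metric_space set \<Rightarrow> bool" where
  "metric_lattice r N X \<longleftrightarrow>
     disjoint_family_on (\<lambda>x. ball x (r / 2)) X \<and>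
     (\<Union>x\<in>X. ball x r) = UNIV \<and>
     (\<forall>y. finite {x\<in>X. y \<in> ball x r} \<and> card {x\<in>X. y \<in> ball x r} \<le> N)"

end

(*
Upper bound: among more independent eigenfunctions with eigenvalues in [0,w] than lattice balls there
is a non-trivial combination f with zero mean on every ball, and the local Poincare inequality,
summed over the lattice, gives |f|^2 <= C r^2 N c0 w |f|^2, which is impossible for r = gamma w^(-1/2)
with gamma small.

Lower bound: let Phi be a maximal orthonormal set of eigenfunctions with eigenvalues in [0,w]. The
spectral theorem is replaced by a variational argument: the heat kernel is bounded, hence energy
bounded sequences are precompact, hence the Rayleigh quotient is at least w on the complement of Phi,
where the heat flow therefore decays like exp (-w t). By the Gaussian lower bound, at a time
comparable to 1/w the flow keeps a fixed part of each normalised indicator of a lattice ball, so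
these orthonormal functions have projections onto span Phi of norm bounded below, and Bessel's
inequality bounds their number by a multiple of card Phi.
*)

theory Submission
  imports Defs "HOL-Complex_Analysis.Great_Picard"
begin

subsection \<open>The semi-inner product on representatives\<close>

text \<open>Three obstacles shape the argument. First, \<Gamma>(f, f) is not assumed to be pointwise
  non-negative, yet replacing a sum over overlapping balls by N times one integral needs exactly
  that. It is recovered from the Poincare inequality, whose left side is non-negative on every small
  ball, by a covering argument with doubling. Second, \<open>heat_semigroup\<close> only supplies
  bounded operators with a right derivative at time zero. Contraction, decay rates and the estimate
  |T_t f - f|^2 <= (t/2) <L f, f>, all immediate from spectral calculus, are therefore proved by
  differentiating orbits from the right, at times below 1, where the kernel is controlled. Third,
  the existence of a maximal \<Phi> presupposes a finite count, so the lower bound draws on the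
  upper one, applied to one existing lattice. The waiting time is 4^p / w: its square root is 2^p r,
  so volumes cost p + 2 doublings, a factor geometric in p, while the flow off \<Phi> has shrunk by
  exp (- 4^p). The exponent p depends on the doubling and Gaussian constants alone, hence c does not
  depend on w.\<close>

lemma L2_measurable [measurable_dest]: "f \<in> L2 M \<Longrightarrow> f \<in> borel_measurable M"
  by (simp add: L2_def)

lemma L2_square_integrable: "f \<in> L2 M \<Longrightarrow> integrable M (\<lambda>x. (f x)\<^sup>2)"
  by (simp add: L2_def)

lemma L2_mult_integrable:
  assumes "f \<in> L2 M" "g \<in> L2 M"
  shows "integrable M (\<lambda>x. f x * g x)"
proof (rule Bochner_Integration.integrable_bound)
  show "integrable M (\<lambda>x. (f x)\<^sup>2 + (g x)\<^sup>2)"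
    using assms by (simp add: L2_square_integrable)
  have "\<bar>a * b\<bar> \<le> a\<^sup>2 + b\<^sup>2" for a b :: real
  proof -
    have "2 * (\<bar>a\<bar> * \<bar>b\<bar>) \<le> a\<^sup>2 + b\<^sup>2" "0 \<le> \<bar>a\<bar> * \<bar>b\<bar>"
      using sum_squares_bound[of "\<bar>a\<bar>" "\<bar>b\<bar>"] by (simp_all add: mult.assoc)
    moreover have "\<bar>a * b\<bar> = \<bar>a\<bar> * \<bar>b\<bar>" by (rule abs_mult)
    ultimately show ?thesis by linarith
  qed
  then show "AE x in M. norm (f x * g x) \<le> norm ((f x)\<^sup>2 + (g x)\<^sup>2)"
    by simp
qed (use assms in measurable)

lemma L2_lincomb:
  assumes "f \<in> L2 M" "g \<in> L2 M"
  shows "(\<lambda>x. a * f x + b * g x) \<in> L2 M"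
proof -
  have "integrable M (\<lambda>x. a\<^sup>2 * (f x)\<^sup>2 + 2 * a * b * (f x * g x) + b\<^sup>2 * (g x)\<^sup>2)"
    using assms by (intro Bochner_Integration.integrable_add integrable_mult_right
        L2_square_integrable L2_mult_integrable)
  moreover have "(\<lambda>x. (a * f x + b * g x)\<^sup>2)
      = (\<lambda>x. a\<^sup>2 * (f x)\<^sup>2 + 2 * a * b * (f x * g x) + b\<^sup>2 * (g x)\<^sup>2)"
    by (simp add: fun_eq_iff power2_eq_square algebra_simps)
  moreover have "(\<lambda>x. a * f x + b * g x) \<in> borel_measurable M"
    using assms by measurable
  ultimately show ?thesis
    by (simp add: L2_def)
qed

lemma L2_zero [simp]: "(\<lambda>x. 0) \<in> L2 M"
  by (simp add: L2_def)

lemma L2_add: "f \<in> L2 M \<Longrightarrow> g \<in> L2 M \<Longrightarrow> (\<lambda>x. f x + g x) \<in> L2 M"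
  using L2_lincomb[of f M g 1 1] by simp

lemma L2_diff: "f \<in> L2 M \<Longrightarrow> g \<in> L2 M \<Longrightarrow> (\<lambda>x. f x - g x) \<in> L2 M"
  using L2_lincomb[of f M g 1 "-1"] by simp

lemma L2_scale: "f \<in> L2 M \<Longrightarrow> (\<lambda>x. a * f x) \<in> L2 M"
  using L2_lincomb[of f M f a 0] by simp

lemma L2_divide: "f \<in> L2 M \<Longrightarrow> (\<lambda>x. f x / a) \<in> L2 M"
  using L2_scale[of f M "1 / a"] by simp

lemma L2_sum: "(\<And>i. i \<in> I \<Longrightarrow> f i \<in> L2 M) \<Longrightarrow> (\<lambda>x. \<Sum>i\<in>I. a i * f i x) \<in> L2 M"
  by (induction I rule: infinite_finite_induct) (simp_all add: L2_add L2_scale)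

lemmas L2_intros = L2_add L2_diff L2_scale L2_divide L2_sum

lemma l2_inner_commute: "l2_inner M f g = l2_inner M g f"
  by (simp add: l2_inner_def mult.commute)

lemma l2_inner_add_left:
  "f \<in> L2 M \<Longrightarrow> g \<in> L2 M \<Longrightarrow> h \<in> L2 M \<Longrightarrow>
    l2_inner M (\<lambda>x. f x + g x) h = l2_inner M f h + l2_inner M g h"
  by (simp add: l2_inner_def distrib_right L2_mult_integrable)

lemma l2_inner_diff_left:
  "f \<in> L2 M \<Longrightarrow> g \<in> L2 M \<Longrightarrow> h \<in> L2 M \<Longrightarrow>
    l2_inner M (\<lambda>x. f x - g x) h = l2_inner M f h - l2_inner M g h"
  by (simp add: l2_inner_def left_diff_distrib L2_mult_integrable)

lemma l2_inner_scale_left: "l2_inner M (\<lambda>x. a * f x) h = a * l2_inner M f h"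
  by (simp add: l2_inner_def mult.assoc)

lemma l2_inner_sum_left:
  "(\<And>i. i \<in> I \<Longrightarrow> f i \<in> L2 M) \<Longrightarrow> h \<in> L2 M \<Longrightarrow>
    l2_inner M (\<lambda>x. \<Sum>i\<in>I. a i * f i x) h = (\<Sum>i\<in>I. a i * l2_inner M (f i) h)"
proof (induction I rule: infinite_finite_induct)
  case (insert i I)
  then show ?case
    by (simp add: l2_inner_add_left l2_inner_scale_left L2_intros)
qed (simp_all add: l2_inner_def)

lemma l2_inner_add_right:
  "f \<in> L2 M \<Longrightarrow> g \<in> L2 M \<Longrightarrow> h \<in> L2 M \<Longrightarrow>
    l2_inner M h (\<lambda>x. f x + g x) = l2_inner M h f + l2_inner M h g"
  by (simp only: l2_inner_commute[of M h] l2_inner_add_left)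

lemma l2_inner_diff_right:
  "f \<in> L2 M \<Longrightarrow> g \<in> L2 M \<Longrightarrow> h \<in> L2 M \<Longrightarrow>
    l2_inner M h (\<lambda>x. f x - g x) = l2_inner M h f - l2_inner M h g"
  by (simp only: l2_inner_commute[of M h] l2_inner_diff_left)

lemma l2_inner_scale_right: "l2_inner M h (\<lambda>x. a * f x) = a * l2_inner M h f"
  by (simp only: l2_inner_commute[of M h] l2_inner_scale_left)

lemma l2_inner_sum_right:
  "(\<And>i. i \<in> I \<Longrightarrow> f i \<in> L2 M) \<Longrightarrow> h \<in> L2 M \<Longrightarrow>
    l2_inner M h (\<lambda>x. \<Sum>i\<in>I. a i * f i x) = (\<Sum>i\<in>I. a i * l2_inner M h (f i))"
  using l2_inner_sum_left[of I f M h a] by (simp add: l2_inner_commute[of M h])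

lemmas l2_inner_simps =
  l2_inner_add_left l2_inner_diff_left l2_inner_scale_left l2_inner_sum_left
  l2_inner_add_right l2_inner_diff_right l2_inner_scale_right l2_inner_sum_right

lemma l2_inner_cong_AE:
  assumes "f \<in> L2 M" "f' \<in> L2 M" "g \<in> L2 M" "g' \<in> L2 M"
    and "AE x in M. f x = f' x" "AE x in M. g x = g' x"
  shows "l2_inner M f g = l2_inner M f' g'"
  unfolding l2_inner_def by (rule integral_cong_AE) (use assms in auto)

lemma l2_inner_self_nonneg: "0 \<le> l2_inner M f f"
  by (simp add: l2_inner_def)

lemma l2_norm_nonneg [simp]: "0 \<le> l2_norm M f"
  by (simp add: l2_norm_def l2_inner_self_nonneg)

lemma l2_norm_square: "(l2_norm M f)\<^sup>2 = l2_inner M f f"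
  by (simp add: l2_norm_def l2_inner_self_nonneg)

lemma l2_norm_zero [simp]: "l2_norm M (\<lambda>x. 0) = 0"
  by (simp add: l2_norm_def l2_inner_def)

lemma l2_norm_cong_AE:
  assumes "f \<in> L2 M" "g \<in> L2 M" "AE x in M. f x = g x"
  shows "l2_norm M f = l2_norm M g"
  unfolding l2_norm_def using l2_inner_cong_AE[of f M g f g] assms by simp

lemma l2_norm_eq_0_iff:
  assumes "f \<in> L2 M"
  shows "l2_norm M f = 0 \<longleftrightarrow> (AE x in M. f x = 0)"
proof -
  have "l2_inner M f f = 0 \<longleftrightarrow> (AE x in M. f x * f x = 0)"
    unfolding l2_inner_def
    by (rule integral_nonneg_eq_0_iff_AE) (use L2_mult_integrable[OF assms assms] in auto)
  then show ?thesis by (simp add: l2_norm_def)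
qed

lemma l2_norm_scale: "l2_norm M (\<lambda>x. a * f x) = \<bar>a\<bar> * l2_norm M f"
  by (simp add: l2_norm_def l2_inner_scale_left l2_inner_scale_right real_sqrt_mult
      flip: mult.assoc power2_eq_square)

text \<open>Stated for bare reals because it serves both Cauchy-Schwarz in L2 and Cauchy-Schwarz for
  the forms <L u, u> - c <u, u>. Either may be degenerate, hence the separate case \<gamma> =
  0.\<close>

lemma quadratic_form_discriminant:
  fixes \<alpha> \<beta> \<gamma> :: real
  assumes nonneg: "\<And>a b. 0 \<le> a\<^sup>2 * \<alpha> + 2 * a * b * \<beta> + b\<^sup>2 * \<gamma>"
  shows "\<beta>\<^sup>2 \<le> \<alpha> * \<gamma>"
proof (cases "\<gamma> = 0")
  case True
  have "\<beta> = 0"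
  proof (rule ccontr)
    assume "\<beta> \<noteq> 0"
    \<comment> \<open>With \<gamma> = 0 the form is affine in b; this b gives it the value
      -1.\<close>
    then show False
      using nonneg[of 1 "- (\<alpha> + 1) / (2 * \<beta>)"] True by (simp add: field_simps)
  qed
  then show ?thesis using True by simp
next
  case False
  then have "0 < \<gamma>" using nonneg[of 0 1] by simp
  \<comment> \<open>The value of the form at (\<gamma>, - \<beta>).\<close>
  have "0 \<le> \<gamma> * (\<gamma> * \<alpha> - \<beta>\<^sup>2)"
    using nonneg[of \<gamma> "-\<beta>"] by (simp add: power2_eq_square algebra_simps)
  then show ?thesis using \<open>0 < \<gamma>\<close> by (simp add: zero_le_mult_iff mult.commute)
qed

lemma l2_Cauchy_Schwarz:
  assumes "f \<in> L2 M" "g \<in> L2 M"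
  shows "\<bar>l2_inner M f g\<bar> \<le> l2_norm M f * l2_norm M g"
proof -
  have "(l2_inner M f g)\<^sup>2 \<le> l2_inner M f f * l2_inner M g g"
  proof (rule quadratic_form_discriminant)
    fix a b
    have "0 \<le> l2_inner M (\<lambda>x. a * f x + b * g x) (\<lambda>x. a * f x + b * g x)"
      by (rule l2_inner_self_nonneg)
    also have "\<dots> = a\<^sup>2 * l2_inner M f f + 2 * a * b * l2_inner M f g + b\<^sup>2 * l2_inner M g g"
      using assms l2_inner_commute[of M g f]
      by (simp add: l2_inner_simps L2_intros power2_eq_square algebra_simps)
    finally show "0 \<le> a\<^sup>2 * l2_inner M f f + 2 * a * b * l2_inner M f g + b\<^sup>2 * l2_inner M g g" .
  qed
  then have "(l2_inner M f g)\<^sup>2 \<le> (l2_norm M f * l2_norm M g)\<^sup>2"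
    by (simp add: power_mult_distrib l2_norm_square)
  then show ?thesis
    by (metis abs_le_square_iff abs_of_nonneg l2_norm_nonneg mult_nonneg_nonneg)
qed

lemma l2_norm_add:
  assumes "f \<in> L2 M" "g \<in> L2 M"
  shows "l2_norm M (\<lambda>x. f x + g x) \<le> l2_norm M f + l2_norm M g"
proof (rule power2_le_imp_le)
  have "(l2_norm M (\<lambda>x. f x + g x))\<^sup>2 = (l2_norm M f)\<^sup>2 + 2 * l2_inner M f g + (l2_norm M g)\<^sup>2"
    using assms l2_inner_commute[of M g f] by (simp add: l2_norm_square l2_inner_simps L2_intros)
  also have "\<dots> \<le> (l2_norm M f)\<^sup>2 + 2 * (l2_norm M f * l2_norm M g) + (l2_norm M g)\<^sup>2"
    using l2_Cauchy_Schwarz[OF assms] by simp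
  finally show "(l2_norm M (\<lambda>x. f x + g x))\<^sup>2 \<le> (l2_norm M f + l2_norm M g)\<^sup>2"
    by (simp add: power2_sum)
qed simp

lemma l2_norm_diff_commute: "l2_norm M (\<lambda>x. f x - g x) = l2_norm M (\<lambda>x. g x - f x)"
proof -
  have "l2_norm M (\<lambda>x. - 1 * (f x - g x)) = \<bar>- 1\<bar> * l2_norm M (\<lambda>x. f x - g x)"
    by (simp only: l2_norm_scale)
  then show ?thesis by simp
qed

lemma l2_norm_diff_triangle:
  assumes "f \<in> L2 M" "g \<in> L2 M" "h \<in> L2 M"
  shows "l2_norm M (\<lambda>x. f x - h x) \<le> l2_norm M (\<lambda>x. f x - g x) + l2_norm M (\<lambda>x. g x - h x)"
  using l2_norm_add[of "\<lambda>x. f x - g x" M "\<lambda>x. g x - h x"] assms by (simp add: L2_intros)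

lemma l2_norm_triangle_sub:
  assumes "f \<in> L2 M" "g \<in> L2 M"
  shows "l2_norm M f \<le> l2_norm M g + l2_norm M (\<lambda>x. f x - g x)"
  using l2_norm_diff_triangle[of f M g "\<lambda>x. 0"] assms by simp

lemma l2_norm_lipschitz:
  assumes "f \<in> L2 M" "g \<in> L2 M"
  shows "\<bar>l2_norm M f - l2_norm M g\<bar> \<le> l2_norm M (\<lambda>x. f x - g x)"
  using l2_norm_triangle_sub[OF assms] l2_norm_triangle_sub[OF assms(2,1)]
    l2_norm_diff_commute[of M f g] by linarith

lemma l2_inner_tendsto:
  assumes L2: "\<And>n. f n \<in> L2 M" "f' \<in> L2 M" "g \<in> L2 M"
    and lim: "((\<lambda>n. l2_norm M (\<lambda>x. f n x - f' x)) \<longlongrightarrow> 0) F"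
  shows "((\<lambda>n. l2_inner M (f n) g) \<longlongrightarrow> l2_inner M f' g) F"
proof -
  have "((\<lambda>n. l2_inner M (f n) g - l2_inner M f' g) \<longlongrightarrow> 0) F"
  proof (rule Lim_null_comparison)
    show "\<forall>\<^sub>F n in F. norm (l2_inner M (f n) g - l2_inner M f' g)
        \<le> l2_norm M (\<lambda>x. f n x - f' x) * l2_norm M g"
    proof (intro always_eventually allI)
      fix n
      show "norm (l2_inner M (f n) g - l2_inner M f' g) \<le> l2_norm M (\<lambda>x. f n x - f' x) * l2_norm M g"
        using l2_Cauchy_Schwarz[OF L2_diff[OF L2(1)[of n] L2(2)] L2(3)]
        by (simp add: l2_inner_diff_left L2)
    qed
    show "((\<lambda>n. l2_norm M (\<lambda>x. f n x - f' x) * l2_norm M g) \<longlongrightarrow> 0) F"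
      using tendsto_mult_left_zero[OF lim] .
  qed
  then show ?thesis by (rule LIM_zero_cancel)
qed

lemma l2_norm_tendsto:
  assumes L2: "\<And>n. f n \<in> L2 M" "f' \<in> L2 M"
    and lim: "((\<lambda>n. l2_norm M (\<lambda>x. f n x - f' x)) \<longlongrightarrow> 0) F"
  shows "((\<lambda>n. l2_norm M (f n)) \<longlongrightarrow> l2_norm M f') F"
proof -
  have "((\<lambda>n. l2_norm M (f n) - l2_norm M f') \<longlongrightarrow> 0) F"
    by (rule Lim_null_comparison[OF _ lim]) (simp add: l2_norm_lipschitz L2)
  then show ?thesis by (rule LIM_zero_cancel)
qed

section \<open>Finite measures: integrability and completeness of L2\<close>

lemma (in finite_measure) L2_const [simp]: "(\<lambda>x. c) \<in> L2 M"
  by (simp add: L2_def)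

lemma (in finite_measure) L2_integrable: "f \<in> L2 M \<Longrightarrow> integrable M f"
  using L2_mult_integrable[of f M "\<lambda>x. 1"] by simp

lemma (in finite_measure) L2_bounded:
  assumes "f \<in> borel_measurable M" "\<And>x. \<bar>f x\<bar> \<le> K"
  shows "f \<in> L2 M"
proof -
  have "norm ((f x)\<^sup>2) \<le> K\<^sup>2" for x
    using power_mono[OF assms(2)[of x], of 2] by simp
  then have "integrable M (\<lambda>x. (f x)\<^sup>2)"
    using assms(1) by (intro integrable_const_bound[of _ "K\<^sup>2"]) auto
  then show ?thesis using assms by (simp add: L2_def)
qed

lemma (in finite_measure) L2_indicator [simp]: "A \<in> sets M \<Longrightarrow> indicator A \<in> L2 M"
  by (rule L2_bounded[of _ 1]) (auto simp: indicator_def)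

lemma (in finite_measure) integral_abs_le_l2_norm:
  assumes "f \<in> L2 M"
  shows "(LINT x|M. \<bar>f x\<bar>) \<le> sqrt (measure M (space M)) * l2_norm M f"
proof -
  have f: "(\<lambda>x. \<bar>f x\<bar>) \<in> L2 M"
    using assms by (auto simp: L2_def intro!: borel_measurable_abs)
  have "\<bar>l2_inner M (\<lambda>x. 1) (\<lambda>x. \<bar>f x\<bar>)\<bar> \<le> l2_norm M (\<lambda>x. 1) * l2_norm M (\<lambda>x. \<bar>f x\<bar>)"
    using f by (intro l2_Cauchy_Schwarz) auto
  moreover have "l2_norm M (\<lambda>x. \<bar>f x\<bar>) = l2_norm M f"
    by (simp add: l2_norm_def l2_inner_def flip: abs_mult)
  moreover have "l2_norm M (\<lambda>x. 1) = sqrt (measure M (space M))"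
    by (simp add: l2_norm_def l2_inner_def)
  ultimately show ?thesis by (simp add: l2_inner_def)
qed

text \<open>On a finite measure space an L2-Cauchy sequence is L1-Cauchy, so a subsequence converges
  almost everywhere; Fatou's lemma then bounds the L2 distance of the whole sequence to that
  limit.\<close>

lemma (in finite_measure) L2_complete:
  assumes L2: "\<And>n::nat. f n \<in> L2 M"
    and Cauchy: "\<And>e. 0 < e \<Longrightarrow> \<exists>n0. \<forall>m\<ge>n0. \<forall>n\<ge>n0. l2_norm M (\<lambda>x. f m x - f n x) < e"
  obtains g where "g \<in> L2 M" "(\<lambda>n. l2_norm M (\<lambda>x. f n x - g x)) \<longlonglongrightarrow> 0"
proof -
  \<comment> \<open>The added 1 keeps V positive even for the zero measure, so that e / V is a
    legitimate tolerance.\<close>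
  define V where "V = sqrt (measure M (space M)) + 1"
  have V: "0 < V" by (simp add: V_def add_nonneg_pos)
  obtain r where r: "strict_mono r" "AE x in M. Cauchy (\<lambda>i. f (r i) x)"
  proof (rule cauchy_L1_AE_cauchy_subseq[of M f])
    show "integrable M (f n)" for n using L2 by (simp add: L2_integrable)
    fix e :: real assume "0 < e"
    then obtain n0 where n0: "\<forall>m\<ge>n0. \<forall>n\<ge>n0. l2_norm M (\<lambda>x. f m x - f n x) < e / V"
      using Cauchy[of "e / V"] V by auto
    have "(LINT x|M. norm (f i x - f j x)) < e" if "i \<ge> n0" "j \<ge> n0" for i j
    proof -
      have "(LINT x|M. norm (f i x - f j x)) \<le> sqrt (measure M (space M)) * l2_norm M (\<lambda>x. f i x - f j x)"
        using integral_abs_le_l2_norm[of "\<lambda>x. f i x - f j x"] L2 by (simp add: L2_intros)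
      also have "\<dots> \<le> V * l2_norm M (\<lambda>x. f i x - f j x)"
        by (intro mult_right_mono) (auto simp: V_def)
      also have "\<dots> < V * (e / V)" using n0 that V by (intro mult_strict_left_mono) auto
      finally show ?thesis using V by simp
    qed
    then show "\<exists>N. \<forall>i\<ge>N. \<forall>j\<ge>N. (LINT x|M. norm (f i x - f j x)) < e" by blast
  qed auto
  define g where "g x = lim (\<lambda>i. f (r i) x)" for x
  have [measurable]: "f n \<in> borel_measurable M" for n using L2 by (simp add: L2_measurable)
  have g_meas [measurable]: "g \<in> borel_measurable M" unfolding g_def by measurable
  have conv: "AE x in M. (\<lambda>i. f (r i) x) \<longlonglongrightarrow> g x"
    using r(2) by eventually_elim (simp add: g_def Cauchy_convergent_iff convergent_LIMSEQ_iff)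
  have bound: "integrable M (\<lambda>x. (f n x - g x)\<^sup>2) \<and> (LINT x|M. (f n x - g x)\<^sup>2) \<le> e\<^sup>2"
    if e: "0 < e" and n: "\<forall>m\<ge>n0. l2_norm M (\<lambda>x. f n x - f m x) < e" for n n0 e
  proof -
    have "(\<integral>\<^sup>+x. ennreal ((f n x - g x)\<^sup>2) \<partial>M) \<le> (\<integral>\<^sup>+x. liminf (\<lambda>i. ennreal ((f n x - f (r i) x)\<^sup>2)) \<partial>M)"
    proof (rule nn_integral_mono_AE, use conv in eventually_elim)
      fix x assume "(\<lambda>i. f (r i) x) \<longlonglongrightarrow> g x"
      then have "(\<lambda>i. ennreal ((f n x - f (r i) x)\<^sup>2)) \<longlonglongrightarrow> ennreal ((f n x - g x)\<^sup>2)"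
        by (intro tendsto_intros) 
      then have "liminf (\<lambda>i. ennreal ((f n x - f (r i) x)\<^sup>2)) = ennreal ((f n x - g x)\<^sup>2)"
        by (rule lim_imp_Liminf[OF trivial_limit_sequentially])
      then show "ennreal ((f n x - g x)\<^sup>2) \<le> liminf (\<lambda>i. ennreal ((f n x - f (r i) x)\<^sup>2))"
        by simp
    qed
    also have "\<dots> \<le> liminf (\<lambda>i. \<integral>\<^sup>+x. ennreal ((f n x - f (r i) x)\<^sup>2) \<partial>M)"
      by (rule nn_integral_liminf) measurable
    also have "\<dots> \<le> ennreal (e\<^sup>2)"
    proof (rule Liminf_le)
      have "(\<integral>\<^sup>+x. ennreal ((f n x - f (r i) x)\<^sup>2) \<partial>M) \<le> ennreal (e\<^sup>2)" if "i \<ge> n0" for i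
      proof -
        have "r i \<ge> n0" using seq_suble[OF r(1), of i] that by simp
        then have "(l2_norm M (\<lambda>x. f n x - f (r i) x))\<^sup>2 \<le> e\<^sup>2"
          using n by (intro power_mono) (auto intro: less_imp_le)
        moreover have "(\<integral>\<^sup>+x. ennreal ((f n x - f (r i) x)\<^sup>2) \<partial>M)
            = ennreal ((l2_norm M (\<lambda>x. f n x - f (r i) x))\<^sup>2)"
          unfolding l2_norm_square l2_inner_def
          by (subst nn_integral_eq_integral) (auto simp: power2_eq_square L2 intro!: L2_mult_integrable L2_diff)
        ultimately show ?thesis by (simp add: ennreal_leI)
      qed
      then show "\<forall>\<^sub>F i in sequentially. (\<integral>\<^sup>+x. ennreal ((f n x - f (r i) x)\<^sup>2) \<partial>M) \<le> ennreal (e\<^sup>2)"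
        by (auto simp: eventually_sequentially)
    qed simp
    finally have le: "(\<integral>\<^sup>+x. ennreal ((f n x - g x)\<^sup>2) \<partial>M) \<le> ennreal (e\<^sup>2)" .
    have int: "integrable M (\<lambda>x. (f n x - g x)\<^sup>2)"
      by (rule integrableI_nonneg) (use le in \<open>auto simp: less_top[symmetric] top_unique\<close>)
    moreover have "ennreal (LINT x|M. (f n x - g x)\<^sup>2) \<le> ennreal (e\<^sup>2)"
      using le nn_integral_eq_integral[OF int] by simp
    ultimately show ?thesis by simp
  qed
  \<comment> \<open>One index suffices for membership: g is f n1 minus the square-integrable
    difference f n1 - g.\<close>
  obtain n1 where n1: "\<forall>m\<ge>n1. \<forall>n\<ge>n1. l2_norm M (\<lambda>x. f m x - f n x) < 1"
    using Cauchy[of 1] by auto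
  have "(\<lambda>x. f n1 x - g x) \<in> L2 M"
    using bound[of 1 n1 n1] n1 by (auto simp: L2_def)
  then have gL2: "g \<in> L2 M"
    using L2_diff[of "f n1" M "\<lambda>x. f n1 x - g x"] L2 by simp
  have "(\<lambda>n. l2_norm M (\<lambda>x. f n x - g x)) \<longlonglongrightarrow> 0"
  proof (rule LIMSEQ_I)
    fix e :: real assume e: "0 < e"
    then obtain n0 where n0: "\<forall>m\<ge>n0. \<forall>n\<ge>n0. l2_norm M (\<lambda>x. f m x - f n x) < e / 2"
      using Cauchy[of "e / 2"] by auto
    have "l2_norm M (\<lambda>x. f n x - g x) \<le> e / 2" if "n \<ge> n0" for n
    proof (rule power2_le_imp_le)
      have "(LINT x|M. (f n x - g x)\<^sup>2) \<le> (e / 2)\<^sup>2"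
        using bound[of "e / 2" n0 n] n0 that e by simp
      then show "(l2_norm M (\<lambda>x. f n x - g x))\<^sup>2 \<le> (e / 2)\<^sup>2"
        by (simp only: l2_norm_square l2_inner_def flip: power2_eq_square)
    qed (use e in simp)
    then show "\<exists>no. \<forall>n\<ge>no. norm (l2_norm M (\<lambda>x. f n x - g x) - 0) < e"
      using e by (intro exI[of _ n0]) (fastforce intro: le_less_trans)
  qed
  with gL2 show thesis by (rule that)
qed

subsection \<open>Semigroups generated by non-negative self-adjoint operators\<close>

text \<open>Semigroup orbits are only known to be differentiable from the right, so the mean value
  theorem is not at hand. If g ended above a line of small positive slope through its initial value,
  then at the last time at or below that line its right derivative relative to the line would be
  negative, and g would lie below the line again immediately afterwards.\<close>

lemma right_derivative_nonpos_imp_le: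
  fixes g :: "real \<Rightarrow> real"
  assumes "a \<le> b" and cont: "continuous_on {a..b} g"
    and deriv: "\<And>s. a \<le> s \<Longrightarrow> s < b \<Longrightarrow> \<exists>D\<le>0. (g has_real_derivative D) (at_right s)"
  shows "g b \<le> g a"
proof (rule field_le_epsilon)
  fix e :: real assume e: "0 < e"
  \<comment> \<open>The line rises by at most e over the whole interval; the 1 in the denominator
    covers a = b.\<close>
  define \<epsilon> where "\<epsilon> = e / (b - a + 1)"
  have \<epsilon>: "0 < \<epsilon>" "\<epsilon> * (b - a) \<le> e"
    using e \<open>a \<le> b\<close> by (simp_all add: \<epsilon>_def field_simps)
  define \<phi> where "\<phi> s = g s - g a - \<epsilon> * (s - a)" for s
  have cont\<phi>: "continuous_on {a..b} \<phi>"
    unfolding \<phi>_def by (intro continuous_intros cont)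
  have "\<phi> b \<le> 0"
  proof (rule ccontr)
    assume b: "\<not> \<phi> b \<le> 0"
    define S where "S = {a..b} \<inter> \<phi> -` {..0}"
    have "closed S" unfolding S_def
      by (intro continuous_closed_preimage cont\<phi>) auto
    moreover have S: "a \<in> S" "S \<subseteq> {a..b}" using \<open>a \<le> b\<close> by (auto simp: S_def \<phi>_def)
    ultimately have "Sup S \<in> S"
      by (intro closed_contains_Sup) (auto intro: bdd_above_mono)
    define s where "s = Sup S"
    have s: "a \<le> s" "s < b" "\<phi> s \<le> 0"
      using \<open>Sup S \<in> S\<close> b by (auto simp: S_def s_def less_le)
    have pos: "0 < \<phi> u" if "s < u" "u \<le> b" for u
    proof (rule ccontr)
      assume "\<not> 0 < \<phi> u"
      then have "u \<in> S" using that s by (auto simp: S_def)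
      then have "u \<le> s" unfolding s_def
        using S by (intro cSup_upper) (auto intro: bdd_above_mono)
      then show False using that by simp
    qed
    obtain D where D: "D \<le> 0" "(g has_real_derivative D) (at_right s)"
      using deriv[of s] s by auto
    have "(\<phi> has_real_derivative (D - \<epsilon>)) (at_right s)"
      unfolding \<phi>_def by (auto intro!: derivative_eq_intros D(2))
    then have "((\<lambda>u. (\<phi> u - \<phi> s) / (u - s)) \<longlongrightarrow> D - \<epsilon>) (at_right s)"
      by (simp add: has_field_derivative_iff)
    moreover have "D - \<epsilon> < 0" using D \<epsilon> by simp
    ultimately have "\<forall>\<^sub>F u in at_right s. (\<phi> u - \<phi> s) / (u - s) < 0"
      by (rule order_tendstoD)
    moreover have "\<forall>\<^sub>F u in at_right s. u \<in> {s<..<b}"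
      using s by (intro eventually_at_right_real)
    ultimately have "\<forall>\<^sub>F u in at_right s. False"
    proof eventually_elim
      case (elim u)
      then have "\<phi> u < \<phi> s" by (simp add: divide_less_0_iff)
      then show False using pos[of u] s elim by simp
    qed
    then show False by simp
  qed
  then show "g b \<le> g a + e" using \<epsilon> by (simp add: \<phi>_def)
qed

text \<open>A set of representatives, not of classes. Two different members cannot agree almost
  everywhere, since their inner product would be 1 instead of 0; so the cardinality is the dimension
  of the span.\<close>

definition l2_orthonormal :: "'a measure \<Rightarrow> ('a \<Rightarrow> real) set \<Rightarrow> bool" where
  "l2_orthonormal M \<Phi> \<longleftrightarrow> finite \<Phi> \<and> \<Phi> \<subseteq> L2 M \<and>
     (\<forall>\<phi>\<in>\<Phi>. \<forall>\<psi>\<in>\<Phi>. l2_inner M \<phi> \<psi> = (if \<phi> = \<psi> then 1 else 0))"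

definition l2_proj :: "'a measure \<Rightarrow> ('a \<Rightarrow> real) set \<Rightarrow> ('a \<Rightarrow> real) \<Rightarrow> 'a \<Rightarrow> real" where
  "l2_proj M \<Phi> f = (\<lambda>x. \<Sum>\<phi>\<in>\<Phi>. l2_inner M f \<phi> * \<phi> x)"

section \<open>Finite orthonormal systems: projections and Bessel's inequality\<close>

context
  fixes M :: "'a measure" and \<Phi>
  assumes \<Phi>: "l2_orthonormal M \<Phi>"
begin

lemma orthonormal_L2: "\<phi> \<in> \<Phi> \<Longrightarrow> \<phi> \<in> L2 M"
  using \<Phi> by (auto simp: l2_orthonormal_def)

lemma l2_proj_L2: "l2_proj M \<Phi> f \<in> L2 M"
  unfolding l2_proj_def by (intro L2_sum orthonormal_L2)

lemma l2_inner_lincomb_orthonormal: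
  assumes "\<psi> \<in> \<Phi>"
  shows "l2_inner M (\<lambda>x. \<Sum>\<phi>\<in>\<Phi>. a \<phi> * \<phi> x) \<psi> = a \<psi>"
proof -
  have "l2_inner M (\<lambda>x. \<Sum>\<phi>\<in>\<Phi>. a \<phi> * \<phi> x) \<psi> = (\<Sum>\<phi>\<in>\<Phi>. a \<phi> * l2_inner M \<phi> \<psi>)"
    using assms by (intro l2_inner_sum_left orthonormal_L2)
  also have "\<dots> = (\<Sum>\<phi>\<in>\<Phi>. if \<phi> = \<psi> then a \<phi> else 0)"
    using \<Phi> assms by (intro sum.cong) (auto simp: l2_orthonormal_def)
  also have "\<dots> = a \<psi>"
    using \<Phi> assms by (simp add: l2_orthonormal_def)
  finally show ?thesis .
qed

lemma l2_inner_proj_left: "\<psi> \<in> \<Phi> \<Longrightarrow> l2_inner M (l2_proj M \<Phi> f) \<psi> = l2_inner M f \<psi>"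
  unfolding l2_proj_def by (rule l2_inner_lincomb_orthonormal)

lemma l2_inner_proj_right:
  assumes "g \<in> L2 M"
  shows "l2_inner M g (l2_proj M \<Phi> f) = (\<Sum>\<phi>\<in>\<Phi>. l2_inner M f \<phi> * l2_inner M g \<phi>)"
  unfolding l2_proj_def by (rule l2_inner_sum_right[OF orthonormal_L2 assms])

lemma l2_norm_proj: "(l2_norm M (l2_proj M \<Phi> f))\<^sup>2 = (\<Sum>\<phi>\<in>\<Phi>. (l2_inner M f \<phi>)\<^sup>2)"
  unfolding l2_norm_square l2_inner_proj_right[OF l2_proj_L2]
  by (simp add: l2_inner_proj_left power2_eq_square)

lemma l2_norm_diff_proj:
  assumes "f \<in> L2 M"
  shows "(l2_norm M (\<lambda>x. f x - l2_proj M \<Phi> f x))\<^sup>2 = (l2_norm M f)\<^sup>2 - (\<Sum>\<phi>\<in>\<Phi>. (l2_inner M f \<phi>)\<^sup>2)"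
proof -
  let ?p = "l2_proj M \<Phi> f"
  have "l2_inner M f ?p = (\<Sum>\<phi>\<in>\<Phi>. (l2_inner M f \<phi>)\<^sup>2)"
    using l2_inner_proj_right[OF assms] by (simp add: power2_eq_square)
  moreover have "l2_inner M ?p ?p = (\<Sum>\<phi>\<in>\<Phi>. (l2_inner M f \<phi>)\<^sup>2)"
    using l2_norm_proj by (simp add: l2_norm_square)
  ultimately show ?thesis
    using assms l2_inner_commute[of M ?p f]
    by (simp add: l2_norm_square l2_inner_diff_left l2_inner_diff_right L2_diff l2_proj_L2)
qed

lemma Bessel:
  assumes "f \<in> L2 M"
  shows "(\<Sum>\<phi>\<in>\<Phi>. (l2_inner M f \<phi>)\<^sup>2) \<le> (l2_norm M f)\<^sup>2"
  using l2_norm_diff_proj[OF assms] zero_le_power2[of "l2_norm M (\<lambda>x. f x - l2_proj M \<Phi> f x)"]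
  by linarith

lemma l2_norm_proj_le:
  assumes "f \<in> L2 M"
  shows "l2_norm M (l2_proj M \<Phi> f) \<le> l2_norm M f"
  using Bessel[OF assms] unfolding l2_norm_proj[symmetric] by (rule power2_le_imp_le) simp

lemma l2_norm_diff_proj_le:
  assumes "f \<in> L2 M"
  shows "l2_norm M (\<lambda>x. f x - l2_proj M \<Phi> f x) \<le> l2_norm M f"
  by (rule power2_le_imp_le) (simp_all add: l2_norm_diff_proj[OF assms] sum_nonneg)

lemma l2_proj_diff:
  assumes "f \<in> L2 M" "g \<in> L2 M"
  shows "l2_proj M \<Phi> (\<lambda>x. f x - g x) = (\<lambda>x. l2_proj M \<Phi> f x - l2_proj M \<Phi> g x)"
proof -
  have "l2_inner M (\<lambda>x. f x - g x) \<phi> = l2_inner M f \<phi> - l2_inner M g \<phi>" if "\<phi> \<in> \<Phi>" for \<phi>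
    using assms orthonormal_L2[OF that] by (rule l2_inner_diff_left)
  then show ?thesis
    unfolding l2_proj_def by (simp add: left_diff_distrib sum_subtractf)
qed

end

text \<open>Isolates what the kernel contributes: norm bounds on [a, 1) and compactness. Contraction
  is not among the axioms; \<open>T_contraction\<close> derives it. In the compactness axiom one
  subsequence serves all times at once, because \<open>energy_compact\<close> fixes it before
  choosing a time from the tolerance.\<close>

locale heat_flow = finite_measure M for M :: "'a measure" +
  fixes L :: "('a \<Rightarrow> real) rel" and T :: "real \<Rightarrow> ('a \<Rightarrow> real) \<Rightarrow> ('a \<Rightarrow> real)"
  assumes selfadjoint: "selfadjoint_operator M L"
    and nonneg: "nonneg_operator M L"
    and semigroup: "heat_semigroup M L T"
    and locally_bounded: "\<And>a. 0 < a \<Longrightarrow>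
      \<exists>K. \<forall>t f. a \<le> t \<and> t < 1 \<and> f \<in> L2 M \<longrightarrow> l2_norm M (T t f) \<le> K * l2_norm M f"
    and compact: "\<And>f B. (\<And>n::nat. f n \<in> L2 M) \<Longrightarrow> (\<And>n. l2_norm M (f n) \<le> B) \<Longrightarrow>
      \<exists>r :: nat \<Rightarrow> nat. strict_mono r \<and> (\<forall>t e. 0 < t \<and> t < 1 \<and> 0 < e \<longrightarrow> (\<exists>n0. \<forall>m\<ge>n0. \<forall>n\<ge>n0.
        l2_norm M (\<lambda>x. T t (f (r m)) x - T t (f (r n)) x) < e))"
begin

lemma operator: "l2_operator M L"
  using selfadjoint by (simp add: selfadjoint_operator_def)

lemma L_L2: "(f, h) \<in> L \<Longrightarrow> f \<in> L2 M \<and> h \<in> L2 M"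
proof -
  have "L \<subseteq> L2 M \<times> L2 M"
    using operator unfolding l2_operator_def by (elim conjE)
  then show "(f, h) \<in> L \<Longrightarrow> f \<in> L2 M \<and> h \<in> L2 M" by auto
qed

lemma L_lincomb:
  "(f, h) \<in> L \<Longrightarrow> (f', h') \<in> L \<Longrightarrow>
    ((\<lambda>x. a * f x + b * f' x), (\<lambda>x. a * h x + b * h' x)) \<in> L"
proof -
  have "\<forall>f g f' g' a b. (f, g) \<in> L \<and> (f', g') \<in> L \<longrightarrow>
      ((\<lambda>x. a * f x + b * f' x), (\<lambda>x. a * g x + b * g' x)) \<in> L"
    using operator unfolding l2_operator_def by (elim conjE)
  then show "(f, h) \<in> L \<Longrightarrow> (f', h') \<in> L \<Longrightarrow>
    ((\<lambda>x. a * f x + b * f' x), (\<lambda>x. a * h x + b * h' x)) \<in> L" by blast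
qed

lemma L_zero: "((\<lambda>x. 0), (\<lambda>x. 0)) \<in> L"
  using operator unfolding l2_operator_def by (elim conjE)

lemma L_scale: "(f, h) \<in> L \<Longrightarrow> ((\<lambda>x. a * f x), (\<lambda>x. a * h x)) \<in> L"
  using L_lincomb[of f h f h a 0] by simp

lemma L_diff: "(f, h) \<in> L \<Longrightarrow> (f', h') \<in> L \<Longrightarrow> ((\<lambda>x. f x - f' x), (\<lambda>x. h x - h' x)) \<in> L"
  using L_lincomb[of f h f' h' 1 "-1"] by simp

lemma L_sum:
  "(\<And>i. i \<in> I \<Longrightarrow> (f i, h i) \<in> L) \<Longrightarrow>
    ((\<lambda>x. \<Sum>i\<in>I. a i * f i x), (\<lambda>x. \<Sum>i\<in>I. a i * h i x)) \<in> L"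
proof (induction I rule: infinite_finite_induct)
  case (insert i I)
  then show ?case
    using L_lincomb[of "f i" "h i" "\<lambda>x. \<Sum>i\<in>I. a i * f i x" "\<lambda>x. \<Sum>i\<in>I. a i * h i x" "a i" 1]
    by simp
qed (simp_all add: L_zero)

lemma L_sym:
  assumes "(f, h) \<in> L" "(u, v) \<in> L"
  shows "l2_inner M h u = l2_inner M f v"
proof -
  have "(u, v) \<in> l2_adjoint M L"
    using selfadjoint assms by (simp add: selfadjoint_operator_def)
  then show ?thesis using assms(1) by (auto simp: l2_adjoint_def)
qed

lemma L_adjointI:
  assumes "f \<in> L2 M" "h \<in> L2 M"
    and "\<And>u v. (u, v) \<in> L \<Longrightarrow> l2_inner M v f = l2_inner M u h"
  shows "(f, h) \<in> L"
proof -
  have "(f, h) \<in> l2_adjoint M L"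
    using assms by (auto simp: l2_adjoint_def)
  then show ?thesis using selfadjoint by (simp add: selfadjoint_operator_def)
qed

lemma L_nonneg: "(f, h) \<in> L \<Longrightarrow> 0 \<le> l2_inner M h f"
  using nonneg by (auto simp: nonneg_operator_def)

lemma L_dense:
  assumes "f \<in> L2 M" "0 < e"
  obtains u v where "(u, v) \<in> L" "l2_norm M (\<lambda>x. f x - u x) < e"
proof -
  have "\<exists>u\<in>Domain L. l2_norm M (\<lambda>x. f x - u x) < e"
    using selfadjoint assms by (simp add: selfadjoint_operator_def densely_defined_def)
  then show thesis using that by blast
qed

text \<open>Positivity is asked for on the span of \<open>f\<close> and \<open>u\<close> only: when
  c is the infimum of the Rayleigh quotient on the complement of the eigenfunctions, the form is
  known to be non-negative just there.\<close>

lemma L_form_Cauchy_Schwarz: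
  assumes form: "\<And>a b. 0 \<le> l2_inner M (\<lambda>x. a * h x + b * v x) (\<lambda>x. a * f x + b * u x)
      - c * l2_inner M (\<lambda>x. a * f x + b * u x) (\<lambda>x. a * f x + b * u x)"
    and L: "(f, h) \<in> L" "(u, v) \<in> L"
  shows "(l2_inner M h u - c * l2_inner M f u)\<^sup>2
    \<le> (l2_inner M h f - c * l2_inner M f f) * (l2_inner M v u - c * l2_inner M u u)"
proof (rule quadratic_form_discriminant)
  fix a b
  have sym: "l2_inner M v f = l2_inner M h u" "l2_inner M u f = l2_inner M f u"
    using L_sym[OF L] by (simp_all add: l2_inner_commute)
  have [simp]: "f \<in> L2 M" "h \<in> L2 M" "u \<in> L2 M" "v \<in> L2 M" using L L_L2 by auto
  have "0 \<le> l2_inner M (\<lambda>x. a * h x + b * v x) (\<lambda>x. a * f x + b * u x)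
      - c * l2_inner M (\<lambda>x. a * f x + b * u x) (\<lambda>x. a * f x + b * u x)"
    by (rule form)
  also have "\<dots> = a\<^sup>2 * (l2_inner M h f - c * l2_inner M f f)
      + 2 * a * b * (l2_inner M h u - c * l2_inner M f u)
      + b\<^sup>2 * (l2_inner M v u - c * l2_inner M u u)"
    by (simp add: l2_inner_simps L2_intros sym power2_eq_square algebra_simps)
  finally show "0 \<le> \<dots>" .
qed

section \<open>Continuity and right derivatives of semigroup orbits\<close>

lemma T_bounded_operator: "0 \<le> t \<Longrightarrow> l2_bounded_operator M (T t)"
  using semigroup by (simp add: heat_semigroup_def)

lemma T_L2: "0 \<le> t \<Longrightarrow> f \<in> L2 M \<Longrightarrow> T t f \<in> L2 M"
  using T_bounded_operator[of t] by (simp add: l2_bounded_operator_def)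

lemma T_lincomb:
  "0 \<le> t \<Longrightarrow> f \<in> L2 M \<Longrightarrow> g \<in> L2 M \<Longrightarrow>
    AE x in M. T t (\<lambda>y. a * f y + b * g y) x = a * T t f x + b * T t g x"
  using T_bounded_operator[of t] by (simp add: l2_bounded_operator_def)

lemma T_bound:
  assumes "0 \<le> t"
  obtains K where "0 \<le> K" "\<And>f. f \<in> L2 M \<Longrightarrow> l2_norm M (T t f) \<le> K * l2_norm M f"
proof -
  obtain K where K: "\<forall>f\<in>L2 M. l2_norm M (T t f) \<le> K * l2_norm M f"
    using T_bounded_operator[OF assms] by (auto simp: l2_bounded_operator_def)
  have "l2_norm M (T t f) \<le> \<bar>K\<bar> * l2_norm M f" if "f \<in> L2 M" for f
    using K[rule_format, OF that] mult_right_mono[OF abs_ge_self[of K] l2_norm_nonneg[of M f]]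
    by linarith
  then show thesis by (intro that[of "\<bar>K\<bar>"]) auto
qed

lemma T_diff:
  "0 \<le> t \<Longrightarrow> f \<in> L2 M \<Longrightarrow> g \<in> L2 M \<Longrightarrow>
    AE x in M. T t (\<lambda>y. f y - g y) x = T t f x - T t g x"
  using T_lincomb[of t f g 1 "-1"] by simp

lemma T_norm_diff:
  assumes "0 \<le> t" "f \<in> L2 M" "g \<in> L2 M"
  shows "l2_norm M (\<lambda>x. T t f x - T t g x) = l2_norm M (T t (\<lambda>x. f x - g x))"
proof (rule l2_norm_cong_AE)
  show "AE x in M. T t f x - T t g x = T t (\<lambda>x. f x - g x) x"
    using T_diff[OF assms] by eventually_elim simp
qed (use assms in \<open>auto intro: L2_diff T_L2\<close>)

lemma T_zero: "f \<in> L2 M \<Longrightarrow> AE x in M. T 0 f x = f x"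
  using semigroup by (simp add: heat_semigroup_def)

lemma T_add: "0 \<le> s \<Longrightarrow> 0 \<le> t \<Longrightarrow> f \<in> L2 M \<Longrightarrow> AE x in M. T (s + t) f x = T s (T t f) x"
  using semigroup by (simp add: heat_semigroup_def)

lemma T_increment:
  assumes "0 \<le> s" "0 \<le> t" "f \<in> L2 M"
  shows "AE x in M. T (t + s) f x - T t f x = T t (\<lambda>x. T s f x - f x) x"
  using T_add[OF assms(2,1,3)] T_diff[OF assms(2) T_L2[OF assms(1,3)] assms(3)]
  by eventually_elim simp

lemma T_increment_norm:
  assumes "0 \<le> s" "0 \<le> t" "f \<in> L2 M"
  shows "l2_norm M (\<lambda>x. T (t + s) f x - T t f x) = l2_norm M (T t (\<lambda>x. T s f x - f x))"
  by (rule l2_norm_cong_AE) (use assms T_increment in \<open>auto intro!: L2_diff T_L2\<close>)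

lemma T_strongly_continuous_0:
  "f \<in> L2 M \<Longrightarrow> ((\<lambda>t. l2_norm M (\<lambda>x. T t f x - f x)) \<longlongrightarrow> 0) (at_right 0)"
  using semigroup by (simp add: heat_semigroup_def)

lemma L_eq_generator:
  "(f, h) \<in> L \<longleftrightarrow> f \<in> L2 M \<and> h \<in> L2 M \<and>
    ((\<lambda>t. l2_norm M (\<lambda>x. (T t f x - f x) / t + h x)) \<longlongrightarrow> 0) (at_right 0)"
proof -
  have "L = {(f, h). f \<in> L2 M \<and> h \<in> L2 M \<and>
      ((\<lambda>t. l2_norm M (\<lambda>x. (T t f x - f x) / t - (- h x))) \<longlongrightarrow> 0) (at_right 0)}"
    using semigroup by (simp only: heat_semigroup_def)
  then show ?thesis by (subst \<open>L = _\<close>) simp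
qed

text \<open>The bounded operator T t carries the difference quotient at time 0 to the one at time
  t.\<close>

lemma T_generator:
  assumes "(f, h) \<in> L" "0 \<le> t"
  shows "((\<lambda>s. l2_norm M (\<lambda>x. (T (t + s) f x - T t f x) / s + T t h x)) \<longlongrightarrow> 0) (at_right 0)"
proof -
  have f: "f \<in> L2 M" and h: "h \<in> L2 M" using assms L_L2 by auto
  obtain K where K: "\<And>f. f \<in> L2 M \<Longrightarrow> l2_norm M (T t f) \<le> K * l2_norm M f"
    using T_bound[OF assms(2)] by blast
  let ?q = "\<lambda>s x. (T s f x - f x) / s + h x"
  have q: "?q s \<in> L2 M" if "0 \<le> s" for s
    using L2_lincomb[OF L2_diff[OF T_L2[OF that f] f] h, of "1 / s" 1] by simp
  have "((\<lambda>s. K * l2_norm M (?q s)) \<longlongrightarrow> 0) (at_right 0)"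
    using assms(1) by (intro tendsto_mult_right_zero) (simp add: L_eq_generator)
  then show ?thesis
  proof (rule Lim_null_comparison[rotated])
    show "\<forall>\<^sub>F s in at_right 0.
      norm (l2_norm M (\<lambda>x. (T (t + s) f x - T t f x) / s + T t h x)) \<le> K * l2_norm M (?q s)"
      using eventually_at_right_less[of "0::real"]
    proof eventually_elim
      fix s :: real assume s: "0 < s"
      have d: "(\<lambda>x. T s f x - f x) \<in> L2 M" using s f by (intro L2_diff T_L2) auto
      have "AE x in M. (T (t + s) f x - T t f x) / s + T t h x = T t (?q s) x"
        using T_increment[OF _ assms(2) f, of s] T_lincomb[OF assms(2) d h, of "1 / s" 1] s
        by auto
      moreover have "(\<lambda>x. (T (t + s) f x - T t f x) / s + T t h x) \<in> L2 M"
        using s assms(2) by (intro L2_add L2_divide L2_diff T_L2 f h; simp)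
      moreover have "T t (?q s) \<in> L2 M"
        using s assms(2) by (intro T_L2 q) auto
      ultimately have "l2_norm M (\<lambda>x. (T (t + s) f x - T t f x) / s + T t h x) = l2_norm M (T t (?q s))"
        by (intro l2_norm_cong_AE)
      then show "norm (l2_norm M (\<lambda>x. (T (t + s) f x - T t f x) / s + T t h x)) \<le> K * l2_norm M (?q s)"
        using K[OF q[of s]] s by simp
    qed
  qed
qed

text \<open>Reading T (t + s) as T s (T t f) turns the right derivative of the orbit at t into the
  generator quotient of T t f at 0. So the flow preserves the domain and commutes with L.\<close>

lemma T_dom:
  assumes "(f, h) \<in> L" "0 \<le> t"
  shows "(T t f, T t h) \<in> L"
  unfolding L_eq_generator
proof (intro conjI)
  have f: "f \<in> L2 M" and h: "h \<in> L2 M" using assms L_L2 by auto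
  then show tf: "T t f \<in> L2 M" and th: "T t h \<in> L2 M" using assms by (auto intro: T_L2)
  show "((\<lambda>s. l2_norm M (\<lambda>x. (T s (T t f) x - T t f x) / s + T t h x)) \<longlongrightarrow> 0) (at_right 0)"
  proof (rule Lim_transform_eventually[OF T_generator[OF assms]])
    show "\<forall>\<^sub>F s in at_right 0. l2_norm M (\<lambda>x. (T (t + s) f x - T t f x) / s + T t h x)
        = l2_norm M (\<lambda>x. (T s (T t f) x - T t f x) / s + T t h x)"
      using eventually_at_right_less[of "0::real"]
    proof eventually_elim
      fix s :: real assume s: "0 < s"
      have "AE x in M. T (t + s) f x = T s (T t f) x"
        using T_add[of s t f] s assms(2) f by (simp add: add.commute)
      then have "AE x in M. (T (t + s) f x - T t f x) / s + T t h x
          = (T s (T t f) x - T t f x) / s + T t h x"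
        by eventually_elim simp
      moreover have "(\<lambda>x. (T (t + s) f x - T t f x) / s + T t h x) \<in> L2 M"
        "(\<lambda>x. (T s (T t f) x - T t f x) / s + T t h x) \<in> L2 M"
        using s assms(2) by (intro L2_add L2_divide L2_diff T_L2 f h tf; simp)+
      ultimately show "l2_norm M (\<lambda>x. (T (t + s) f x - T t f x) / s + T t h x)
        = l2_norm M (\<lambda>x. (T s (T t f) x - T t f x) / s + T t h x)"
        by (intro l2_norm_cong_AE)
    qed
  qed
qed

text \<open>Factoring out T (min s t) reduces both sides of t to strong continuity at 0, provided
  that factor stays bounded for s near t. Contraction cannot supply the bound, as its proof rests on
  this continuity: for t = 0 the factor is T 0 itself, for t > 0 \<open>locally_bounded\<close> is
  applied on [t/2, 1).\<close>

lemma T_continuous: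
  assumes f: "f \<in> L2 M" and t: "0 \<le> t" "t < 1" and "0 < e"
  obtains d where "0 < d"
    "\<And>s. 0 \<le> s \<Longrightarrow> s < 1 \<Longrightarrow> \<bar>s - t\<bar> < d \<Longrightarrow> l2_norm M (\<lambda>x. T s f x - T t f x) < e"
proof -
  obtain K d1 where K: "0 < K" "0 < d1" and K_bound: "\<And>s g. 0 \<le> s \<Longrightarrow> s < 1 \<Longrightarrow> \<bar>s - t\<bar> < d1 \<Longrightarrow> g \<in> L2 M
      \<Longrightarrow> l2_norm M (T (min s t) g) \<le> K * l2_norm M g"
  proof (cases "t = 0")
    case True
    obtain K where K: "0 \<le> K" "\<And>f. f \<in> L2 M \<Longrightarrow> l2_norm M (T 0 f) \<le> K * l2_norm M f"
      using T_bound[of 0] by auto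
    have "l2_norm M (T 0 f) \<le> (K + 1) * l2_norm M f" if "f \<in> L2 M" for f
      using K(2)[OF that] by (simp add: distrib_right add_increasing2)
    then show ?thesis using True K(1) by (intro that[of "K + 1" 1]) (auto simp: min_def)
  next
    case False
    then have "0 < t" using t by simp
    then obtain K where K: "\<And>s f. t / 2 \<le> s \<Longrightarrow> s < 1 \<Longrightarrow> f \<in> L2 M \<Longrightarrow> l2_norm M (T s f) \<le> K * l2_norm M f"
      using locally_bounded[of "t / 2"] by auto
    have "l2_norm M (T (min s t) g) \<le> (\<bar>K\<bar> + 1) * l2_norm M g"
      if "0 \<le> s" "s < 1" "\<bar>s - t\<bar> < t / 2" "g \<in> L2 M" for s g
    proof -
      have "l2_norm M (T (min s t) g) \<le> K * l2_norm M g"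
        using that t by (intro K) (auto simp: min_def abs_if split: if_splits)
      also have "\<dots> \<le> (\<bar>K\<bar> + 1) * l2_norm M g" by (intro mult_right_mono) auto
      finally show ?thesis .
    qed
    then show ?thesis using \<open>0 < t\<close> by (intro that[of "\<bar>K\<bar> + 1" "t / 2"]) auto
  qed
  have "\<forall>\<^sub>F s in at_right 0. l2_norm M (\<lambda>x. T s f x - f x) < e / K"
    using order_tendstoD(2)[OF T_strongly_continuous_0[OF f], of "e / K"] \<open>0 < e\<close> K by simp
  then obtain d2 where d2: "0 < d2" "\<And>s. 0 < s \<Longrightarrow> s < d2 \<Longrightarrow> l2_norm M (\<lambda>x. T s f x - f x) < e / K"
    unfolding eventually_at_right_field by auto
  show thesis
  proof (rule that[of "min d1 d2"])
    fix s assume s: "0 \<le> s" "s < 1" "\<bar>s - t\<bar> < min d1 d2"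
    show "l2_norm M (\<lambda>x. T s f x - T t f x) < e"
    proof (cases "s = t")
      case False
      let ?h = "\<bar>s - t\<bar>"
      have "min s t + ?h = max s t" by (simp add: min_def max_def)
      then have "l2_norm M (\<lambda>x. T (max s t) f x - T (min s t) f x)
          = l2_norm M (T (min s t) (\<lambda>x. T ?h f x - f x))"
        using T_increment_norm[of ?h "min s t" f] s t f by simp
      also have "\<dots> \<le> K * l2_norm M (\<lambda>x. T ?h f x - f x)"
        using s f by (intro K_bound) (auto intro!: L2_diff T_L2)
      also have "\<dots> < e"
        using d2(2)[of ?h] False s K by (simp add: field_simps)
      finally show ?thesis
        using l2_norm_diff_commute[of M "T s f" "T t f"] by (auto simp: min_def max_def split: if_splits)
    qed (use \<open>0 < e\<close> in simp)
  qed (use K d2 in auto)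
qed

lemma continuous_on_T_norm:
  assumes "f \<in> L2 M" "w \<in> L2 M" "b < 1"
  shows "continuous_on {0..b} (\<lambda>s. l2_norm M (\<lambda>x. T s f x - w x))"
  unfolding continuous_on_iff
proof (intro ballI allI impI)
  fix t e :: real assume t: "t \<in> {0..b}" and e: "0 < e"
  obtain d where d: "0 < d"
    "\<And>s. 0 \<le> s \<Longrightarrow> s < 1 \<Longrightarrow> \<bar>s - t\<bar> < d \<Longrightarrow> l2_norm M (\<lambda>x. T s f x - T t f x) < e"
    using T_continuous[OF assms(1) _ _ e, of t] t assms(3) by auto
  have "dist (l2_norm M (\<lambda>x. T s f x - w x)) (l2_norm M (\<lambda>x. T t f x - w x)) < e"
    if "s \<in> {0..b}" "dist s t < d" for s
  proof -
    have "\<bar>l2_norm M (\<lambda>x. T s f x - w x) - l2_norm M (\<lambda>x. T t f x - w x)\<bar>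
        \<le> l2_norm M (\<lambda>x. (T s f x - w x) - (T t f x - w x))"
      using that t assms by (intro l2_norm_lipschitz) (auto intro!: L2_diff T_L2)
    then show ?thesis using d(2)[of s] that assms by (simp add: dist_real_def)
  qed
  then show "\<exists>d>0. \<forall>s\<in>{0..b}. dist s t < d \<longrightarrow>
      dist (l2_norm M (\<lambda>x. T s f x - w x)) (l2_norm M (\<lambda>x. T t f x - w x)) < e"
    using d(1) by blast
qed

lemma continuous_on_T_inner:
  assumes f: "f \<in> L2 M" and w: "w \<in> L2 M" and b: "b < 1"
  shows "continuous_on {0..b} (\<lambda>s. l2_inner M (T s f) w)"
proof -
  have polar: "l2_inner M (T s f) w
      = ((l2_norm M (\<lambda>x. T s f x - 0))\<^sup>2 + (l2_norm M w)\<^sup>2 - (l2_norm M (\<lambda>x. T s f x - w x))\<^sup>2) / 2"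
    if "s \<in> {0..b}" for s
    using that f w l2_inner_commute[of M w "T s f"]
    by (simp add: l2_norm_square l2_inner_simps L2_intros T_L2)
  show ?thesis
    by (subst continuous_on_cong[OF refl polar], assumption)
      (intro continuous_intros continuous_on_T_norm f w b L2_zero; simp)
qed

lemma T_inner_right_derivative:
  assumes fh: "(f, h) \<in> L" and "0 \<le> t" and w: "w \<in> L2 M"
  shows "((\<lambda>s. l2_inner M (T s f) w) has_real_derivative - l2_inner M (T t h) w) (at_right t)"
proof -
  have f: "f \<in> L2 M" and h: "h \<in> L2 M" using fh L_L2 by auto
  let ?q = "\<lambda>s x. (T (t + s) f x - T t f x) / s + T t h x"
  have "((\<lambda>s. l2_norm M (?q s) * l2_norm M w) \<longlongrightarrow> 0) (at_right 0)"
    by (rule tendsto_mult_left_zero[OF T_generator[OF fh \<open>0 \<le> t\<close>]])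
  then have "((\<lambda>s. (l2_inner M (T (t + s) f) w - l2_inner M (T t f) w) / s - - l2_inner M (T t h) w)
      \<longlongrightarrow> 0) (at_right 0)"
  proof (rule Lim_null_comparison[rotated])
    show "\<forall>\<^sub>F s in at_right 0.
      norm ((l2_inner M (T (t + s) f) w - l2_inner M (T t f) w) / s - - l2_inner M (T t h) w)
        \<le> l2_norm M (?q s) * l2_norm M w"
      using eventually_at_right_less[of "0::real"]
    proof eventually_elim
      fix s :: real assume s: "0 < s"
      have L2s: "T (t + s) f \<in> L2 M" "T t f \<in> L2 M" "T t h \<in> L2 M"
        using s f h \<open>0 \<le> t\<close> by (auto intro: T_L2)
      have q: "?q s = (\<lambda>x. (1 / s) * (T (t + s) f x - T t f x) + T t h x)" by simp
      have "?q s \<in> L2 M" unfolding q using L2s by (intro L2_intros)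
      moreover have "l2_inner M (?q s) w
          = (l2_inner M (T (t + s) f) w - l2_inner M (T t f) w) / s + l2_inner M (T t h) w"
        unfolding q using L2s w by (simp only: l2_inner_simps L2_intros) simp
      ultimately show "norm ((l2_inner M (T (t + s) f) w - l2_inner M (T t f) w) / s - - l2_inner M (T t h) w)
        \<le> l2_norm M (?q s) * l2_norm M w"
        using l2_Cauchy_Schwarz[of "?q s" M w] w by simp
    qed
  qed
  then have "((\<lambda>s. (l2_inner M (T (t + s) f) w - l2_inner M (T t f) w) / s)
      \<longlongrightarrow> - l2_inner M (T t h) w) (at_right 0)"
    by (rule LIM_zero_cancel)
  then show ?thesis
    unfolding has_field_derivative_iff filterlim_at_right_to_0[of _ _ t]
    by (simp add: add.commute)
qed

text \<open>The increment of the squared norm is a linear term, handled by the inner product with a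
  fixed vector, plus the squared norm of the increment of the orbit, which is of second order. The
  shift w is 0 for decay rates and f for the distance from the start.\<close>

lemma T_norm_right_derivative:
  assumes fh: "(f, h) \<in> L" and "0 \<le> t" and w: "w \<in> L2 M"
  shows "((\<lambda>s. (l2_norm M (\<lambda>x. T s f x - w x))\<^sup>2) has_real_derivative
    - 2 * l2_inner M (T t h) (\<lambda>x. T t f x - w x)) (at_right t)"
proof -
  have f: "f \<in> L2 M" and h: "h \<in> L2 M" using fh L_L2 by auto
  have tf: "T t f \<in> L2 M" and th: "T t h \<in> L2 M" using f h \<open>0 \<le> t\<close> by (auto intro: T_L2)
  let ?u = "\<lambda>x. T t f x - w x"
  let ?\<delta> = "\<lambda>s x. T (t + s) f x - T t f x"
  have u: "?u \<in> L2 M" using tf w by (rule L2_diff)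
  have "((\<lambda>s. (l2_inner M (T (t + s) f) ?u - l2_inner M (T t f) ?u) / s)
      \<longlongrightarrow> - l2_inner M (T t h) ?u) (at_right 0)"
    using T_inner_right_derivative[OF fh \<open>0 \<le> t\<close> u]
    unfolding has_field_derivative_iff filterlim_at_right_to_0[of _ _ t] by (simp add: add.commute)
  \<comment> \<open>The norm of the increment divided by s is bounded by the bracket, so its square
    divided by s is at most s times a bounded quantity.\<close>
  moreover have "((\<lambda>s. s * (l2_norm M (\<lambda>x. ?\<delta> s x / s + T t h x) + l2_norm M (T t h))\<^sup>2)
      \<longlongrightarrow> 0 * (0 + l2_norm M (T t h))\<^sup>2) (at_right 0)"
    by (intro tendsto_intros T_generator[OF fh \<open>0 \<le> t\<close>])
  then have "((\<lambda>s. (l2_norm M (?\<delta> s))\<^sup>2 / s) \<longlongrightarrow> 0) (at_right 0)"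
  proof (rule Lim_null_comparison[rotated, OF tendsto_eq_rhs])
    show "\<forall>\<^sub>F s in at_right 0. norm ((l2_norm M (?\<delta> s))\<^sup>2 / s)
        \<le> s * (l2_norm M (\<lambda>x. ?\<delta> s x / s + T t h x) + l2_norm M (T t h))\<^sup>2"
      using eventually_at_right_less[of "0::real"]
    proof eventually_elim
      fix s :: real assume s: "0 < s"
      have d: "?\<delta> s \<in> L2 M" using s f tf \<open>0 \<le> t\<close> by (intro L2_diff T_L2) auto
      have q: "(\<lambda>x. ?\<delta> s x / s + T t h x) \<in> L2 M"
        using L2_lincomb[OF d th, of "1 / s" 1] by simp
      have "l2_norm M (?\<delta> s) / s = l2_norm M (\<lambda>x. ?\<delta> s x / s)"
        using l2_norm_scale[of M "1 / s" "?\<delta> s"] s by simp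
      also have "\<dots> \<le> l2_norm M (\<lambda>x. ?\<delta> s x / s + T t h x) + l2_norm M (T t h)"
        using l2_norm_add[OF q L2_scale[OF th, of "-1"]] l2_norm_scale[of M "-1" "T t h"] by simp
      finally have "s * (l2_norm M (?\<delta> s) / s)\<^sup>2
          \<le> s * (l2_norm M (\<lambda>x. ?\<delta> s x / s + T t h x) + l2_norm M (T t h))\<^sup>2"
        using s by (intro mult_left_mono power_mono) auto
      then show "norm ((l2_norm M (?\<delta> s))\<^sup>2 / s)
        \<le> s * (l2_norm M (\<lambda>x. ?\<delta> s x / s + T t h x) + l2_norm M (T t h))\<^sup>2"
        using s by (simp add: power_divide power2_eq_square)
    qed
  qed simp
  ultimately have "((\<lambda>s. 2 * ((l2_inner M (T (t + s) f) ?u - l2_inner M (T t f) ?u) / s)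
      + (l2_norm M (?\<delta> s))\<^sup>2 / s) \<longlongrightarrow> 2 * (- l2_inner M (T t h) ?u) + 0) (at_right 0)"
    by (intro tendsto_intros)
  then have "((\<lambda>s. ((l2_norm M (\<lambda>x. T (t + s) f x - w x))\<^sup>2 - (l2_norm M ?u)\<^sup>2) / s)
      \<longlongrightarrow> - 2 * l2_inner M (T t h) ?u) (at_right 0)"
  proof (rule Lim_transform_eventually[OF tendsto_eq_rhs])
    show "\<forall>\<^sub>F s in at_right 0.
      2 * ((l2_inner M (T (t + s) f) ?u - l2_inner M (T t f) ?u) / s) + (l2_norm M (?\<delta> s))\<^sup>2 / s
        = ((l2_norm M (\<lambda>x. T (t + s) f x - w x))\<^sup>2 - (l2_norm M ?u)\<^sup>2) / s"
      using eventually_at_right_less[of "0::real"]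
    proof eventually_elim
      fix s :: real assume s: "0 < s"
      have tsf: "T (t + s) f \<in> L2 M" using s f \<open>0 \<le> t\<close> by (intro T_L2) auto
      have "2 * (l2_inner M (T (t + s) f) ?u - l2_inner M (T t f) ?u) + (l2_norm M (?\<delta> s))\<^sup>2
          = (l2_norm M (\<lambda>x. T (t + s) f x - w x))\<^sup>2 - (l2_norm M ?u)\<^sup>2"
        using tsf tf w l2_inner_commute[of M "T t f" "T (t + s) f"] l2_inner_commute[of M w "T (t + s) f"]
          l2_inner_commute[of M w "T t f"]
        by (simp add: l2_norm_square l2_inner_simps L2_intros)
      then show "2 * ((l2_inner M (T (t + s) f) ?u - l2_inner M (T t f) ?u) / s) + (l2_norm M (?\<delta> s))\<^sup>2 / s
        = ((l2_norm M (\<lambda>x. T (t + s) f x - w x))\<^sup>2 - (l2_norm M ?u)\<^sup>2) / s"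
        using s by (simp add: field_simps)
    qed
  qed simp
  then show ?thesis
    unfolding has_field_derivative_iff filterlim_at_right_to_0[of _ _ t]
    by (simp add: add.commute)
qed

text \<open>Gronwall's argument: exp (2 c s) |T s f|^2 is non-increasing. It is used with c = 0 for
  contraction and with c = w off the low eigenfunctions.\<close>

lemma T_decay:
  assumes fh: "(f, h) \<in> L" and t: "0 \<le> t" "t < 1"
    and rate: "\<And>s. 0 \<le> s \<Longrightarrow> s < t \<Longrightarrow> c * (l2_norm M (T s f))\<^sup>2 \<le> l2_inner M (T s h) (T s f)"
  shows "l2_norm M (T t f) \<le> exp (- c * t) * l2_norm M f"
proof -
  have f: "f \<in> L2 M" and h: "h \<in> L2 M" using fh L_L2 by auto
  define g where "g s = exp (2 * c * s) * (l2_norm M (\<lambda>x. T s f x - 0))\<^sup>2" for s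
  have "g t \<le> g 0"
  proof (rule right_derivative_nonpos_imp_le[of 0 t g])
    show "continuous_on {0..t} g"
      unfolding g_def by (intro continuous_intros continuous_on_T_norm f t L2_zero)
    fix s assume s: "0 \<le> s" "s < t"
    have exp_deriv: "((\<lambda>s. exp (2 * c * s)) has_real_derivative 2 * c * exp (2 * c * s)) (at_right s)"
      by (auto intro!: derivative_eq_intros)
    let ?D = "exp (2 * c * s) * (2 * (c * (l2_norm M (T s f))\<^sup>2 - l2_inner M (T s h) (T s f)))"
    have "(g has_real_derivative ?D) (at_right s)"
      unfolding g_def
      by (rule DERIV_cong[OF DERIV_mult[OF exp_deriv T_norm_right_derivative[OF fh s(1) L2_zero]]])
        (simp add: algebra_simps)
    moreover have "?D \<le> 0" using rate[OF s] by (intro mult_nonneg_nonpos) auto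
    ultimately show "\<exists>D\<le>0. (g has_real_derivative D) (at_right s)" by blast
  qed (use t in auto)
  moreover have "l2_norm M (T 0 f) = l2_norm M f"
    using f T_zero by (intro l2_norm_cong_AE) (auto intro: T_L2)
  ultimately have "exp (2 * c * t) * (l2_norm M (T t f))\<^sup>2 \<le> (l2_norm M f)\<^sup>2"
    by (simp add: g_def)
  then have "(l2_norm M (T t f))\<^sup>2 \<le> exp (- (2 * c * t)) * (l2_norm M f)\<^sup>2"
    by (simp add: exp_minus field_simps)
  also have "\<dots> = (exp (- c * t) * l2_norm M f)\<^sup>2"
    by (simp add: power_mult_distrib flip: exp_double)
  finally show ?thesis by (rule power2_le_imp_le) simp
qed

lemma T_contraction:
  assumes "(f, h) \<in> L" "0 \<le> t" "t < 1"
  shows "l2_norm M (T t f) \<le> l2_norm M f"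
  using T_decay[OF assms, of 0] L_nonneg[OF T_dom[OF assms(1)]] by simp

text \<open>Spectral calculus would give this from (1 - exp (- x))^2 <= x / 2. Here the left side is
  differentiated instead: its slope - 2 <L T s f, T s f> + 2 <L T s f, f> is at most <L f, f> / 2 by
  Cauchy-Schwarz for the energy form.\<close>

lemma T_minus_id:
  assumes fh: "(f, h) \<in> L" and t: "0 \<le> t" "t < 1"
  shows "(l2_norm M (\<lambda>x. T t f x - f x))\<^sup>2 \<le> t / 2 * l2_inner M h f"
proof -
  have f: "f \<in> L2 M" and h: "h \<in> L2 M" using fh L_L2 by auto
  define \<gamma> where "\<gamma> = l2_inner M h f"
  define g where "g s = (l2_norm M (\<lambda>x. T s f x - f x))\<^sup>2 - s / 2 * \<gamma>" for s
  have "g t \<le> g 0"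
  proof (rule right_derivative_nonpos_imp_le[of 0 t g])
    show "continuous_on {0..t} g"
      unfolding g_def by (intro continuous_intros continuous_on_T_norm f t) auto
    fix s assume s: "0 \<le> s" "s < t"
    let ?D = "- 2 * l2_inner M (T s h) (\<lambda>x. T s f x - f x) - \<gamma> / 2"
    have "(g has_real_derivative ?D) (at_right s)"
      unfolding g_def
      by (rule DERIV_cong[OF DERIV_diff[OF T_norm_right_derivative[OF fh s(1) f]
              DERIV_cmult_right[OF DERIV_cdivide[OF DERIV_ident]]]]) simp
    moreover have "?D \<le> 0"
    proof -
      define \<alpha> \<beta> where "\<alpha> = l2_inner M (T s h) (T s f)" and "\<beta> = l2_inner M (T s h) f"
      note Ts = T_dom[OF fh s(1)]
      have "\<beta>\<^sup>2 \<le> \<alpha> * \<gamma>"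
        using L_form_Cauchy_Schwarz[OF _ Ts fh, of 0] L_nonneg[OF L_lincomb[OF Ts fh]]
        by (simp add: \<alpha>_def \<beta>_def \<gamma>_def)
      \<comment> \<open>The arithmetic-geometric mean inequality, with weights matching the factor 2
        in the derivative of the squared norm and the slope 1/2 of the claim.\<close>
      moreover have "4 * (\<alpha> * \<gamma>) \<le> (2 * \<alpha> + \<gamma> / 2)\<^sup>2"
        using zero_le_power2[of "2 * \<alpha> - \<gamma> / 2"] by (simp add: power2_eq_square algebra_simps)
      ultimately have le: "(2 * \<beta>)\<^sup>2 \<le> (2 * \<alpha> + \<gamma> / 2)\<^sup>2" by simp
      have pos: "0 \<le> \<alpha>" "0 \<le> \<gamma>" using L_nonneg[OF Ts] L_nonneg[OF fh] by (simp_all add: \<alpha>_def \<gamma>_def)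
      have "2 * \<beta> \<le> 2 * \<alpha> + \<gamma> / 2"
        by (rule power2_le_imp_le[OF le]) (use pos in simp)
      moreover have "l2_inner M (T s h) (\<lambda>x. T s f x - f x) = \<alpha> - \<beta>"
        using f h s by (simp add: \<alpha>_def \<beta>_def l2_inner_simps T_L2)
      ultimately show ?thesis by simp
    qed
    ultimately show "\<exists>D\<le>0. (g has_real_derivative D) (at_right s)" by blast
  qed (use t in auto)
  moreover have "l2_norm M (\<lambda>x. T 0 f x - f x) = 0"
    using T_zero[OF f] f by (subst l2_norm_eq_0_iff) (auto intro!: L2_diff T_L2)
  ultimately show ?thesis by (simp add: g_def \<gamma>_def)
qed

text \<open>By symmetry of L, exp (l s) <T s f, \<phi>> has right derivative zero. The monotonicity
  criterion only bounds from above, so it is applied with both signs c.\<close>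

lemma T_orthogonal_eigenfunction:
  assumes fh: "(f, h) \<in> L" and \<phi>: "(\<phi>, (\<lambda>x. l * \<phi> x)) \<in> L"
    and orth: "l2_inner M f \<phi> = 0" and t: "0 \<le> t" "t < 1"
  shows "l2_inner M (T t f) \<phi> = 0"
proof -
  have f: "f \<in> L2 M" and h: "h \<in> L2 M" and \<phi>2: "\<phi> \<in> L2 M" using fh \<phi> L_L2 by auto
  have "c * l2_inner M (T t f) \<phi> \<le> 0" for c
  proof -
    define g where "g s = exp (l * s) * (c * l2_inner M (T s f) \<phi>)" for s
    have "g t \<le> g 0"
    proof (rule right_derivative_nonpos_imp_le[of 0 t g])
      show "continuous_on {0..t} g"
        unfolding g_def by (intro continuous_intros continuous_on_T_inner f \<phi>2 t)
      fix s assume s: "0 \<le> s" "s < t"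
      have exp_deriv: "((\<lambda>s. exp (l * s)) has_real_derivative l * exp (l * s)) (at_right s)"
        by (auto intro!: derivative_eq_intros)
      have "l2_inner M (T s h) \<phi> = l * l2_inner M (T s f) \<phi>"
        using L_sym[OF T_dom[OF fh s(1)] \<phi>] by (simp add: l2_inner_scale_right)
      then have "(g has_real_derivative 0) (at_right s)"
        unfolding g_def
        by (intro DERIV_cong[OF DERIV_mult[OF exp_deriv
                DERIV_cmult[OF T_inner_right_derivative[OF fh s(1) \<phi>2]]]]) simp
      then show "\<exists>D\<le>0. (g has_real_derivative D) (at_right s)" by blast
    qed (use t in auto)
    moreover have "l2_inner M (T 0 f) \<phi> = 0"
      using l2_inner_cong_AE[OF T_L2[OF order_refl f] f \<phi>2 \<phi>2 T_zero[OF f]] orth by simp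
    ultimately show ?thesis by (simp add: g_def mult_le_0_iff)
  qed
  from this[of 1] this[of "-1"] show ?thesis by simp
qed

text \<open>The flow moves each f n by at most sqrt (t E / 2), uniformly in n, and for each fixed t
  the smoothed sequence is Cauchy along r. Splitting e into three parts transfers this to the
  sequence itself.\<close>

lemma energy_compact:
  assumes fh: "\<And>n::nat. (f n, h n) \<in> L" and B: "\<And>n. l2_norm M (f n) \<le> B"
    and E: "\<And>n. l2_inner M (h n) (f n) \<le> E"
  obtains r :: "nat \<Rightarrow> nat" and g where "strict_mono r" "g \<in> L2 M" "(\<lambda>n. l2_norm M (\<lambda>x. f (r n) x - g x)) \<longlonglongrightarrow> 0"
proof -
  have f: "f n \<in> L2 M" for n using fh L_L2 by auto
  obtain r :: "nat \<Rightarrow> nat" where r: "strict_mono r" and r_Cauchy: "\<And>t e. 0 < t \<Longrightarrow> t < 1 \<Longrightarrow> 0 < e \<Longrightarrow>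
      \<exists>n0. \<forall>m\<ge>n0. \<forall>n\<ge>n0. l2_norm M (\<lambda>x. T t (f (r m)) x - T t (f (r n)) x) < e"
    using compact[of f B] f B by blast
  have "\<exists>n0. \<forall>m\<ge>n0. \<forall>n\<ge>n0. l2_norm M (\<lambda>x. f (r m) x - f (r n) x) < e" if e: "0 < e" for e
  proof -
    have "0 \<le> E" using L_nonneg[OF fh[of 0]] E[of 0] by linarith
    \<comment> \<open>Small enough that the smoothing moves every member by at most e / 3; the cap
      1/2 keeps t below 1 and E + 1 keeps the denominator positive.\<close>
    define t where "t = min (1 / 2) (e\<^sup>2 / (9 * (E + 1)))"
    have "0 < e\<^sup>2 / (9 * (E + 1))" using e \<open>0 \<le> E\<close> by (intro divide_pos_pos) auto
    then have t: "0 < t" "t < 1" by (auto simp: t_def)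
    have "t * (E + 1) \<le> e\<^sup>2 / (9 * (E + 1)) * (E + 1)"
      using \<open>0 \<le> E\<close> by (intro mult_right_mono) (auto simp: t_def)
    also have "\<dots> = (e / 3)\<^sup>2" using \<open>0 \<le> E\<close> by (simp add: field_simps power2_eq_square)
    finally have tE: "t * (E + 1) \<le> (e / 3)\<^sup>2" .
    have close: "l2_norm M (\<lambda>x. T t (f n) x - f n x) \<le> e / 3" for n
    proof (rule power2_le_imp_le)
      have "(l2_norm M (\<lambda>x. T t (f n) x - f n x))\<^sup>2 \<le> t / 2 * l2_inner M (h n) (f n)"
        using T_minus_id[OF fh] t by simp
      also have "\<dots> \<le> t / 2 * E" using t E by (intro mult_left_mono) auto
      also have "\<dots> \<le> t * (E + 1)" using t \<open>0 \<le> E\<close> by (simp add: field_simps)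
      finally show "(l2_norm M (\<lambda>x. T t (f n) x - f n x))\<^sup>2 \<le> (e / 3)\<^sup>2" using tE by simp
    qed (use e in simp)
    obtain n0 where n0: "\<forall>m\<ge>n0. \<forall>n\<ge>n0. l2_norm M (\<lambda>x. T t (f (r m)) x - T t (f (r n)) x) < e / 3"
      using r_Cauchy[OF t, of "e / 3"] e by auto
    have "l2_norm M (\<lambda>x. f (r m) x - f (r n) x) < e" if "m \<ge> n0" "n \<ge> n0" for m n
    proof -
      have L2s: "f (r m) \<in> L2 M" "f (r n) \<in> L2 M" "T t (f (r m)) \<in> L2 M" "T t (f (r n)) \<in> L2 M"
        using f t by (auto intro: T_L2)
      have "l2_norm M (\<lambda>x. f (r m) x - f (r n) x)
          \<le> l2_norm M (\<lambda>x. f (r m) x - T t (f (r m)) x) + l2_norm M (\<lambda>x. T t (f (r m)) x - f (r n) x)"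
        by (rule l2_norm_diff_triangle[OF L2s(1,3,2)])
      moreover have "l2_norm M (\<lambda>x. T t (f (r m)) x - f (r n) x)
          \<le> l2_norm M (\<lambda>x. T t (f (r m)) x - T t (f (r n)) x) + l2_norm M (\<lambda>x. T t (f (r n)) x - f (r n) x)"
        by (rule l2_norm_diff_triangle[OF L2s(3,4,2)])
      ultimately show ?thesis
        using n0[rule_format, OF that] close[of "r m"] close[of "r n"]
          l2_norm_diff_commute[of M "f (r m)" "T t (f (r m))"] by linarith
    qed
    then show ?thesis by blast
  qed
  then obtain g where "g \<in> L2 M" "(\<lambda>n. l2_norm M (\<lambda>x. f (r n) x - g x)) \<longlonglongrightarrow> 0"
    using L2_complete[of "\<lambda>n. f (r n)"] f by blast
  with r show thesis by (rule that)
qed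

text \<open>Completeness is phrased negatively, by the absence of further low eigenfunctions
  orthogonal to \<Phi>: this is what maximality provides and what the minimiser in
  \<open>spectral_gap\<close> would violate.\<close>

definition complete_eigensystem ::
    "real \<Rightarrow> (('a \<Rightarrow> real) \<Rightarrow> real) \<Rightarrow> ('a \<Rightarrow> real) set \<Rightarrow> bool" where
  "complete_eigensystem w l \<Phi> \<longleftrightarrow> l2_orthonormal M \<Phi> \<and>
     (\<forall>\<phi>\<in>\<Phi>. (\<phi>, (\<lambda>x. l \<phi> * \<phi> x)) \<in> L) \<and>
     (\<forall>f c. (f, (\<lambda>x. c * f x)) \<in> L \<and> 0 \<le> c \<and> c \<le> w \<and> (\<forall>\<phi>\<in>\<Phi>. l2_inner M f \<phi> = 0) \<longrightarrow> l2_norm M f = 0)"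

section \<open>Spectral gap and decay relative to a complete system of low eigenfunctions\<close>

context
  fixes w l \<Phi>
  assumes complete: "complete_eigensystem w l \<Phi>"
begin

lemma eigensystem_orthonormal: "l2_orthonormal M \<Phi>"
  using complete by (simp add: complete_eigensystem_def)

lemma eigensystem_L: "\<phi> \<in> \<Phi> \<Longrightarrow> (\<phi>, (\<lambda>x. l \<phi> * \<phi> x)) \<in> L"
  using complete by (simp add: complete_eigensystem_def)

lemma eigensystem_complete:
  "(f, (\<lambda>x. c * f x)) \<in> L \<Longrightarrow> 0 \<le> c \<Longrightarrow> c \<le> w \<Longrightarrow> (\<And>\<phi>. \<phi> \<in> \<Phi> \<Longrightarrow> l2_inner M f \<phi> = 0)
    \<Longrightarrow> l2_norm M f = 0"
  using complete unfolding complete_eigensystem_def by blast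

text \<open>The span of \<Phi> lies in the domain and L maps it into itself. Hence subtracting the
  projection keeps a vector in the domain, and the correction is invisible to anything orthogonal to
  \<Phi>.\<close>

lemma proj_L:
  obtains h where "(l2_proj M \<Phi> f, h) \<in> L"
    "\<And>g. g \<in> L2 M \<Longrightarrow> (\<And>\<phi>. \<phi> \<in> \<Phi> \<Longrightarrow> l2_inner M g \<phi> = 0) \<Longrightarrow> l2_inner M g h = 0"
proof (rule that)
  let ?h = "\<lambda>x. \<Sum>\<phi>\<in>\<Phi>. l2_inner M f \<phi> * (l \<phi> * \<phi> x)"
  show "(l2_proj M \<Phi> f, ?h) \<in> L"
    unfolding l2_proj_def by (intro L_sum eigensystem_L)
  fix g assume g: "g \<in> L2 M" "\<And>\<phi>. \<phi> \<in> \<Phi> \<Longrightarrow> l2_inner M g \<phi> = 0"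
  have "l2_inner M g ?h = (\<Sum>\<phi>\<in>\<Phi>. l2_inner M f \<phi> * l2_inner M g (\<lambda>x. l \<phi> * \<phi> x))"
    by (rule l2_inner_sum_right[OF L2_scale[OF orthonormal_L2[OF eigensystem_orthonormal]] g(1)])
  then show "l2_inner M g ?h = 0"
    using g by (simp add: l2_inner_scale_right)
qed

text \<open>
  A minimiser of the Rayleigh quotient on the orthogonal complement of \<open>\<Phi>\<close> is an eigenfunction:
  Cauchy-Schwarz for the form \<open>\<langle>L u, u\<rangle> - c \<langle>u, u\<rangle>\<close>, where \<open>c\<close> is the infimum, shows that
  \<open>\<langle>g, L u - c u\<rangle>\<close> vanishes for the limit \<open>g\<close> of a minimising sequence.
\<close>

lemma spectral_gap:
  assumes fh: "(f, h) \<in> L" and orth: "\<And>\<phi>. \<phi> \<in> \<Phi> \<Longrightarrow> l2_inner M f \<phi> = 0"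
  shows "w * (l2_norm M f)\<^sup>2 \<le> l2_inner M h f"
proof (rule ccontr)
  assume "\<not> ?thesis"
  then have less: "l2_inner M h f < w * (l2_norm M f)\<^sup>2" by simp
  \<comment> \<open>Rayleigh quotients on the complement of \<Phi>. They are non-negative and, by
    the assumption to be refuted, one is below w; so their infimum c lies in [0, w).\<close>
  define A where "A = {l2_inner M v u |u v. (u, v) \<in> L \<and> l2_norm M u = 1 \<and> (\<forall>\<phi>\<in>\<Phi>. l2_inner M u \<phi> = 0)}"
  have normalise: "l2_inner M v u / (l2_norm M u)\<^sup>2 \<in> A"
    if uv: "(u, v) \<in> L" and "l2_norm M u \<noteq> 0" and "\<And>\<phi>. \<phi> \<in> \<Phi> \<Longrightarrow> l2_inner M u \<phi> = 0" for u v
  proof -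
    let ?a = "1 / l2_norm M u"
    have "l2_inner M (\<lambda>x. ?a * v x) (\<lambda>x. ?a * u x) = l2_inner M v u / (l2_norm M u)\<^sup>2"
      by (simp only: l2_inner_scale_left l2_inner_scale_right) (simp add: power2_eq_square)
    moreover have "l2_norm M (\<lambda>x. ?a * u x) = 1"
      using that(2) by (simp only: l2_norm_scale) (simp add: abs_of_pos less_le)
    moreover have "\<forall>\<phi>\<in>\<Phi>. l2_inner M (\<lambda>x. ?a * u x) \<phi> = 0"
      using that(3) by (simp only: l2_inner_scale_left) simp
    ultimately show ?thesis
      unfolding A_def using L_scale[OF uv, of ?a] by (smt (verit, best) mem_Collect_eq)
  qed
  have A_nonneg: "0 \<le> a" if "a \<in> A" for a using that L_nonneg by (auto simp: A_def)
  then have bdd: "bdd_below A" by (rule bdd_belowI)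
  define c where "c = Inf A"
  have "l2_norm M f \<noteq> 0" using less L_nonneg[OF fh] by auto
  then have fA: "l2_inner M h f / (l2_norm M f)\<^sup>2 \<in> A" using normalise[OF fh] orth by simp
  have "c \<le> l2_inner M h f / (l2_norm M f)\<^sup>2"
    unfolding c_def by (rule cInf_lower[OF fA bdd])
  also have "\<dots> < w" using less \<open>l2_norm M f \<noteq> 0\<close> by (simp add: divide_less_eq)
  finally have "c < w" .
  have "0 \<le> c" unfolding c_def using fA A_nonneg by (intro cInf_greatest) auto
  have form_nonneg: "0 \<le> l2_inner M v u - c * l2_inner M u u"
    if uv: "(u, v) \<in> L" and "\<And>\<phi>. \<phi> \<in> \<Phi> \<Longrightarrow> l2_inner M u \<phi> = 0" for u v
  proof (cases "l2_norm M u = 0")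
    case True
    then show ?thesis using L_nonneg[OF uv] l2_norm_square[of M u] by simp
  next
    case False
    have "c \<le> l2_inner M v u / (l2_norm M u)\<^sup>2"
      unfolding c_def by (rule cInf_lower[OF normalise[OF uv False] bdd]) (rule that)
    then show ?thesis using False by (simp add: pos_le_divide_eq l2_norm_square[symmetric])
  qed
  have "\<exists>u v. (u, v) \<in> L \<and> l2_norm M u = 1 \<and> (\<forall>\<phi>\<in>\<Phi>. l2_inner M u \<phi> = 0) \<and>
      l2_inner M v u < c + 1 / real (Suc n)" for n
  proof -
    have "Inf A < c + 1 / real (Suc n)" by (simp add: c_def)
    then obtain a where "a \<in> A" "a < c + 1 / real (Suc n)"
      using cInf_lessD fA by blast
    then show ?thesis unfolding A_def by blast
  qed
  then obtain u v where uv: "\<And>n. (u n, v n) \<in> L" "\<And>n. l2_norm M (u n) = 1"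
    "\<And>n \<phi>. \<phi> \<in> \<Phi> \<Longrightarrow> l2_inner M (u n) \<phi> = 0" "\<And>n. l2_inner M (v n) (u n) < c + 1 / real (Suc n)"
    by metis
  have E: "l2_inner M (v n) (u n) \<le> c + 1" for n
    using uv(4)[of n] by (rule less_imp_le[THEN order_trans]) simp
  obtain r g where r: "strict_mono r" and g: "g \<in> L2 M"
    and lim: "(\<lambda>n. l2_norm M (\<lambda>x. u (r n) x - g x)) \<longlonglongrightarrow> 0"
    using energy_compact[of u v 1 "c + 1", OF uv(1) _ E] uv(2) by auto
  have u: "u n \<in> L2 M" for n using uv(1) L_L2 by blast
  have lim_inner: "(\<lambda>n. l2_inner M (u (r n)) z) \<longlonglongrightarrow> l2_inner M g z" if "z \<in> L2 M" for z
    by (rule l2_inner_tendsto[OF u g that lim])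
  have "(\<lambda>n. l2_norm M (u (r n))) \<longlonglongrightarrow> l2_norm M g"
    by (rule l2_norm_tendsto[OF u g lim])
  then have norm_g: "l2_norm M g = 1" by (simp add: uv(2) LIMSEQ_const_iff)
  have g_orth: "l2_inner M g \<phi> = 0" if "\<phi> \<in> \<Phi>" for \<phi>
    using lim_inner[OF orthonormal_L2[OF eigensystem_orthonormal that]]
    by (simp add: uv(3)[OF that] LIMSEQ_const_iff)
  \<comment> \<open>\<open>g\<close> is so far only an L2 limit, not known to lie in the domain, so
    the eigenvalue equation is tested against pairs (p, q) of the graph: first with p orthogonal to
    \<Phi>, then, after subtracting the projection, with all p.\<close>
  have weak_orth: "l2_inner M g q = c * l2_inner M g p"
    if pq: "(p, q) \<in> L" and p_orth: "\<And>\<phi>. \<phi> \<in> \<Phi> \<Longrightarrow> l2_inner M p \<phi> = 0" for p q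
  proof -
    have p: "p \<in> L2 M" and q: "q \<in> L2 M" using pq L_L2 by auto
    define E where "E = l2_inner M q p - c * l2_inner M p p"
    have "0 \<le> E" unfolding E_def by (rule form_nonneg[OF pq p_orth])
    have bound: "(l2_inner M (u n) q - c * l2_inner M (u n) p)\<^sup>2 \<le> 1 / real (Suc n) * E" for n
    proof -
      have "(l2_inner M (v n) p - c * l2_inner M (u n) p)\<^sup>2
          \<le> (l2_inner M (v n) (u n) - c * l2_inner M (u n) (u n)) * E"
        unfolding E_def
      proof (rule L_form_Cauchy_Schwarz[OF _ uv(1) pq])
        fix a b
        have "l2_inner M (\<lambda>x. a * u n x + b * p x) \<phi> = 0" if "\<phi> \<in> \<Phi>" for \<phi>
          using u p orthonormal_L2[OF eigensystem_orthonormal that] uv(3)[OF that] p_orth[OF that]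
          by (simp add: l2_inner_add_left l2_inner_scale_left L2_scale)
        then show "0 \<le> l2_inner M (\<lambda>x. a * v n x + b * q x) (\<lambda>x. a * u n x + b * p x)
            - c * l2_inner M (\<lambda>x. a * u n x + b * p x) (\<lambda>x. a * u n x + b * p x)"
          by (intro form_nonneg L_lincomb uv(1) pq)
      qed
      also have "l2_inner M (u n) (u n) = 1" using l2_norm_square[of M "u n"] uv(2) by simp
      \<comment> \<open>Moving L onto the fixed p leaves only \<open>u n\<close>, which converges;
        nothing is known about convergence of \<open>v n\<close>.\<close>
      also have "l2_inner M (v n) p = l2_inner M (u n) q" by (rule L_sym[OF uv(1) pq])
      also have "(l2_inner M (v n) (u n) - c * 1) * E \<le> 1 / real (Suc n) * E"
        using uv(4)[of n] \<open>0 \<le> E\<close> by (intro mult_right_mono) auto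
      finally show ?thesis .
    qed
    have "(\<lambda>n. (l2_inner M (u (r n)) q - c * l2_inner M (u (r n)) p)\<^sup>2)
        \<longlonglongrightarrow> (l2_inner M g q - c * l2_inner M g p)\<^sup>2"
      by (intro tendsto_intros lim_inner p q)
    moreover have "(\<lambda>n. 1 / real (Suc (r n)) * E) \<longlonglongrightarrow> 0 * E"
      using LIMSEQ_subseq_LIMSEQ[OF LIMSEQ_Suc[OF lim_1_over_n[where 'a=real]] r]
      by (intro tendsto_mult) (simp_all add: o_def)
    ultimately have "(l2_inner M g q - c * l2_inner M g p)\<^sup>2 \<le> 0 * E"
      by (rule LIMSEQ_le) (use bound in blast)
    then show ?thesis by simp
  qed
  have weak: "l2_inner M g q = c * l2_inner M g p" if pq: "(p, q) \<in> L" for p q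
  proof -
    have p: "p \<in> L2 M" and q: "q \<in> L2 M" using pq L_L2 by auto
    obtain k where k: "(l2_proj M \<Phi> p, k) \<in> L" "l2_inner M g k = 0"
      using proj_L[of p] g g_orth by metis
    then have k2: "k \<in> L2 M" using L_L2 by blast
    have "l2_inner M (\<lambda>x. p x - l2_proj M \<Phi> p x) \<phi> = 0" if "\<phi> \<in> \<Phi>" for \<phi>
      using p that eigensystem_orthonormal
      by (simp add: l2_inner_diff_left l2_proj_L2 orthonormal_L2 l2_inner_proj_left)
    then have "l2_inner M g (\<lambda>x. q x - k x) = c * l2_inner M g (\<lambda>x. p x - l2_proj M \<Phi> p x)"
      by (intro weak_orth L_diff pq k)
    moreover have "l2_inner M g (l2_proj M \<Phi> p) = 0"
      using g_orth by (simp add: l2_inner_proj_right[OF eigensystem_orthonormal g])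
    ultimately show ?thesis
      using p q g k k2 by (simp add: l2_inner_diff_right l2_proj_L2[OF eigensystem_orthonormal])
  qed
  \<comment> \<open>Self-adjointness promotes the weak equation to membership in the graph.\<close>
  have "(g, (\<lambda>x. c * g x)) \<in> L"
  proof (rule L_adjointI[OF g L2_scale[OF g]])
    fix p q assume "(p, q) \<in> L"
    from weak[OF this] show "l2_inner M q g = l2_inner M p (\<lambda>x. c * g x)"
      by (simp only: l2_inner_scale_right l2_inner_commute[of M _ g])
  qed
  then have "l2_norm M g = 0"
    using \<open>0 \<le> c\<close> \<open>c < w\<close> g_orth by (intro eigensystem_complete) auto
  with norm_g show False by simp
qed

text \<open>On the domain, u splits into its projection, where the flow contracts, and the rest,
  which stays orthogonal to \<Phi> and so decays at rate w. Density extends the estimate to all of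
  L2; the indicators to which it will be applied need not lie in the domain.\<close>

lemma T_decay_off_eigensystem:
  assumes f: "f \<in> L2 M" and t: "0 \<le> t" "t < 1"
  shows "l2_norm M (T t f) \<le> l2_norm M (l2_proj M \<Phi> f) + exp (- w * t) * l2_norm M f"
proof -
  note ortho = eigensystem_orthonormal
  have dom: "l2_norm M (T t u) \<le> l2_norm M (l2_proj M \<Phi> u) + exp (- w * t) * l2_norm M u"
    if uv: "(u, v) \<in> L" for u v
  proof -
    have u: "u \<in> L2 M" using uv L_L2 by blast
    let ?p = "l2_proj M \<Phi> u"
    let ?q = "\<lambda>x. u x - ?p x"
    have p: "?p \<in> L2 M" by (rule l2_proj_L2[OF ortho])
    obtain k where k: "(?p, k) \<in> L" using proj_L[of u] by metis
    note qL = L_diff[OF uv k]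
    have q: "?q \<in> L2 M" by (rule L2_diff[OF u p])
    have q_orth: "l2_inner M ?q \<phi> = 0" if "\<phi> \<in> \<Phi>" for \<phi>
      using u p orthonormal_L2[OF ortho that] by (simp add: l2_inner_diff_left l2_inner_proj_left[OF ortho that])
    have "l2_norm M (T t ?q) \<le> exp (- w * t) * l2_norm M ?q"
    proof (rule T_decay[OF qL t])
      fix s assume s: "0 \<le> s" "s < t"
      have "l2_inner M (T s ?q) \<phi> = 0" if "\<phi> \<in> \<Phi>" for \<phi>
        using s t by (intro T_orthogonal_eigenfunction[OF qL eigensystem_L[OF that] q_orth[OF that]]) auto
      then show "w * (l2_norm M (T s ?q))\<^sup>2 \<le> l2_inner M (T s (\<lambda>x. v x - k x)) (T s ?q)"
        by (intro spectral_gap T_dom[OF qL s(1)])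
    qed
    also have "\<dots> \<le> exp (- w * t) * l2_norm M u"
      by (intro mult_left_mono l2_norm_diff_proj_le[OF ortho u]) simp
    finally have 1: "l2_norm M (T t ?q) \<le> exp (- w * t) * l2_norm M u" .
    have "l2_norm M (T t u) \<le> l2_norm M (T t ?p) + l2_norm M (\<lambda>x. T t u x - T t ?p x)"
      using t u p by (intro l2_norm_triangle_sub T_L2)
    also have "l2_norm M (\<lambda>x. T t u x - T t ?p x) = l2_norm M (T t ?q)"
      by (rule T_norm_diff[OF t(1) u p])
    also have "l2_norm M (T t ?p) \<le> l2_norm M ?p" by (rule T_contraction[OF k t])
    finally show ?thesis using 1 by linarith
  qed
  obtain K where K: "0 \<le> K" "\<And>f. f \<in> L2 M \<Longrightarrow> l2_norm M (T t f) \<le> K * l2_norm M f"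
    using T_bound[OF t(1)] by blast
  show ?thesis
  proof (rule field_le_epsilon)
    fix e :: real assume e: "0 < e"
    define E where "E = exp (- w * t)"
    \<comment> \<open>Approximating f costs K \<delta> in the flow, \<delta> in the projection and E
      \<delta> in the norm; together these make e.\<close>
    define \<delta> where "\<delta> = e / (K + 1 + E)"
    have KE: "0 < K + 1 + E" using K by (simp add: E_def add_nonneg_pos)
    then have "0 < \<delta>" using e by (simp add: \<delta>_def)
    obtain u v where uv: "(u, v) \<in> L" and close: "l2_norm M (\<lambda>x. f x - u x) < \<delta>"
      using L_dense[OF f \<open>0 < \<delta>\<close>] by blast
    have u: "u \<in> L2 M" using uv L_L2 by blast
    have "l2_norm M (T t f) \<le> l2_norm M (T t u) + l2_norm M (\<lambda>x. T t f x - T t u x)"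
      using t u f by (intro l2_norm_triangle_sub T_L2)
    moreover have "l2_norm M (\<lambda>x. T t f x - T t u x) \<le> K * \<delta>"
    proof -
      have "l2_norm M (\<lambda>x. T t f x - T t u x) = l2_norm M (T t (\<lambda>x. f x - u x))"
        by (rule T_norm_diff[OF t(1) f u])
      also have "\<dots> \<le> K * l2_norm M (\<lambda>x. f x - u x)" by (rule K(2)[OF L2_diff[OF f u]])
      also have "\<dots> \<le> K * \<delta>" using close K by (intro mult_left_mono) auto
      finally show ?thesis .
    qed
    moreover have "l2_norm M (l2_proj M \<Phi> u) \<le> l2_norm M (l2_proj M \<Phi> f) + \<delta>"
    proof -
      have "l2_norm M (l2_proj M \<Phi> u) \<le> l2_norm M (l2_proj M \<Phi> f)
          + l2_norm M (\<lambda>x. l2_proj M \<Phi> u x - l2_proj M \<Phi> f x)"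
        by (intro l2_norm_triangle_sub l2_proj_L2[OF ortho])
      also have "(\<lambda>x. l2_proj M \<Phi> u x - l2_proj M \<Phi> f x) = l2_proj M \<Phi> (\<lambda>x. u x - f x)"
        by (rule l2_proj_diff[OF ortho u f, symmetric])
      also have "l2_norm M \<dots> \<le> l2_norm M (\<lambda>x. u x - f x)"
        by (rule l2_norm_proj_le[OF ortho L2_diff[OF u f]])
      finally show ?thesis using close l2_norm_diff_commute[of M u f] by simp
    qed
    moreover have "E * l2_norm M u \<le> E * l2_norm M f + E * \<delta>"
    proof -
      have "l2_norm M u \<le> l2_norm M f + \<delta>"
        using l2_norm_triangle_sub[OF u f] close l2_norm_diff_commute[of M u f] by simp
      then have "E * l2_norm M u \<le> E * (l2_norm M f + \<delta>)"
        by (intro mult_left_mono) (simp_all add: E_def)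
      then show ?thesis by (simp add: distrib_left)
    qed
    ultimately have "l2_norm M (T t f)
        \<le> l2_norm M (l2_proj M \<Phi> f) + E * l2_norm M f + (K * \<delta> + \<delta> + E * \<delta>)"
      using dom[OF uv] unfolding E_def by linarith
    also have "K * \<delta> + \<delta> + E * \<delta> = (K + 1 + E) * \<delta>" by (simp add: algebra_simps)
    also have "\<dots> = e" using KE by (simp add: \<delta>_def)
    finally show "l2_norm M (T t f)
        \<le> l2_norm M (l2_proj M \<Phi> f) + exp (- w * t) * l2_norm M f + e" by (simp add: E_def)
  qed
qed

end

end

subsection \<open>Integral operators with bounded kernels\<close>

lemma L2_dominated_limit:
  assumes f: "\<And>n. f n \<in> L2 M" and g: "g \<in> L2 M" and w: "w \<in> L2 M"
    and lim: "AE x in M. (\<lambda>n. f n x) \<longlonglongrightarrow> g x"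
    and bound: "\<And>n. AE x in M. \<bar>f n x\<bar> \<le> w x"
  shows "(\<lambda>n. l2_norm M (\<lambda>x. f n x - g x)) \<longlonglongrightarrow> 0"
proof -
  have "(\<lambda>n. LINT x|M. (f n x - g x) * (f n x - g x)) \<longlonglongrightarrow> (LINT x|M. 0)"
  proof (rule integral_dominated_convergence)
    show "integrable M (\<lambda>x. 2 * (w x)\<^sup>2 + 2 * (g x)\<^sup>2)"
      using w g by (intro Bochner_Integration.integrable_add integrable_mult_right L2_square_integrable)
    show "AE x in M. (\<lambda>n. (f n x - g x) * (f n x - g x)) \<longlonglongrightarrow> 0"
      using lim
    proof eventually_elim
      case (elim x)
      then have "(\<lambda>n. (f n x - g x) * (f n x - g x)) \<longlonglongrightarrow> (g x - g x) * (g x - g x)"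
        by (intro tendsto_intros)
      then show ?case by simp
    qed
    show "AE x in M. norm ((f n x - g x) * (f n x - g x)) \<le> 2 * (w x)\<^sup>2 + 2 * (g x)\<^sup>2" for n
      using bound[of n]
    proof eventually_elim
      case (elim x)
      have "(f n x)\<^sup>2 \<le> (w x)\<^sup>2" using elim power_mono[of "\<bar>f n x\<bar>" "w x" 2] by simp
      moreover have "(f n x - g x) * (f n x - g x) \<le> 2 * (f n x)\<^sup>2 + 2 * (g x)\<^sup>2"
        using zero_le_power2[of "f n x + g x"] by (simp add: power2_eq_square algebra_simps)
      ultimately show ?case by simp
    qed
  qed (use f g in measurable)
  then have "(\<lambda>n. sqrt (l2_inner M (\<lambda>x. f n x - g x) (\<lambda>x. f n x - g x))) \<longlonglongrightarrow> sqrt 0"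
    unfolding l2_inner_def by (intro tendsto_real_sqrt) simp
  then show ?thesis by (simp add: l2_norm_def)
qed

text \<open>A Dynkin induction for vectors: a closed linear property that holds for the indicators
  of an intersection-stable generator holds on all of L2. This replaces an explicit density theorem
  for the generator.\<close>

lemma (in finite_measure) L2_closed_subspace_induct [consumes 4, case_names basic space lincomb limit]:
  assumes G: "Int_stable G" "G \<subseteq> Pow (space M)" "sets M = sigma_sets (space M) G"
    and f: "f \<in> L2 M"
    and basic: "\<And>A. A \<in> G \<Longrightarrow> P (indicator A)"
    and space: "P (indicator (space M))"
    and lincomb: "\<And>f g a b. f \<in> L2 M \<Longrightarrow> P f \<Longrightarrow> g \<in> L2 M \<Longrightarrow> P g \<Longrightarrow> P (\<lambda>x. a * f x + b * g x)"
    and limit: "\<And>f g. (\<And>n::nat. f n \<in> L2 M) \<Longrightarrow> (\<And>n. P (f n)) \<Longrightarrow> g \<in> L2 M \<Longrightarrow>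
      (\<lambda>n. l2_norm M (\<lambda>x. f n x - g x)) \<longlonglongrightarrow> 0 \<Longrightarrow> P g"
  shows "P f"
proof -
  have zero: "P (\<lambda>x. 0)"
    using lincomb[OF L2_indicator space L2_indicator space, of 0 0] by simp
  \<comment> \<open>Functions that agree on the space may differ as HOL functions; a constant
    sequence in the limit rule identifies them.\<close>
  have P_cong: "P g" if "f \<in> L2 M" "P f" "g \<in> L2 M" "\<And>x. x \<in> space M \<Longrightarrow> f x = g x" for f g
  proof (rule limit[of "\<lambda>_. f"])
    have "l2_norm M (\<lambda>x. f x - g x) = l2_norm M (\<lambda>x. 0)"
      using that by (intro l2_norm_cong_AE) (auto intro: L2_diff)
    then show "(\<lambda>n. l2_norm M (\<lambda>x. f x - g x)) \<longlonglongrightarrow> 0" by simp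
  qed (use that in auto)
  have P_sum: "P (\<lambda>x. \<Sum>i\<in>I. a i * indicator (A i) x)"
    if "\<And>i. i \<in> I \<Longrightarrow> A i \<in> sets M" "\<And>i. i \<in> I \<Longrightarrow> P (indicator (A i))"
    for I :: "'i set" and a A
    using that
  proof (induction I rule: infinite_finite_induct)
    case (insert i I)
    have "P (\<lambda>x. a i * indicator (A i) x + 1 * (\<Sum>i\<in>I. a i * indicator (A i) x))"
      using insert by (intro lincomb L2_sum) auto
    then show ?case by (simp only: sum.insert[OF insert(1,2)] mult_1)
  qed (simp_all add: zero)
  have sets: "P (indicator A)" if "A \<in> sets M" for A
    using G(1,2) that[unfolded G(3)]
  proof (induction A rule: sigma_sets_induct_disjoint)
    case (basic A)
    then show ?case by (rule assms(5))
  next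
    case empty
    then show ?case using zero by simp
  next
    case (compl A)
    then have A: "A \<in> sets M" using G(3) by simp
    have "P (\<lambda>x. 1 * indicator (space M) x + (-1) * indicator A x)"
      using A compl by (intro lincomb space) auto
    then show ?case
    proof (rule P_cong[rotated])
      show "(\<lambda>x. 1 * indicator (space M) x + (-1) * indicator A x) \<in> L2 M"
        by (intro L2_lincomb L2_indicator sets.top A)
      show "1 * indicator (space M) x + (-1) * indicator A x = (indicator (space M - A) x :: real)" for x
        using sets.sets_into_space[OF A] by (auto simp: indicator_def)
    qed (use A in auto)
  next
    case (union A)
    then have A: "A i \<in> sets M" for i using G(3) by auto
    have partial: "P (\<lambda>x. \<Sum>i<n. 1 * indicator (A i) x)" for n
      using A union by (intro P_sum) auto
    have lim: "(\<lambda>n. l2_norm M (\<lambda>x. (\<Sum>i<n. 1 * indicator (A i) x) - indicator (\<Union>i. A i) x)) \<longlonglongrightarrow> 0"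
    proof (rule L2_dominated_limit[where w="\<lambda>x. 1"])
      have "(\<lambda>n. \<Sum>i<n. indicator (A i) x :: real) \<longlonglongrightarrow> indicator (\<Union>i. A i) x" for x
        using indicator_sums[of A x] union(1) by (auto simp: sums_def disjoint_family_on_def)
      then show "AE x in M. (\<lambda>n. \<Sum>i<n. 1 * indicator (A i) x :: real) \<longlonglongrightarrow> indicator (\<Union>i. A i) x"
        by simp
      have "(\<Sum>i<n. indicator (A i) x :: real) = indicator (\<Union>i<n. A i) x" for n x
        using union(1) by (subst indicator_UN_disjoint) (auto simp: disjoint_family_on_def)
      then show "AE x in M. \<bar>\<Sum>i<n. 1 * indicator (A i) x :: real\<bar> \<le> 1" for n
        by (simp add: indicator_def)
      show "(\<lambda>x. \<Sum>i<n. 1 * indicator (A i) x) \<in> L2 M" for n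
        by (intro L2_sum L2_indicator A)
    qed (use A in auto)
    have "indicator (\<Union>i. A i) \<in> L2 M"
      using A by (intro L2_indicator) auto
    from limit[OF L2_sum[OF L2_indicator[OF A]] partial this lim] show ?case .
  qed
  obtain F :: "nat \<Rightarrow> 'a \<Rightarrow> real" where F_all: "(\<forall>i. simple_function M (F i)) \<and>
      (\<forall>x\<in>space M. (\<lambda>i. F i x) \<longlonglongrightarrow> f x) \<and> (\<forall>i. \<forall>x\<in>space M. dist (F i x) 0 \<le> 2 * dist (f x) 0)"
    using borel_measurable_implies_sequence_metric[OF L2_measurable[OF f], of 0] by (rule exE)
  have F: "simple_function M (F i)" for i using F_all by blast
  have F_lim: "(\<lambda>i. F i x) \<longlonglongrightarrow> f x" if "x \<in> space M" for x using F_all that by blast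
  have F_bound: "\<bar>F i x\<bar> \<le> 2 * \<bar>f x\<bar>" if "x \<in> space M" for i x
    using F_all that by (simp add: dist_norm)
  \<comment> \<open>The simple approximations rewritten as explicit finite sums of indicators, so
    that \<open>P_sum\<close> applies; they equal F i on the space only.\<close>
  define S where "S i x = (\<Sum>y\<in>F i ` space M. y * indicator (F i -` {y} \<inter> space M) x)" for i x
  have S_eq: "S i x = F i x" if "x \<in> space M" for i x
    unfolding S_def by (subst simple_function_indicator_representation_banach[OF F that, of i])
      (simp only: real_scaleR_def mult.commute)
  have F_sets: "F i -` {y} \<inter> space M \<in> sets M" for i y
    using F by (rule simple_functionD)
  have S_L2: "S i \<in> L2 M" for i
    unfolding S_def by (intro L2_sum L2_indicator F_sets)
  have "P (S i)" for i
    unfolding S_def by (intro P_sum sets F_sets)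
  moreover have "(\<lambda>i. l2_norm M (\<lambda>x. S i x - f x)) \<longlonglongrightarrow> 0"
  proof (rule L2_dominated_limit[OF S_L2 f])
    show "(\<lambda>x. 2 * \<bar>f x\<bar>) \<in> L2 M"
      using f by (intro L2_scale) (auto simp: L2_def intro!: borel_measurable_abs)
  qed (use F_lim F_bound S_eq in auto)
  ultimately show ?thesis
    by (rule limit[OF S_L2 _ f])
qed

text \<open>Weak sequential compactness without constructing the weak limit. A diagonal subsequence
  makes the inner products with the countably many generator indicators converge, and the uniform
  bound B carries this over to linear combinations and L2 limits.\<close>

lemma (in finite_measure) L2_weak_subsequence:
  assumes G: "countable G" "Int_stable G" "G \<subseteq> Pow (space M)" "sets M = sigma_sets (space M) G"
    and f: "\<And>n::nat. f n \<in> L2 M" and B: "\<And>n. l2_norm M (f n) \<le> B"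
  obtains r :: "nat \<Rightarrow> nat" where "strict_mono r"
    "\<And>h. h \<in> L2 M \<Longrightarrow> convergent (\<lambda>n. l2_inner M h (f (r n)))"
proof -
  have G_sets: "A \<in> sets M" if "A \<in> insert (space M) G" for A
    using that G(4) by auto
  have "0 \<le> B" using order_trans[OF l2_norm_nonneg B] .
  have bound: "norm (l2_inner M (indicator A) (f n)) \<le> l2_norm M (\<lambda>x. 1) * B"
    if A: "A \<in> insert (space M) G" for A n
  proof -
    have "l2_inner M (indicator A) (indicator A) \<le> l2_inner M (\<lambda>x. 1) (\<lambda>x. 1)"
      unfolding l2_inner_def
    proof (rule integral_mono)
      show "integrable M (\<lambda>x. indicator A x * indicator A x :: real)"
        using L2_indicator[OF G_sets[OF A]] by (intro L2_mult_integrable)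
    qed (auto simp: indicator_def)
    then have "l2_norm M (indicator A) \<le> l2_norm M (\<lambda>x. 1)"
      unfolding l2_norm_def by (rule real_sqrt_le_mono)
    then have "l2_norm M (indicator A) * l2_norm M (f n) \<le> l2_norm M (\<lambda>x. 1) * B"
      using B[of n] by (intro mult_mono) auto
    then show ?thesis
      using l2_Cauchy_Schwarz[OF L2_indicator[OF G_sets[OF A]] f[of n]] by simp
  qed
  obtain r :: "nat \<Rightarrow> nat" where r: "strict_mono r"
    "\<And>A. A \<in> insert (space M) G \<Longrightarrow> \<exists>l. (\<lambda>n. l2_inner M (indicator A) (f (r n))) \<longlonglongrightarrow> l"
    by (rule function_convergent_subsequence[of "insert (space M) G" "\<lambda>n A. l2_inner M (indicator A) (f n)"])
      (use G(1) bound in auto)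
  have "convergent (\<lambda>n. l2_inner M h (f (r n)))" if "h \<in> L2 M" for h
    using G(2-4) that
  proof (induction h rule: L2_closed_subspace_induct)
    case (basic A)
    then show ?case using r(2) by (simp add: convergent_def)
  next
    case space
    then show ?case using r(2) by (simp add: convergent_def)
  next
    case (lincomb h k a b)
    have "l2_inner M (\<lambda>x. a * h x + b * k x) (f (r n))
        = a * l2_inner M h (f (r n)) + b * l2_inner M k (f (r n))" for n
      using lincomb f by (simp add: l2_inner_add_left l2_inner_scale_left L2_scale)
    then show ?case
      using lincomb by (auto intro!: convergent_add convergent_mult convergent_const)
  next
    case (limit hs h)
    have "Cauchy (\<lambda>n. l2_inner M h (f (r n)))"
    proof (rule metric_CauchyI)
      fix e :: real assume e: "0 < e"
      define \<delta> where "\<delta> = e / (3 * (B + 1))"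
      have "0 < \<delta>" using e \<open>0 \<le> B\<close> by (simp add: \<delta>_def)
      then obtain k where k: "l2_norm M (\<lambda>x. hs k x - h x) < \<delta>"
        using order_tendstoD(2)[OF limit(3), of \<delta>] by (auto simp: eventually_sequentially)
      have approx: "\<bar>l2_inner M h (f n) - l2_inner M (hs k) (f n)\<bar> \<le> e / 3" for n
      proof -
        have "\<bar>l2_inner M (\<lambda>x. h x - hs k x) (f n)\<bar> \<le> l2_norm M (\<lambda>x. h x - hs k x) * l2_norm M (f n)"
          using limit f by (intro l2_Cauchy_Schwarz L2_diff) auto
        also have "\<dots> \<le> \<delta> * (B + 1)"
          using k B[of n] \<open>0 < \<delta>\<close> l2_norm_diff_commute[of M h "hs k"] by (intro mult_mono) auto
        also have "\<dots> = e / 3" using \<open>0 \<le> B\<close> by (simp add: \<delta>_def field_simps)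
        finally show ?thesis using limit f by (simp add: l2_inner_diff_left)
      qed
      have "Cauchy (\<lambda>n. l2_inner M (hs k) (f (r n)))"
        using limit(4) by (rule convergent_Cauchy)
      then obtain n0 where n0: "\<And>m n. m \<ge> n0 \<Longrightarrow> n \<ge> n0 \<Longrightarrow>
          dist (l2_inner M (hs k) (f (r m))) (l2_inner M (hs k) (f (r n))) < e / 3"
        using metric_CauchyD[of _ "e / 3"] e by (metis divide_pos_pos zero_less_numeral)
      have "dist (l2_inner M h (f (r m))) (l2_inner M h (f (r n))) < e" if "m \<ge> n0" "n \<ge> n0" for m n
        using n0[OF that] approx[of "r m"] approx[of "r n"] unfolding dist_real_def by linarith
      then show "\<exists>n0. \<forall>m\<ge>n0. \<forall>n\<ge>n0. dist (l2_inner M h (f (r m))) (l2_inner M h (f (r n))) < e"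
        by blast
    qed
    then show ?case by (simp add: Cauchy_convergent_iff)
  qed
  with r(1) show thesis by (rule that)
qed

lemma (in finite_measure) kernel_operator_pointwise_bound:
  assumes f: "f \<in> L2 M" and p: "\<And>y. \<bar>p y\<bar> \<le> K" and int: "integrable M (\<lambda>y. p y * f y)"
  shows "\<bar>LINT y|M. p y * f y\<bar> \<le> K * (sqrt (measure M (space M)) * l2_norm M f)"
proof -
  have "0 \<le> K" using order_trans[OF abs_ge_zero p] .
  have "\<bar>LINT y|M. p y * f y\<bar> \<le> (LINT y|M. \<bar>p y * f y\<bar>)" by (rule integral_abs_bound)
  also have "\<dots> \<le> (LINT y|M. K * \<bar>f y\<bar>)"
  proof (rule integral_mono)
    show "integrable M (\<lambda>y. \<bar>p y * f y\<bar>)" using int by (rule integrable_abs)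
    show "integrable M (\<lambda>y. K * \<bar>f y\<bar>)" using f by (simp add: L2_integrable)
    show "\<bar>p y * f y\<bar> \<le> K * \<bar>f y\<bar>" for y
      using p[of y] by (simp add: abs_mult mult_right_mono)
  qed
  also have "\<dots> = K * (LINT y|M. \<bar>f y\<bar>)" by simp
  also have "\<dots> \<le> K * (sqrt (measure M (space M)) * l2_norm M f)"
    using integral_abs_le_l2_norm[OF f] \<open>0 \<le> K\<close> by (rule mult_left_mono)
  finally show ?thesis .
qed

lemma (in finite_measure) l2_norm_le_const:
  assumes g: "g \<in> L2 M" and C: "0 \<le> C" "AE x in M. \<bar>g x\<bar> \<le> C"
  shows "l2_norm M g \<le> sqrt (measure M (space M)) * C"
proof (rule power2_le_imp_le)
  have "(l2_norm M g)\<^sup>2 = (LINT x|M. g x * g x)" by (simp add: l2_norm_square l2_inner_def)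
  also have "\<dots> \<le> (LINT x|M. C * C)"
  proof (rule integral_mono_AE)
    show "AE x in M. g x * g x \<le> C * C"
      using C(2)
    proof eventually_elim
      case (elim x)
      then show ?case using mult_mono[OF elim elim C(1)] by (simp flip: abs_mult)
    qed
  qed (use L2_mult_integrable[OF g g] in auto)
  finally show "(l2_norm M g)\<^sup>2 \<le> (sqrt (measure M (space M)) * C)\<^sup>2"
    by (simp add: power_mult_distrib flip: power2_eq_square)
qed (use C in simp)

text \<open>
  A bounded sequence has a weakly convergent subsequence; a bounded kernel turns it into one whose
  image converges pointwise and boundedly.
\<close>

lemma heat_flow_of_bounded_kernel:
  assumes fin: "finite_measure M" and space: "space M = UNIV"
    and G: "countable G" "Int_stable G" "sets M = sigma_sets UNIV G"
    and sa: "selfadjoint_operator M L" and nonneg: "nonneg_operator M L"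
    and semi: "heat_semigroup M L T" and kernel: "heat_kernel M T P"
    and bdd: "\<And>a. 0 < a \<Longrightarrow> \<exists>K. \<forall>t x y. a \<le> t \<and> t < 1 \<longrightarrow> \<bar>P t x y\<bar> \<le> K"
  shows "heat_flow M L T"
proof -
  interpret finite_measure M by (rule fin)
  have T_kernel: "AE x in M. integrable M (\<lambda>y. P t x y * f y) \<and> T t f x = (LINT y|M. P t x y * f y)"
    if "0 < t" "f \<in> L2 M" for t f
    using kernel that by (simp add: heat_kernel_def)
  have T_L2: "T t f \<in> L2 M" if "0 < t" "f \<in> L2 M" for t f
    using semi that by (simp add: heat_semigroup_def l2_bounded_operator_def)
  define V where "V = sqrt (measure M (space M))"
  have "0 \<le> V" by (simp add: V_def)
  have pointwise: "AE x in M. \<bar>T t f x\<bar> \<le> K * (V * l2_norm M f)"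
    if "0 < t" "f \<in> L2 M" "\<And>x y. \<bar>P t x y\<bar> \<le> K" for t f K
    using T_kernel[OF that(1,2)] unfolding V_def
    by eventually_elim (use kernel_operator_pointwise_bound[OF that(2,3)] in auto)
  show ?thesis
  proof (intro heat_flow.intro heat_flow_axioms.intro fin sa nonneg semi)
    fix a :: real assume "0 < a"
    then obtain K where K: "\<And>t x y. a \<le> t \<Longrightarrow> t < 1 \<Longrightarrow> \<bar>P t x y\<bar> \<le> K" using bdd by blast
    \<comment> \<open>One factor V comes from bounding the L1 norm of the input by its L2 norm, the
      other from bounding the L2 norm of the output by its supremum.\<close>
    have "l2_norm M (T t f) \<le> (V * (K * V)) * l2_norm M f" if "a \<le> t" "t < 1" "f \<in> L2 M" for t f
    proof -
      have "0 \<le> K" using order_trans[OF abs_ge_zero K[OF that(1,2)]] .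
      have "l2_norm M (T t f) \<le> V * (K * (V * l2_norm M f))"
        unfolding V_def
      proof (rule l2_norm_le_const)
        show "AE x in M. \<bar>T t f x\<bar> \<le> K * (sqrt (measure M (space M)) * l2_norm M f)"
          using pointwise[of t f K] K that \<open>0 < a\<close> by (simp add: V_def)
      qed (use T_L2 that \<open>0 < a\<close> \<open>0 \<le> K\<close> in auto)
      then show ?thesis by (simp add: mult.assoc)
    qed
    then show "\<exists>K. \<forall>t f. a \<le> t \<and> t < 1 \<and> f \<in> L2 M \<longrightarrow> l2_norm M (T t f) \<le> K * l2_norm M f"
      by blast
  next
    fix f :: "nat \<Rightarrow> 'a \<Rightarrow> real" and B
    assume f: "\<And>n. f n \<in> L2 M" and B: "\<And>n. l2_norm M (f n) \<le> B"
    have "0 \<le> B" using order_trans[OF l2_norm_nonneg B] .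
    obtain r :: "nat \<Rightarrow> nat" where r: "strict_mono r"
      and weak: "\<And>h. h \<in> L2 M \<Longrightarrow> convergent (\<lambda>n. l2_inner M h (f (r n)))"
    proof (rule L2_weak_subsequence[of G f B])
      show "G \<subseteq> Pow (space M)" by (simp add: space)
      show "sets M = sigma_sets (space M) G" using G(3) space by simp
    qed (use G f B in auto)
    have "\<exists>n0. \<forall>m\<ge>n0. \<forall>n\<ge>n0. l2_norm M (\<lambda>x. T t (f (r m)) x - T t (f (r n)) x) < e"
      if t: "0 < t" "t < 1" and e: "0 < e" for t e
    proof -
      obtain K where K: "\<And>x y. \<bar>P t x y\<bar> \<le> K" using bdd[OF t(1)] t(2) by blast
      then have "0 \<le> K" using order_trans[OF abs_ge_zero] by blast
      \<comment> \<open>Kernel sections are bounded, hence in L2, hence admissible test vectors for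
        the weak convergence.\<close>
      have P_L2: "P t x \<in> L2 M" for x
      proof (rule L2_bounded[OF _ K])
        have "(\<lambda>(x, y). P t x y) \<in> borel_measurable (M \<Otimes>\<^sub>M M)"
          using kernel t by (simp add: heat_kernel_def)
        from measurable_Pair2[OF this, of x] show "P t x \<in> borel_measurable M"
          by (simp add: space)
      qed
      define F where "F x = lim (\<lambda>n. T t (f (r n)) x)" for x
      have TL2: "T t (f n) \<in> L2 M" for n using T_L2 t f by blast
      have lim: "AE x in M. (\<lambda>n. T t (f (r n)) x) \<longlonglongrightarrow> F x"
      proof -
        have "AE x in M. \<forall>n. T t (f (r n)) x = (LINT y|M. P t x y * f (r n) y)"
          unfolding AE_all_countable using T_kernel[OF t(1) f] by (auto elim: eventually_mono)
        then show ?thesis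
        proof eventually_elim
          case (elim x)
          then have "convergent (\<lambda>n. T t (f (r n)) x)"
            using weak[OF P_L2[of x]] by (simp add: l2_inner_def)
          then show ?case unfolding F_def by (simp add: convergent_LIMSEQ_iff)
        qed
      qed
      have bound: "AE x in M. \<bar>T t (f n) x\<bar> \<le> K * (V * B)" for n
        using pointwise[OF t(1) f K, of n]
      proof eventually_elim
        case (elim x)
        also have "K * (V * l2_norm M (f n)) \<le> K * (V * B)"
          using B[of n] \<open>0 \<le> K\<close> \<open>0 \<le> V\<close> by (intro mult_left_mono)
        finally show ?case .
      qed
      have F_bound: "AE x in M. \<bar>F x\<bar> \<le> K * (V * B)"
      proof -
        have "AE x in M. \<forall>n. \<bar>T t (f (r n)) x\<bar> \<le> K * (V * B)"
          unfolding AE_all_countable using bound by blast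
        with lim show ?thesis
        proof eventually_elim
          case (elim x)
          then show ?case by (intro LIMSEQ_le_const2[OF tendsto_rabs[OF elim(1)]]) auto
        qed
      qed
      have F_meas: "F \<in> borel_measurable M"
        unfolding F_def by (rule borel_measurable_lim_metric) (rule L2_measurable[OF TL2])
      have F_L2: "F \<in> L2 M"
      proof -
        have "AE x in M. norm ((F x)\<^sup>2) \<le> (K * (V * B))\<^sup>2"
          using F_bound
        proof eventually_elim
          case (elim x)
          then show ?case using power_mono[OF elim, of 2] by simp
        qed
        then have "integrable M (\<lambda>x. (F x)\<^sup>2)"
          using F_meas by (intro integrable_const_bound[of _ "(K * (V * B))\<^sup>2"]) auto
        then show ?thesis using F_meas by (simp add: L2_def)
      qed
      have "(\<lambda>n. l2_norm M (\<lambda>x. T t (f (r n)) x - F x)) \<longlonglongrightarrow> 0"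
        by (rule L2_dominated_limit[OF TL2 F_L2 L2_const lim bound])
      then have "\<forall>\<^sub>F n in sequentially. l2_norm M (\<lambda>x. T t (f (r n)) x - F x) < e / 2"
        using e by (intro order_tendstoD) auto
      then obtain n0 where n0: "\<And>n. n \<ge> n0 \<Longrightarrow> l2_norm M (\<lambda>x. T t (f (r n)) x - F x) < e / 2"
        by (auto simp: eventually_sequentially)
      have "l2_norm M (\<lambda>x. T t (f (r m)) x - T t (f (r n)) x) < e" if "m \<ge> n0" "n \<ge> n0" for m n
        using l2_norm_diff_triangle[OF TL2[of "r m"] F_L2 TL2[of "r n"]]
          n0[OF that(1)] n0[OF that(2)] l2_norm_diff_commute[of M F "T t (f (r n))"]
        by linarith
      then show ?thesis by blast
    qed
    with r show "\<exists>r :: nat \<Rightarrow> nat. strict_mono r \<and> (\<forall>t e. 0 < t \<and> t < 1 \<and> 0 < e \<longrightarrow>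
        (\<exists>n0. \<forall>m\<ge>n0. \<forall>n\<ge>n0. l2_norm M (\<lambda>x. T t (f (r m)) x - T t (f (r n)) x) < e))"
      by blast
  qed
qed

subsection \<open>Doubling measures on compact metric spaces\<close>

text \<open>The type is only a metric space, so second countability has to come from compactness:
  finite covers by balls of radius 1 / (n + 1) form a countable base.\<close>

lemma compact_metric_countable_generator:
  assumes "compact (UNIV :: 'a::metric_space set)"
  obtains G :: "'a::metric_space set set" where "countable G" "Int_stable G" "sets borel = sigma_sets UNIV G"
proof -
  have "\<exists>C. finite C \<and> (UNIV :: 'a set) \<subseteq> (\<Union>c\<in>C. ball c (1 / real (Suc n)))" for n
  proof -
    have "x \<in> ball x (1 / real (Suc n))" for x :: 'a by simp
    then have cover: "(UNIV :: 'a set) \<subseteq> (\<Union>c\<in>UNIV. ball c (1 / real (Suc n)))" by blast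
    obtain C where "C \<subseteq> UNIV" "finite C" "(UNIV :: 'a set) \<subseteq> (\<Union>c\<in>C. ball c (1 / real (Suc n)))"
      by (rule compactE_image[OF assms _ cover]) (rule open_ball)
    then show ?thesis by blast
  qed
  then have "\<forall>n. \<exists>C. finite C \<and> (UNIV :: 'a set) \<subseteq> (\<Union>c\<in>C. ball c (1 / real (Suc n)))" by blast
  from choice[OF this] obtain C
    where "\<forall>n. finite (C n) \<and> (UNIV :: 'a set) \<subseteq> (\<Union>c\<in>C n. ball c (1 / real (Suc n)))" by (rule exE)
  then have C: "finite (C n)" "(UNIV :: 'a set) \<subseteq> (\<Union>c\<in>C n. ball c (1 / real (Suc n)))" for n
    by blast+
  define B where "B = (\<Union>n. (\<lambda>c. ball c (1 / real (Suc n))) ` C n)"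
  have "countable B"
    unfolding B_def by (rule countable_UN) (auto intro: countable_finite C(1))
  have B_open: "open b" if "b \<in> B" for b using that by (auto simp: B_def)
  have basis: "\<exists>b\<in>B. x \<in> b \<and> b \<subseteq> U" if "open U" "x \<in> U" for U x
  proof -
    obtain e where e: "0 < e" "ball x e \<subseteq> U" using \<open>open U\<close> \<open>x \<in> U\<close> open_contains_ball by blast
    obtain n where n: "1 / real (Suc n) < e / 2"
      using nat_approx_posE[of "e / 2"] e by auto
    obtain c where c: "c \<in> C n" "x \<in> ball c (1 / real (Suc n))" using C(2)[of n] by blast
    have "ball c (1 / real (Suc n)) \<subseteq> ball x e"
    proof
      fix y assume "y \<in> ball c (1 / real (Suc n))"
      then show "y \<in> ball x e"
        using c n dist_triangle[of x y c] by (simp add: dist_commute)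
    qed
    with c e show ?thesis unfolding B_def by blast
  qed
  \<comment> \<open>Finite intersections make the base intersection-stable; the empty family
    contributes UNIV.\<close>
  define G where "G = Inter ` {F. finite F \<and> F \<subseteq> B}"
  have "countable G"
    unfolding G_def by (intro countable_image countable_Collect_finite_subset \<open>countable B\<close>)
  moreover have "Int_stable G"
  proof (rule Int_stableI)
    fix a b assume "a \<in> G" "b \<in> G"
    then obtain F F' where "a = \<Inter>F" "finite F" "F \<subseteq> B" "b = \<Inter>F'" "finite F'" "F' \<subseteq> B"
      unfolding G_def by auto
    then show "a \<inter> b \<in> G"
      unfolding G_def by (intro image_eqI[of _ _ "F \<union> F'"]) auto
  qed
  moreover have "sets (borel :: 'a measure) = sigma_sets UNIV G"
  proof (rule antisym)
    have "U \<in> sigma_sets UNIV G" if "open U" for U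
    proof -
      have "U = \<Union>{b \<in> B. b \<subseteq> U}" using basis[OF that] by blast
      moreover have "\<Union>{b \<in> B. b \<subseteq> U} \<in> sigma_sets UNIV G"
      proof (rule sigma_sets_UNION)
        show "countable {b \<in> B. b \<subseteq> U}" using \<open>countable B\<close> by (rule countable_subset[rotated]) auto
        fix b assume "b \<in> {b \<in> B. b \<subseteq> U}"
        then have "b \<in> G" unfolding G_def by (intro image_eqI[of _ _ "{b}"]) auto
        then show "b \<in> sigma_sets UNIV G" by blast
      qed
      ultimately show ?thesis by simp
    qed
    then have "sigma_sets UNIV (Collect open) \<subseteq> sigma_sets UNIV G"
      by (intro sigma_sets_mono) blast
    then show "sets (borel :: 'a measure) \<subseteq> sigma_sets UNIV G"
      by (simp add: borel_def)
    have "G \<subseteq> sets borel"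
      unfolding G_def using B_open by (auto intro!: borel_open)
    then show "sigma_sets UNIV G \<subseteq> sets (borel :: 'a measure)"
      using sets.sigma_sets_subset[of G borel] by simp
  qed
  ultimately show thesis by (rule that)
qed

text \<open>\<open>A\<close> stands for 2 powr D, in the form in which doubling is iterated. Inner
  regularity enters where a set of positive measure has to be replaced by a compact subset.\<close>

locale doubling_space = finite_measure M for M :: "'a::metric_space measure" +
  fixes A :: real
  assumes compact_UNIV: "compact (UNIV :: 'a set)"
    and sets_M: "sets M = sets borel"
    and ball_pos: "\<And>x r. 0 < r \<Longrightarrow> 0 < measure M (ball x r)"
    and doubling: "\<And>x r. 0 < r \<Longrightarrow> measure M (ball x (2 * r)) \<le> A * measure M (ball x r)"
    and inner_regular:
      "\<And>B. B \<in> sets M \<Longrightarrow> emeasure M B = (SUP K\<in>{K. compact K \<and> K \<subseteq> B}. emeasure M K)"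
begin

lemma space_M: "space M = UNIV"
  using sets_eq_imp_space_eq[OF sets_M] by simp

lemma open_sets [simp, intro]: "open U \<Longrightarrow> U \<in> sets M"
  by (simp add: sets_M)

lemma closed_sets [intro]: "closed U \<Longrightarrow> U \<in> sets M"
  by (simp add: sets_M)

lemma ball_mono: "ball x r \<subseteq> ball y s \<Longrightarrow> measure M (ball x r) \<le> measure M (ball y s)"
  by (rule finite_measure_mono) auto

lemma A_ge_1: "1 \<le> A"
proof -
  have "measure M (ball x 1) \<le> measure M (ball x (2 * 1))" for x
    by (intro ball_mono subset_ball) simp
  also have "measure M (ball x (2 * 1)) \<le> A * measure M (ball x 1)" for x by (rule doubling) simp
  finally have "1 * measure M (ball x 1) \<le> A * measure M (ball x 1)" for x by simp
  from this[of undefined] show ?thesis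
    using ball_pos[of 1 undefined] by (simp only: mult_le_cancel_right_pos)
qed

lemma doubling_iterate: "0 < r \<Longrightarrow> measure M (ball x (2 ^ k * r)) \<le> A ^ k * measure M (ball x r)"
proof (induction k)
  case (Suc k)
  have "measure M (ball x (2 * (2 ^ k * r))) \<le> A * measure M (ball x (2 ^ k * r))"
    using Suc by (intro doubling) simp
  also have "\<dots> \<le> A * (A ^ k * measure M (ball x r))"
    using Suc A_ge_1 by (intro mult_left_mono) auto
  finally show ?case by (simp add: mult.assoc)
qed simp

text \<open>A number of doublings that depends on r and the diameter, but not on x, enlarges every
  ball of radius r to the whole space.\<close>

lemma ball_measure_lower_bound:
  assumes "0 < r"
  obtains m where "0 < m" "\<And>x. m \<le> measure M (ball x r)"
proof -
  obtain R where R: "\<And>x y :: 'a. dist x y \<le> R"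
    using compact_imp_bounded[OF compact_UNIV] unfolding bounded_two_points by blast
  obtain k where k: "R / r < 2 ^ k" using real_arch_pow[of 2 "R / r"] by auto
  then have "R < 2 ^ k * r" using assms by (simp add: divide_less_eq)
  then have "ball x (2 ^ k * r) = UNIV" for x :: 'a
    using R by (auto intro: le_less_trans[OF R])
  then have "measure M UNIV \<le> A ^ k * measure M (ball x r)" for x
    using doubling_iterate[OF assms, of x k] by simp
  moreover have "0 < A ^ k" using A_ge_1 by simp
  ultimately have "measure M UNIV / A ^ k \<le> measure M (ball x r)" for x
    by (simp add: divide_le_eq mult.commute)
  moreover have "0 < measure M UNIV"
    using ball_pos[of 1 undefined] finite_measure_mono[of "ball undefined 1" UNIV]
    by (auto simp: less_le_trans)
  ultimately show thesis using \<open>0 < A ^ k\<close> by (intro that[of "measure M UNIV / A ^ k"]) auto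
qed

lemma separated_card_bound:
  assumes "0 < r"
  shows "\<exists>n. \<forall>F :: 'a set. finite F \<and> disjoint_family_on (\<lambda>x. ball x r) F \<longrightarrow> card F \<le> n"
proof -
  obtain m where m: "0 < m" "\<And>x. m \<le> measure M (ball x r)"
    using ball_measure_lower_bound[OF assms] by blast
  have "card F \<le> nat \<lceil>measure M UNIV / m\<rceil>" if F: "finite F" "disjoint_family_on (\<lambda>x. ball x r) F" for F :: "'a set"
  proof -
    have "real (card F) * m \<le> (\<Sum>x\<in>F. measure M (ball x r))"
      using sum_bounded_below[of F m "\<lambda>x. measure M (ball x r)"] m by simp
    also have "\<dots> = measure M (\<Union>x\<in>F. ball x r)"
      using F by (intro finite_measure_finite_Union[symmetric]) auto
    also have "\<dots> \<le> measure M UNIV" by (intro finite_measure_mono) auto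
    finally have "real (card F) \<le> measure M UNIV / m" using m by (simp add: le_divide_eq)
    then show ?thesis by linarith
  qed
  then show ?thesis by blast
qed

lemma lattice_finite:
  fixes X :: "'a set"
  assumes "metric_lattice r N X" "0 < r"
  shows "finite X"
proof -
  obtain n where n: "\<And>F :: 'a set. finite F \<Longrightarrow> disjoint_family_on (\<lambda>x. ball x (r / 2)) F \<Longrightarrow> card F \<le> n"
    using separated_card_bound[OF half_gt_zero[OF assms(2)]] by blast
  have disj: "disjoint_family_on (\<lambda>x. ball x (r / 2)) X"
    using assms(1) by (simp add: metric_lattice_def)
  have "card F \<le> n" if "F \<subseteq> X" "finite F" for F
    by (rule n[OF that(2) disjoint_family_on_mono[OF that(1) disj]])
  then show ?thesis
    using finite_if_finite_subsets_card_bdd[of X n] by blast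
qed

text \<open>A 2r-separated subset of K of greatest cardinality: separation makes the r-balls
  disjoint, and a point of K outside all 2r-balls could be added. Cardinalities are bounded because
  disjoint r-balls have measure bounded below.\<close>

lemma separated_net:
  fixes K :: "'a set"
  assumes "0 < r"
  obtains S where "finite S" "S \<subseteq> K" "disjoint_family_on (\<lambda>x. ball x r) S" "K \<subseteq> (\<Union>x\<in>S. ball x (2 * r))"
proof -
  define Q where "Q S \<longleftrightarrow> finite S \<and> S \<subseteq> K \<and> (\<forall>x\<in>S. \<forall>y\<in>S. x \<noteq> y \<longrightarrow> 2 * r \<le> dist x y)" for S
  have disj: "disjoint_family_on (\<lambda>x. ball x r) S" if "Q S" for S
    unfolding disjoint_family_on_def
  proof (intro ballI impI equals0I)
    fix x y z assume xy: "x \<in> S" "y \<in> S" "x \<noteq> y" and z: "z \<in> ball x r \<inter> ball y r"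
    have "dist x y \<le> dist x z + dist y z" using dist_triangle[of x y z] by (simp add: dist_commute)
    then show False using xy z that unfolding Q_def by fastforce
  qed
  obtain n where n: "\<And>F :: 'a set. finite F \<Longrightarrow> disjoint_family_on (\<lambda>x. ball x r) F \<Longrightarrow> card F \<le> n"
    using separated_card_bound[OF assms] by blast
  have bound: "\<forall>S. Q S \<longrightarrow> card S < Suc n" using disj n by (auto simp: Q_def less_Suc_eq_le)
  have "Q {}" by (simp add: Q_def)
  then obtain S where S: "Q S" "\<And>S'. Q S' \<Longrightarrow> card S' \<le> card S"
    using ex_has_greatest_nat[of Q "{}" card "Suc n"] bound by blast
  have "\<exists>x\<in>S. y \<in> ball x (2 * r)" if "y \<in> K" for y
  proof (rule ccontr)
    assume far: "\<not> ?thesis"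
    then have "y \<notin> S" using assms by auto
    have "Q (insert y S)"
      using S(1) far that unfolding Q_def by (auto simp: not_less dist_commute)
    then show False using S(2)[of "insert y S"] \<open>y \<notin> S\<close> S(1) by (simp add: Q_def)
  qed
  then show thesis using S(1) disj by (intro that[of S]) (auto simp: Q_def)
qed

text \<open>
  On a compact set \<open>K\<close> where \<open>h < -\<epsilon>\<close>, disjoint balls of a small fixed radius centred in \<open>K\<close> fill,
  by doubling, a definite proportion of \<open>K\<close> and stay in a thin neighbourhood of it; so some of the
  integrals of \<open>h\<close> over these balls would be negative.
\<close>

lemma AE_nonneg_if_ball_integrals_nonneg:
  fixes h :: "'a \<Rightarrow> real"
  assumes h: "integrable M h" and "0 < r0"
    and nonneg: "\<And>x r. 0 < r \<Longrightarrow> r < r0 \<Longrightarrow> 0 \<le> (LINT y:ball x r|M. h y)"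
  shows "AE x in M. 0 \<le> h x"
proof -
  have h_meas [measurable]: "h \<in> borel_measurable M" using h by simp
  have null: "measure M {x. h x < - \<epsilon>} = 0" if "0 < \<epsilon>" for \<epsilon> :: real
  proof (rule ccontr)
    define B where "B = {x. h x < - \<epsilon>}"
    assume "measure M {x. h x < - \<epsilon>} \<noteq> 0"
    then have B_pos: "0 < emeasure M B"
      by (simp add: B_def emeasure_eq_measure zero_less_measure_iff)
    have "B \<in> sets M"
      using borel_measurable_less[OF h_meas borel_measurable_const[of "- \<epsilon>"]]
      by (simp add: B_def space_M)
    \<comment> \<open>Compactness is what makes the neighbourhoods U n shrink to K, so that the
      shells U n - K carry little of any integrable function.\<close>
    from inner_regular[OF this] B_pos obtain K where K: "compact K" "K \<subseteq> B" "0 < emeasure M K"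
      by (auto simp: less_SUP_iff)
    have K_sets: "K \<in> sets M" using K(1) by (simp add: compact_imp_closed closed_sets)
    have K_pos: "0 < measure M K" using K(3) by (simp add: emeasure_eq_measure)
    define U where "U n = (\<Union>x\<in>K. ball x (1 / real (Suc n)))" for n
    have U_sets: "U n \<in> sets M" for n unfolding U_def by (intro open_sets open_UN) auto
    \<comment> \<open>The summand 1 pays for the - \<epsilon> that is charged on all of W below,
      including its part outside K: there h <= - \<epsilon> + (1 + \<epsilon>) F.\<close>
    define F where "F = (\<lambda>x. \<bar>h x\<bar> + 1)"
    have F: "integrable M F" using h by (simp add: F_def)
    have "(\<lambda>n. LINT x|M. indicator (U n - K) x * F x) \<longlonglongrightarrow> (LINT x|M. 0)"
    proof (rule integral_dominated_convergence)
      show "AE x in M. (\<lambda>n. indicator (U n - K) x * F x) \<longlonglongrightarrow> 0"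
      proof (rule AE_I2)
        fix x
        have "\<exists>n0. \<forall>n\<ge>n0. x \<notin> U n - K"
        proof (cases "x \<in> K")
          case False
          have "open (- K)" using K(1) by (intro open_Compl compact_imp_closed)
          then have "\<exists>e>0. ball x e \<subseteq> - K"
            using False by (simp add: open_contains_ball)
          then obtain e where e: "0 < e" "ball x e \<inter> K = {}" by blast
          obtain n0 where n0: "1 / real (Suc n0) < e" using nat_approx_posE[of e] e by auto
          have "x \<notin> U n" if "n \<ge> n0" for n
          proof
            assume "x \<in> U n"
            then obtain y where y: "y \<in> K" "dist y x < 1 / real (Suc n)" by (auto simp: U_def)
            have "1 / real (Suc n) \<le> 1 / real (Suc n0)" using that by (simp add: frac_le)
            then have "y \<in> ball x e" using y n0 by (simp add: dist_commute)
            then show False using e y by blast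
          qed
          then show ?thesis by blast
        qed auto
        then obtain n0 where "\<forall>n\<ge>n0. x \<notin> U n - K" by blast
        then have "\<forall>\<^sub>F n in sequentially. indicator (U n - K) x * F x = 0"
          unfolding eventually_sequentially by (intro exI[of _ n0]) (simp add: indicator_def)
        then show "(\<lambda>n. indicator (U n - K) x * F x) \<longlonglongrightarrow> 0"
          by (rule tendsto_eventually)
      qed
      show "AE x in M. norm (indicator (U n - K) x * F x) \<le> F x" for n
        by (auto simp: indicator_def F_def)
      show "(\<lambda>x. indicator (U n - K) x * F x) \<in> borel_measurable M" for n
        using F U_sets K_sets by (intro borel_measurable_times borel_measurable_indicator) auto
    qed (use F in auto)
    \<comment> \<open>Chosen so that (1 + \<epsilon>) \<delta> = \<epsilon> |K| / A, which is at
      most the gain \<epsilon> |W| that doubling guarantees.\<close>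
    moreover define \<delta> where "\<delta> = \<epsilon> * measure M K / (A * (1 + \<epsilon>))"
    have "0 < \<delta>" using that K_pos A_ge_1 by (simp add: \<delta>_def)
    ultimately have "\<forall>\<^sub>F n in sequentially. (LINT x|M. indicator (U n - K) x * F x) < \<delta>"
      by (intro order_tendstoD) auto
    moreover obtain n1 where n1: "1 / real (Suc n1) < r0" using nat_approx_posE[of r0] \<open>0 < r0\<close> by auto
    have "1 / real (Suc n) < r0" if "n \<ge> n1" for n
      by (rule le_less_trans[OF _ n1]) (use that in \<open>simp add: frac_le\<close>)
    then have "\<forall>\<^sub>F n in sequentially. 1 / real (Suc n) < r0"
      unfolding eventually_sequentially by blast
    ultimately have "\<forall>\<^sub>F n in sequentially.
        (LINT x|M. indicator (U n - K) x * F x) < \<delta> \<and> 1 / real (Suc n) < r0"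
      by eventually_elim simp
    then obtain n where n: "(LINT x|M. indicator (U n - K) x * F x) < \<delta>" "1 / real (Suc n) < r0"
      by (auto simp: eventually_sequentially)
    define r where "r = 1 / real (Suc n)"
    have "0 < r" by (simp add: r_def)
    obtain S where S: "finite S" "S \<subseteq> K" "disjoint_family_on (\<lambda>x. ball x r) S"
      "K \<subseteq> (\<Union>x\<in>S. ball x (2 * r))"
      using separated_net[OF \<open>0 < r\<close>] by metis
    define W where "W = (\<Union>x\<in>S. ball x r)"
    have W_sets: "W \<in> sets M" unfolding W_def by (intro open_sets open_UN) auto
    have "W \<subseteq> U n" using S(2) by (auto simp: W_def U_def r_def)
    have "measure M K \<le> measure M (\<Union>x\<in>S. ball x (2 * r))"
      using S(4) by (intro finite_measure_mono) auto
    also have "\<dots> \<le> (\<Sum>x\<in>S. measure M (ball x (2 * r)))"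
      using S(1) by (intro finite_measure_subadditive_finite) auto
    also have "\<dots> \<le> (\<Sum>x\<in>S. A * measure M (ball x r))"
      using \<open>0 < r\<close> by (intro sum_mono doubling)
    also have "\<dots> = A * measure M W"
      unfolding W_def using S by (subst finite_measure_finite_Union) (auto simp: sum_distrib_left)
    finally have KW: "measure M K \<le> A * measure M W" .
    have "0 \<le> (\<Sum>x\<in>S. LINT y:ball x r|M. h y)"
      using n(2) \<open>0 < r\<close> by (intro sum_nonneg nonneg) (auto simp: r_def)
    also have "\<dots> = (LINT y:W|M. h y)"
    proof -
      have "(\<Sum>x\<in>S. LINT y:ball x r|M. h y) = (LINT y|M. (\<Sum>x\<in>S. indicator (ball x r) y *\<^sub>R h y))"
        unfolding set_lebesgue_integral_def
        using h by (intro Bochner_Integration.integral_sum[symmetric] integrable_mult_indicator) auto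
      also have "(\<lambda>y. \<Sum>x\<in>S. indicator (ball x r) y *\<^sub>R h y) = (\<lambda>y. indicator W y *\<^sub>R h y)"
        unfolding W_def using S by (simp add: indicator_UN_disjoint sum_distrib_right)
      finally show ?thesis by (simp add: set_lebesgue_integral_def)
    qed
    also have "\<dots> \<le> (LINT y|M. - \<epsilon> * indicator W y + (1 + \<epsilon>) * (indicator (U n - K) y * F y))"
      unfolding set_lebesgue_integral_def
    proof (rule integral_mono)
      show "integrable M (\<lambda>x. indicat_real W x *\<^sub>R h x)"
        using W_sets h by (rule integrable_mult_indicator)
      have "integrable M (\<lambda>y. indicator (U n - K) y *\<^sub>R F y)"
        using U_sets K_sets F by (intro integrable_mult_indicator) auto
      then show "integrable M (\<lambda>y. - \<epsilon> * indicator W y + (1 + \<epsilon>) * (indicator (U n - K) y * F y))"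
        using W_sets by (intro Bochner_Integration.integrable_add integrable_mult_right integrable_real_indicator)
          (auto simp: less_top[symmetric])
      fix x
      show "indicat_real W x *\<^sub>R h x \<le> - \<epsilon> * indicator W x + (1 + \<epsilon>) * (indicator (U n - K) x * F x)"
      proof (cases "x \<in> W")
        case True
        show ?thesis
        proof (cases "x \<in> K")
          case True
          then have "h x < - \<epsilon>" using K(2) by (auto simp: B_def)
          then show ?thesis using True \<open>x \<in> W\<close> by simp
        next
          case False
          have "h x \<le> - \<epsilon> + (1 + \<epsilon>) * F x"
          proof -
            have "0 \<le> \<epsilon> * \<bar>h x\<bar>" using that by simp
            then show ?thesis unfolding F_def by (simp add: algebra_simps)
          qed
          then show ?thesis using False True \<open>W \<subseteq> U n\<close> by (auto simp: indicator_def)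
        qed
      next
        case False
        then show ?thesis using that by (simp add: F_def)
      qed
    qed
    also have "\<dots> = - \<epsilon> * measure M W + (1 + \<epsilon>) * (LINT x|M. indicator (U n - K) x * F x)"
    proof -
      have "integrable M (\<lambda>y. indicator (U n - K) y *\<^sub>R F y)"
        using U_sets K_sets F by (intro integrable_mult_indicator) auto
      then show ?thesis
        using W_sets by (subst Bochner_Integration.integral_add) (auto simp: less_top[symmetric] space_M)
    qed
    also have "\<dots> < - \<epsilon> * measure M W + (1 + \<epsilon>) * \<delta>"
      using n(1) that by simp
    also have "(1 + \<epsilon>) * \<delta> = \<epsilon> * (measure M K / A)"
      using that A_ge_1 by (simp add: \<delta>_def)
    also have "- \<epsilon> * measure M W + \<epsilon> * (measure M K / A) \<le> 0"
    proof -
      have "measure M K / A \<le> measure M W" using KW A_ge_1 by (simp add: divide_le_eq mult.commute)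
      then have "\<epsilon> * (measure M K / A) \<le> \<epsilon> * measure M W" using that by (intro mult_left_mono) auto
      then show ?thesis by simp
    qed
    finally show False by simp
  qed
  have "AE x in M. - (1 / real (Suc n)) \<le> h x" for n
  proof -
    have B: "{x. h x < - (1 / real (Suc n))} \<in> sets M"
      using borel_measurable_less[OF h_meas borel_measurable_const[of "- (1 / real (Suc n))"]]
      by (simp add: space_M)
    have "emeasure M {x. h x < - (1 / real (Suc n))} = 0"
      using null[of "1 / real (Suc n)"] by (simp add: emeasure_eq_measure)
    then show ?thesis
      by (intro AE_I[of _ _ "{x. h x < - (1 / real (Suc n))}"]) (use B in auto)
  qed
  then have "AE x in M. \<forall>n. - (1 / real (Suc n)) \<le> h x" by (simp add: AE_all_countable)
  then show ?thesis
  proof eventually_elim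
    case (elim x)
    show ?case
    proof (rule ccontr)
      assume "\<not> 0 \<le> h x"
      then obtain n where "1 / real (Suc n) < - h x" using nat_approx_posE[of "- h x"] by auto
      then show False using elim by (metis less_minus_iff not_less)
    qed
  qed
qed

end

subsection \<open>Counting eigenvalues\<close>

text \<open>Gaussian elimination over arbitrary finite index sets: equation j is solved for an
  unknown k that occurs in it, and c' is the reduced system.\<close>

lemma homogeneous_system_nontrivial_solution:
  fixes c :: "'i \<Rightarrow> 'j \<Rightarrow> real"
  assumes "finite J" "finite I" "card J < card I"
  shows "\<exists>a. (\<exists>i\<in>I. a i \<noteq> 0) \<and> (\<forall>j\<in>J. (\<Sum>i\<in>I. a i * c i j) = 0)"
  using assms
proof (induction J arbitrary: I c rule: finite_induct)
  case empty
  then obtain i where "i \<in> I" by (auto simp: card_gt_0_iff)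
  then show ?case by (intro exI[of _ "\<lambda>_. 1"]) auto
next
  case (insert j J)
  show ?case
  proof (cases "\<exists>k\<in>I. c k j \<noteq> 0")
    case False
    have "card J < card I" using insert by simp
    from insert.IH[OF insert.prems(1) this, of c] obtain a
      where a: "\<exists>i\<in>I. a i \<noteq> 0" "\<forall>j\<in>J. (\<Sum>i\<in>I. a i * c i j) = 0" by blast
    moreover have "(\<Sum>i\<in>I. a i * c i j) = 0" using False by (intro sum.neutral) auto
    ultimately show ?thesis by blast
  next
    case True
    then obtain k where k: "k \<in> I" "c k j \<noteq> 0" by blast
    define I' where "I' = I - {k}"
    define c' where "c' i l = c i l - c i j / c k j * c k l" for i l
    have I': "finite I'" "k \<notin> I'" "I = insert k I'" using insert.prems k by (auto simp: I'_def)
    have "card J < card I'" using insert I' by simp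
    from insert.IH[OF I'(1) this, of c'] obtain a
      where a: "\<exists>i\<in>I'. a i \<noteq> 0" "\<forall>l\<in>J. (\<Sum>i\<in>I'. a i * c' i l) = 0" by blast
    define s where "s = (\<Sum>i\<in>I'. a i * c i j) / c k j"
    \<comment> \<open>Back substitution: the value of the eliminated unknown that satisfies equation
      j.\<close>
    define b where "b = a(k := - s)"
    have b_sum: "(\<Sum>i\<in>I. b i * c i l) = (\<Sum>i\<in>I'. a i * c i l) - s * c k l" for l
    proof -
      have "(\<Sum>i\<in>I'. b i * c i l) = (\<Sum>i\<in>I'. a i * c i l)"
        using I'(2) by (intro sum.cong) (auto simp: b_def)
      then show ?thesis using I' by (simp add: b_def)
    qed
    have "(\<Sum>i\<in>I. b i * c i l) = 0" if "l \<in> J" for l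
    proof -
      have "(\<Sum>i\<in>I'. a i * c' i l) = (\<Sum>i\<in>I'. a i * c i l) - s * c k l"
        by (simp add: c'_def s_def algebra_simps sum_subtractf sum_distrib_left sum_distrib_right
            sum_divide_distrib)
      then show ?thesis using a(2) that b_sum by simp
    qed
    moreover have "(\<Sum>i\<in>I. b i * c i j) = 0" using k by (simp add: b_sum s_def)
    moreover have "\<exists>i\<in>I. b i \<noteq> 0"
    proof -
      obtain i where "i \<in> I'" "a i \<noteq> 0" using a(1) by blast
      then show ?thesis using I' by (intro bexI[of _ i]) (auto simp: b_def)
    qed
    ultimately show ?thesis by blast
  qed
qed

text \<open>A bounded set of extended naturals is finite, so its supremum is a maximum.
  Multiplicities and suprema of lattice cardinalities can then be realised by actual families and
  lattices.\<close>

lemma enat_Sup_attained: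
  assumes "S \<noteq> {}" "\<And>x. x \<in> S \<Longrightarrow> x \<le> enat n"
  shows "Sup S \<in> S"
proof -
  have "finite S" using assms(2) by (rule finite_enat_bounded)
  then show ?thesis using assms(1) by (simp add: Sup_enat_def)
qed

context heat_flow
begin

lemma eigenspace_L2: "f \<in> eigenspace L l \<Longrightarrow> f \<in> L2 M"
  using L_L2 by (auto simp: eigenspace_def)

lemma eigenspace_orthogonal:
  assumes "f \<in> eigenspace L l" "g \<in> eigenspace L k" "l \<noteq> k"
  shows "l2_inner M f g = 0"
proof -
  have "l2_inner M (\<lambda>x. l * f x) g = l2_inner M f (\<lambda>x. k * g x)"
    using assms by (intro L_sym) (auto simp: eigenspace_def)
  then have "l * l2_inner M f g = k * l2_inner M f g"
    by (simp only: l2_inner_scale_left l2_inner_scale_right)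
  then show ?thesis using assms(3) by simp
qed

section \<open>Finite sums of eigenfunctions, one for each of finitely many distinct
  eigenvalues\<close>

context
  fixes \<Lambda> :: "real set" and f :: "real \<Rightarrow> 'a \<Rightarrow> real"
  assumes finite_\<Lambda>: "finite \<Lambda>" and f: "\<And>l. l \<in> \<Lambda> \<Longrightarrow> f l \<in> eigenspace L l"
begin

lemma eigensum_power: "((\<lambda>x. \<Sum>l\<in>\<Lambda>. f l x), (\<lambda>x. \<Sum>l\<in>\<Lambda>. l ^ k * f l x)) \<in> L ^^ k"
proof (induction k)
  case (Suc k)
  have "((\<lambda>x. \<Sum>l\<in>\<Lambda>. l ^ k * f l x), (\<lambda>x. \<Sum>l\<in>\<Lambda>. l ^ k * (l * f l x))) \<in> L"
    using f by (intro L_sum) (auto simp: eigenspace_def)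
  then have "((\<lambda>x. \<Sum>l\<in>\<Lambda>. l ^ k * f l x), (\<lambda>x. \<Sum>l\<in>\<Lambda>. l ^ Suc k * f l x)) \<in> L"
    by (simp add: ac_simps)
  with Suc show ?case by auto
qed simp

text \<open>This makes the energy bound and the Poincare inequality applicable to combinations of
  eigenfunctions.\<close>

lemma eigensum_smooth: "(\<lambda>x. \<Sum>l\<in>\<Lambda>. f l x) \<in> smooth_domain L"
  unfolding smooth_domain_def using eigensum_power by blast

lemma eigensum_L: "((\<lambda>x. \<Sum>l\<in>\<Lambda>. f l x), (\<lambda>x. \<Sum>l\<in>\<Lambda>. l * f l x)) \<in> L"
  using eigensum_power[of 1] by simp

lemma eigensum_inner:
  assumes "k \<in> \<Lambda>"
  shows "l2_inner M (\<lambda>x. \<Sum>l\<in>\<Lambda>. a l * f l x) (f k) = a k * (l2_norm M (f k))\<^sup>2"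
proof -
  have "l2_inner M (\<lambda>x. \<Sum>l\<in>\<Lambda>. a l * f l x) (f k) = (\<Sum>l\<in>\<Lambda>. a l * l2_inner M (f l) (f k))"
    using f assms by (intro l2_inner_sum_left) (auto intro: eigenspace_L2)
  also have "\<dots> = (\<Sum>l\<in>\<Lambda>. if l = k then a k * l2_inner M (f k) (f k) else 0)"
  proof (rule sum.cong[OF refl])
    fix l assume "l \<in> \<Lambda>"
    then show "a l * l2_inner M (f l) (f k) = (if l = k then a k * l2_inner M (f k) (f k) else 0)"
      using eigenspace_orthogonal[OF f f[OF assms], of l] by simp
  qed
  also have "\<dots> = a k * (l2_norm M (f k))\<^sup>2"
    using assms finite_\<Lambda> by (simp add: l2_norm_square)
  finally show ?thesis .
qed

lemma eigensum_inner_eigensum: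
  "l2_inner M (\<lambda>x. \<Sum>l\<in>\<Lambda>. a l * f l x) (\<lambda>x. \<Sum>l\<in>\<Lambda>. f l x) = (\<Sum>l\<in>\<Lambda>. a l * (l2_norm M (f l))\<^sup>2)"
proof -
  have "l2_inner M (\<lambda>x. \<Sum>l\<in>\<Lambda>. a l * f l x) (\<lambda>x. \<Sum>l\<in>\<Lambda>. 1 * f l x)
      = (\<Sum>k\<in>\<Lambda>. 1 * l2_inner M (\<lambda>x. \<Sum>l\<in>\<Lambda>. a l * f l x) (f k))"
    using f by (intro l2_inner_sum_right L2_sum) (auto intro: eigenspace_L2)
  then show ?thesis by (simp add: eigensum_inner)
qed

text \<open>Eigenfunctions to different eigenvalues are orthogonal, so both sides are sums of
  squared norms and can be compared term by term.\<close>

lemma eigensum_energy: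
  assumes "\<Lambda> \<subseteq> {..w}"
  shows "l2_inner M (\<lambda>x. \<Sum>l\<in>\<Lambda>. l * f l x) (\<lambda>x. \<Sum>l\<in>\<Lambda>. f l x) \<le> w * (l2_norm M (\<lambda>x. \<Sum>l\<in>\<Lambda>. f l x))\<^sup>2"
proof -
  have "(\<Sum>l\<in>\<Lambda>. l * (l2_norm M (f l))\<^sup>2) \<le> (\<Sum>l\<in>\<Lambda>. w * (l2_norm M (f l))\<^sup>2)"
    using assms by (intro sum_mono mult_right_mono) auto
  moreover have "(l2_norm M (\<lambda>x. \<Sum>l\<in>\<Lambda>. f l x))\<^sup>2 = (\<Sum>l\<in>\<Lambda>. (l2_norm M (f l))\<^sup>2)"
    using eigensum_inner_eigensum[of "\<lambda>_. 1"] by (simp add: l2_norm_square)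
  ultimately show ?thesis
    using eigensum_inner_eigensum[of "\<lambda>l. l"] by (simp add: sum_distrib_left)
qed

lemma eigensum_null_components:
  assumes "l2_norm M (\<lambda>x. \<Sum>l\<in>\<Lambda>. f l x) = 0" "k \<in> \<Lambda>"
  shows "l2_norm M (f k) = 0"
proof -
  have "(\<Sum>l\<in>\<Lambda>. (l2_norm M (f l))\<^sup>2) = 0"
    using eigensum_inner_eigensum[of "\<lambda>_. 1"] assms(1) by (simp add: l2_norm_square[symmetric])
  then show ?thesis using assms(2) finite_\<Lambda> by (simp add: sum_nonneg_eq_0_iff)
qed

end

text \<open>
  Given more independent eigenfunctions than linear functionals \<open>q x\<close>, some non-trivial combination
  is annihilated by all of them.
\<close>

lemma independent_eigenfunctions_le:
  fixes q :: "'b \<Rightarrow> ('a \<Rightarrow> real) \<Rightarrow> real"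
  assumes X: "finite X"
    and linear: "\<And>x (I :: (real \<times> ('a \<Rightarrow> real)) set) a f. x \<in> X \<Longrightarrow> finite I \<Longrightarrow> (\<And>i. i \<in> I \<Longrightarrow> f i \<in> L2 M) \<Longrightarrow>
      q x (\<lambda>y. \<Sum>i\<in>I. a i * f i y) = (\<Sum>i\<in>I. a i * q x (f i))"
    and null: "\<And>\<Lambda> f. finite \<Lambda> \<Longrightarrow> \<Lambda> \<subseteq> {0..w} \<Longrightarrow> (\<And>l. l \<in> \<Lambda> \<Longrightarrow> f l \<in> eigenspace L l) \<Longrightarrow>
      (\<And>x. x \<in> X \<Longrightarrow> q x (\<lambda>y. \<Sum>l\<in>\<Lambda>. f l y) = 0) \<Longrightarrow> l2_norm M (\<lambda>y. \<Sum>l\<in>\<Lambda>. f l y) = 0"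
    and \<Lambda>: "finite \<Lambda>" "\<Lambda> \<subseteq> {0..w}"
    and F: "\<And>l. l \<in> \<Lambda> \<Longrightarrow> F l \<subseteq> eigenspace L l" "\<And>l. l \<in> \<Lambda> \<Longrightarrow> ae_independent M (F l)"
  shows "(\<Sum>l\<in>\<Lambda>. card (F l)) \<le> card X"
proof (rule ccontr)
  define I where "I = Sigma \<Lambda> F"
  have F_finite: "finite (F l)" if "l \<in> \<Lambda>" for l using F(2)[OF that] by (simp add: ae_independent_def)
  then have I: "finite I" using \<Lambda> by (auto simp: I_def)
  assume "\<not> ?thesis"
  then have "card X < card I" using \<Lambda> F_finite by (simp add: I_def)
  from homogeneous_system_nontrivial_solution[OF X I this, of "\<lambda>i x. q x (snd i)"]
  obtain a where a: "\<exists>i\<in>I. a i \<noteq> 0" "\<And>x. x \<in> X \<Longrightarrow> (\<Sum>i\<in>I. a i * q x (snd i)) = 0" by blast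
  define f where "f l = (\<lambda>y. \<Sum>g\<in>F l. a (l, g) * g y)" for l
  have f_eigen: "f l \<in> eigenspace L l" if "l \<in> \<Lambda>" for l
  proof -
    have "((\<lambda>y. \<Sum>g\<in>F l. a (l, g) * g y), (\<lambda>y. \<Sum>g\<in>F l. a (l, g) * (l * g y))) \<in> L"
      using F(1)[OF that] by (intro L_sum) (auto simp: eigenspace_def)
    moreover have "(\<lambda>y. \<Sum>g\<in>F l. a (l, g) * (l * g y)) = (\<lambda>y. l * f l y)"
      by (simp add: f_def sum_distrib_left ac_simps)
    ultimately show ?thesis by (simp add: eigenspace_def f_def)
  qed
  have f_sum: "(\<lambda>y. \<Sum>l\<in>\<Lambda>. f l y) = (\<lambda>y. \<Sum>i\<in>I. a i * snd i y)"
    using \<Lambda> F_finite by (simp add: f_def I_def sum.Sigma case_prod_beta)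
  have "l2_norm M (\<lambda>y. \<Sum>l\<in>\<Lambda>. f l y) = 0"
  proof (rule null[OF \<Lambda> f_eigen])
    fix x assume x: "x \<in> X"
    have "q x (\<lambda>y. \<Sum>i\<in>I. a i * snd i y) = (\<Sum>i\<in>I. a i * q x (snd i))"
    proof (rule linear[OF x I])
      fix i assume "i \<in> I"
      then have "fst i \<in> \<Lambda>" "snd i \<in> F (fst i)" by (auto simp: I_def)
      then show "snd i \<in> L2 M" using F(1) eigenspace_L2 by blast
    qed
    then show "q x (\<lambda>y. \<Sum>l\<in>\<Lambda>. f l y) = 0" using a(2)[OF x] f_sum by simp
  qed
  \<comment> \<open>Orthogonality between different eigenvalues splits the null sum into null
    components; independence inside each F l then kills the coefficients.\<close>
  then have "l2_norm M (f l) = 0" if "l \<in> \<Lambda>" for l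
    using eigensum_null_components[OF \<Lambda>(1) f_eigen _ that] by blast
  then have ae: "AE y in M. (\<Sum>g\<in>F l. a (l, g) * g y) = 0" if "l \<in> \<Lambda>" for l
    using l2_norm_eq_0_iff[OF eigenspace_L2[OF f_eigen[OF that]]] that by (simp add: f_def)
  have zero: "a (l, g) = 0" if "l \<in> \<Lambda>" "g \<in> F l" for l g
  proof -
    have "\<forall>a. (AE x in M. (\<Sum>f\<in>F l. a f * f x) = 0) \<longrightarrow> (\<forall>f\<in>F l. a f = 0)"
      using F(2)[OF that(1)] by (simp add: ae_independent_def)
    from this[THEN spec, of "\<lambda>g. a (l, g)"] show ?thesis using ae[OF that(1)] that(2) by simp
  qed
  obtain i where "i \<in> I" "a i \<noteq> 0" using a(1) by blast
  then show False using zero by (cases i) (auto simp: I_def)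
qed

text \<open>The count is infinite by definition if there are infinitely many eigenvalues. A bound
  uniform over finite families excludes this and also bounds every multiplicity, so each
  multiplicity is attained by some family and the bound applies to all of these at once.\<close>

lemma eigenvalue_count_le:
  assumes bound: "\<And>\<Lambda> F. finite \<Lambda> \<Longrightarrow> \<Lambda> \<subseteq> {0..w} \<Longrightarrow> (\<And>l. l \<in> \<Lambda> \<Longrightarrow> F l \<subseteq> eigenspace L l) \<Longrightarrow>
      (\<And>l. l \<in> \<Lambda> \<Longrightarrow> ae_independent M (F l)) \<Longrightarrow> (\<Sum>l\<in>\<Lambda>. card (F l)) \<le> n"
  shows "eigenvalue_count M L w \<le> enat n"
proof -
  let ?E = "eigenvalues M L \<inter> {0..w}"
  have fin: "finite ?E"
  proof (rule ccontr)
    assume "infinite ?E"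
    \<comment> \<open>With n + 1 eigenvalues, one eigenfunction for each of them already violates
      the bound.\<close>
    then obtain \<Lambda> where \<Lambda>: "finite \<Lambda>" "card \<Lambda> = Suc n" "\<Lambda> \<subseteq> ?E"
      using infinite_arbitrarily_large by blast
    have "\<forall>l\<in>\<Lambda>. \<exists>f. f \<in> eigenspace L l \<and> \<not> (AE x in M. f x = 0)"
      using \<Lambda>(3) by (auto simp: eigenvalues_def)
    then obtain f where f: "\<forall>l\<in>\<Lambda>. f l \<in> eigenspace L l \<and> \<not> (AE x in M. f l x = 0)"
      by (rule bchoice[THEN exE])
    have "ae_independent M {f l}" if "l \<in> \<Lambda>" for l
      using f that by (auto simp: ae_independent_def)
    then have "(\<Sum>l\<in>\<Lambda>. card {f l}) \<le> n" using \<Lambda> f by (intro bound) auto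
    then show False using \<Lambda> by simp
  qed
  define Q where "Q l F \<longleftrightarrow> F \<subseteq> eigenspace L l \<and> ae_independent M F" for l F
  have "\<exists>F. Q l F \<and> enat (card F) = multiplicity_of M L l" if "l \<in> ?E" for l
  proof -
    have "(SUP F\<in>{F. Q l F}. enat (card F)) \<in> (\<lambda>F. enat (card F)) ` {F. Q l F}"
    proof (rule enat_Sup_attained)
      have "Q l {}" by (simp add: Q_def ae_independent_def)
      then show "(\<lambda>F. enat (card F)) ` {F. Q l F} \<noteq> {}" by blast
      fix x assume "x \<in> (\<lambda>F. enat (card F)) ` {F. Q l F}"
      then obtain F where "Q l F" "x = enat (card F)" by blast
      then show "x \<le> enat n"
        using bound[of "{l}" "\<lambda>_. F"] that by (simp add: Q_def)
    qed
    then show ?thesis by (auto simp: multiplicity_of_def Q_def)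
  qed
  then have "\<forall>l\<in>?E. \<exists>F. Q l F \<and> enat (card F) = multiplicity_of M L l" by blast
  then obtain F where F: "\<forall>l\<in>?E. Q l (F l) \<and> enat (card (F l)) = multiplicity_of M L l"
    by (rule bchoice[THEN exE])
  have "eigenvalue_count M L w = (\<Sum>l\<in>?E. enat (card (F l)))"
    using fin F by (simp add: eigenvalue_count_def)
  also have "\<dots> = enat (\<Sum>l\<in>?E. card (F l))"
    using of_nat_sum[of "\<lambda>l. card (F l)" ?E, where 'a=enat] by (simp add: of_nat_eq_enat)
  also have "\<dots> \<le> enat n" using bound[OF fin, of F] F by (simp add: Q_def)
  finally show ?thesis .
qed

text \<open>Grouping \<Phi> by eigenvalue, each group is independent and so no larger than the
  multiplicity. If there are infinitely many eigenvalues the count is infinite anyway.\<close>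

lemma card_orthonormal_eigenfunctions_le:
  assumes \<Phi>: "l2_orthonormal M \<Phi>"
    and eigen: "\<And>\<phi>. \<phi> \<in> \<Phi> \<Longrightarrow> \<phi> \<in> eigenspace L (l \<phi>)" "\<And>\<phi>. \<phi> \<in> \<Phi> \<Longrightarrow> l \<phi> \<in> {0..w}"
  shows "enat (card \<Phi>) \<le> eigenvalue_count M L w"
proof (cases "finite (eigenvalues M L \<inter> {0..w})")
  case True
  have finite: "finite \<Phi>" using \<Phi> by (simp add: l2_orthonormal_def)
  let ?F = "\<lambda>k. {\<phi> \<in> \<Phi>. l \<phi> = k}"
  have indep: "ae_independent M (?F k)" for k
    unfolding ae_independent_def
  proof (intro conjI allI impI ballI)
    fix a \<psi> assume ae: "AE x in M. (\<Sum>\<phi>\<in>?F k. a \<phi> * \<phi> x) = 0" and \<psi>: "\<psi> \<in> ?F k"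
    have F: "l2_orthonormal M (?F k)" using \<Phi> by (auto simp: l2_orthonormal_def)
    have "a \<psi> = l2_inner M (\<lambda>x. \<Sum>\<phi>\<in>?F k. a \<phi> * \<phi> x) \<psi>"
      using l2_inner_lincomb_orthonormal[OF F \<psi>] by simp
    also have "\<dots> = l2_inner M (\<lambda>x. 0) \<psi>"
      using ae orthonormal_L2[OF F] \<psi> by (intro l2_inner_cong_AE L2_sum) auto
    finally show "a \<psi> = 0" by (simp add: l2_inner_def)
  qed (use finite in simp)
  have mult: "enat (card (?F k)) \<le> multiplicity_of M L k" for k
    unfolding multiplicity_of_def using eigen indep by (intro SUP_upper) auto
  have sub: "l ` \<Phi> \<subseteq> eigenvalues M L \<inter> {0..w}"
  proof
    fix k assume "k \<in> l ` \<Phi>"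
    then obtain \<phi> where \<phi>: "\<phi> \<in> \<Phi>" "k = l \<phi>" by blast
    have "l2_inner M \<phi> \<phi> = 1" using \<Phi> \<phi> by (auto simp: l2_orthonormal_def)
    then have "l2_norm M \<phi> \<noteq> 0" by (simp add: l2_norm_def)
    then have "\<not> (AE x in M. \<phi> x = 0)"
      using l2_norm_eq_0_iff[OF orthonormal_L2[OF \<Phi> \<phi>(1)]] by simp
    then show "k \<in> eigenvalues M L \<inter> {0..w}"
      using eigen \<phi> by (auto simp: eigenvalues_def)
  qed
  have "card \<Phi> = (\<Sum>k\<in>l ` \<Phi>. card (?F k))"
    using finite sum.image_gen[of \<Phi> "\<lambda>_. 1::nat" l] by simp
  then have "enat (card \<Phi>) = (\<Sum>k\<in>l ` \<Phi>. enat (card (?F k)))"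
    using of_nat_sum[of "\<lambda>k. card (?F k)" "l ` \<Phi>", where 'a=enat] by (simp add: of_nat_eq_enat)
  also have "\<dots> \<le> (\<Sum>k\<in>l ` \<Phi>. multiplicity_of M L k)" by (intro sum_mono mult)
  also have "\<dots> \<le> (\<Sum>k\<in>eigenvalues M L \<inter> {0..w}. multiplicity_of M L k)"
    using True sub by (intro sum_mono2) auto
  also have "\<dots> = eigenvalue_count M L w" using True by (simp add: eigenvalue_count_def)
  finally show ?thesis .
qed (simp add: eigenvalue_count_def)

text \<open>The finite count bounds the size of orthonormal families of low eigenfunctions, so a
  largest one exists; a further eigenfunction orthogonal to it could be normalised and
  added.\<close>

lemma complete_eigensystem_exists:
  assumes "eigenvalue_count M L w \<le> enat n"
  obtains l \<Phi> where "complete_eigensystem w l \<Phi>" "enat (card \<Phi>) \<le> eigenvalue_count M L w"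
proof -
  define Q where "Q \<Phi> \<longleftrightarrow> l2_orthonormal M \<Phi> \<and>
    (\<forall>\<phi>\<in>\<Phi>. \<exists>l. \<phi> \<in> eigenspace L l \<and> l \<in> {0..w})" for \<Phi>
  have Q_bound: "enat (card \<Phi>) \<le> eigenvalue_count M L w" if "Q \<Phi>" for \<Phi>
  proof -
    have "\<forall>\<phi>\<in>\<Phi>. \<exists>l. \<phi> \<in> eigenspace L l \<and> l \<in> {0..w}" using that by (simp add: Q_def)
    then obtain l where "\<forall>\<phi>\<in>\<Phi>. \<phi> \<in> eigenspace L (l \<phi>) \<and> l \<phi> \<in> {0..w}" by (rule bchoice[THEN exE])
    then show ?thesis
      using that by (intro card_orthonormal_eigenfunctions_le[of \<Phi> l]) (auto simp: Q_def)
  qed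
  have "\<forall>\<Phi>. Q \<Phi> \<longrightarrow> card \<Phi> < Suc n"
    using order_trans[OF Q_bound assms] by (auto simp: less_Suc_eq_le)
  moreover have "Q {}" by (simp add: Q_def l2_orthonormal_def)
  ultimately obtain \<Phi> where \<Phi>: "Q \<Phi>" "\<And>\<Phi>'. Q \<Phi>' \<Longrightarrow> card \<Phi>' \<le> card \<Phi>"
    using ex_has_greatest_nat[of Q "{}" card "Suc n"] by blast
  have ortho: "l2_orthonormal M \<Phi>" using \<Phi>(1) by (simp add: Q_def)
  have "\<forall>\<phi>\<in>\<Phi>. \<exists>l. \<phi> \<in> eigenspace L l \<and> l \<in> {0..w}" using \<Phi>(1) by (simp add: Q_def)
  then obtain l where l: "\<forall>\<phi>\<in>\<Phi>. \<phi> \<in> eigenspace L (l \<phi>) \<and> l \<phi> \<in> {0..w}" by (rule bchoice[THEN exE])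
  have null: "l2_norm M f = 0"
    if f: "(f, (\<lambda>x. c * f x)) \<in> L" "0 \<le> c" "c \<le> w" "\<forall>\<phi>\<in>\<Phi>. l2_inner M f \<phi> = 0" for f c
  proof (rule ccontr)
    assume nz: "l2_norm M f \<noteq> 0"
    let ?a = "1 / l2_norm M f"
    define g where "g = (\<lambda>x. ?a * f x)"
    have g_L2: "g \<in> L2 M" using f(1) L_L2 unfolding g_def by (blast intro: L2_scale)
    have g_norm: "l2_inner M g g = 1"
      unfolding g_def l2_inner_scale_left l2_inner_scale_right l2_norm_square[symmetric]
      using nz by (simp add: power2_eq_square)
    have g_orth: "l2_inner M g \<phi> = 0" if "\<phi> \<in> \<Phi>" for \<phi>
      unfolding g_def l2_inner_scale_left using f(4) that by simp
    have "g \<notin> \<Phi>" using g_orth[of g] g_norm by auto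
    have "g \<in> eigenspace L c"
      using L_scale[OF f(1), of ?a] by (simp add: eigenspace_def g_def ac_simps)
    moreover have "l2_orthonormal M (insert g \<Phi>)"
    proof -
      have "l2_inner M \<phi> g = 0" if "\<phi> \<in> \<Phi>" for \<phi>
        using g_orth[OF that] by (subst l2_inner_commute)
      moreover have "\<forall>\<phi>\<in>\<Phi>. \<forall>\<psi>\<in>\<Phi>. l2_inner M \<phi> \<psi> = (if \<phi> = \<psi> then 1 else 0)"
        "finite \<Phi>" "\<Phi> \<subseteq> L2 M"
        using ortho by (simp_all add: l2_orthonormal_def)
      ultimately show ?thesis
        using g_L2 g_norm g_orth \<open>g \<notin> \<Phi>\<close> unfolding l2_orthonormal_def
        by (intro conjI ballI) (simp_all, metis)
    qed
    ultimately have "Q (insert g \<Phi>)" using \<Phi>(1) f by (auto simp: Q_def)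
    from \<Phi>(2)[OF this] show False
      using \<open>g \<notin> \<Phi>\<close> ortho by (simp add: l2_orthonormal_def)
  qed
  have "complete_eigensystem w l \<Phi>"
    unfolding complete_eigensystem_def using ortho l null by (auto simp: eigenspace_def)
  then show thesis using Q_bound[OF \<Phi>(1)] by (rule that)
qed

end

subsection \<open>Lattices and eigenvalues\<close>

text \<open>Decay doubly exponential in p beats a geometric loss in p. This selects the waiting time
  of the lower bound.\<close>

lemma exp_neg_power4_le:
  fixes K A :: real
  assumes "0 < K" "1 \<le> A"
  obtains p :: nat where "exp (- (4 ^ p)) \<le> K / A ^ (p + 2)"
proof -
  \<comment> \<open>After taking logarithms the claim reads p a + b <= 4^p; a p beyond a + |b| + 1
    works because p^2 <= 4^p.\<close>
  define a b where "a = ln A" and "b = 2 * a - ln K"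
  have "0 \<le> a" using assms by (simp add: a_def)
  obtain p :: nat where p: "a + \<bar>b\<bar> + 1 \<le> real p" using real_arch_simple by blast
  have "real p * a + b \<le> real p * (a + \<bar>b\<bar>)"
  proof -
    have "1 * \<bar>b\<bar> \<le> real p * \<bar>b\<bar>" using p \<open>0 \<le> a\<close> by (intro mult_right_mono) auto
    then show ?thesis by (simp add: distrib_left)
  qed
  also have "\<dots> \<le> real p * real p" using p by (intro mult_left_mono) auto
  also have "\<dots> \<le> 2 ^ p * 2 ^ p"
  proof -
    have "real p \<le> 2 ^ p" using less_exp[of p] by (metis of_nat_less_iff less_imp_le of_nat_power of_nat_numeral)
    then show ?thesis by (intro mult_mono) auto
  qed
  also have "\<dots> = 4 ^ p" by (simp flip: power_mult_distrib)
  finally have "- (4 ^ p) \<le> ln K - (real p + 2) * a" by (simp add: b_def algebra_simps)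
  then have "exp (- (4 ^ p)) \<le> exp (ln K - (real p + 2) * a)" by simp
  also have "\<dots> = K / exp ((real p + 2) * a)" using assms by (simp add: exp_diff)
  also have "exp ((real p + 2) * a) = exp a ^ (p + 2)"
  proof -
    have "real p + 2 = real (p + 2)" by simp
    then show ?thesis by (simp only: exp_of_nat_mult)
  qed
  also have "exp a = A" using assms by (simp add: a_def)
  finally show thesis by (rule that)
qed

text \<open>The relational identity S O S = L yields a vector between F and H, and self-adjointness
  of S moves one factor across. The value chosen by \<open>l2_apply\<close> may be another
  representative, hence the comparison almost everywhere.\<close>

lemma nonneg_sqrt_norm:
  assumes S: "nonneg_sqrt M L S" and FH: "(F, H) \<in> L"
  shows "(l2_norm M (l2_apply S F))\<^sup>2 = l2_inner M H F"
proof -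
  have sa: "selfadjoint_operator M S" and "S O S = L" using S by (auto simp: nonneg_sqrt_def)
  then obtain g where g: "(F, g) \<in> S" "(g, H) \<in> S" using FH by blast
  have op: "l2_operator M S" using sa by (simp add: selfadjoint_operator_def)
  have "S \<subseteq> L2 M \<times> L2 M" using op unfolding l2_operator_def by (elim conjE)
  then have L2: "g' \<in> L2 M" if "(F, g') \<in> S" for g' using that by auto
  have single: "\<forall>f g g'. (f, g) \<in> S \<and> (f, g') \<in> S \<longrightarrow> (AE x in M. g x = g' x)"
    using op unfolding l2_operator_def by (elim conjE)
  have app: "(F, l2_apply S F) \<in> S" unfolding l2_apply_def using g(1) by (rule someI[where P="\<lambda>g. (F, g) \<in> S"])
  have "AE x in M. l2_apply S F x = g x" using single app g(1) by blast
  then have "l2_norm M (l2_apply S F) = l2_norm M g"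
    by (rule l2_norm_cong_AE[OF L2[OF app] L2[OF g(1)]])
  then have "(l2_norm M (l2_apply S F))\<^sup>2 = l2_inner M g g" by (simp add: l2_norm_square)
  also have "\<dots> = l2_inner M F H"
  proof -
    have "(g, H) \<in> l2_adjoint M S" using sa g(2) by (simp add: selfadjoint_operator_def)
    then show ?thesis using g(1) by (auto simp: l2_adjoint_def)
  qed
  finally show ?thesis by (simp add: l2_inner_commute[of M F H])
qed

lemma nonneg_sqrt_imp_nonneg: "nonneg_sqrt M L S \<Longrightarrow> nonneg_operator M L"
  unfolding nonneg_operator_def using nonneg_sqrt_norm[of M L S] zero_le_power2
  by (metis (no_types, lifting) case_prodI2)

context doubling_space
begin

text \<open>The function s counts the lattice balls through a point. Covering gives s >= 1, used for
  the square of f; multiplicity gives s <= N, used for g, and it is there that g must be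
  non-negative almost everywhere.\<close>

lemma norm_le_of_local_bounds:
  fixes X :: "'a set" and g :: "'a \<Rightarrow> real"
  assumes lattice: "metric_lattice r N X" and "0 < r" and f: "f \<in> L2 M"
    and g: "integrable M g" "AE x in M. 0 \<le> g x" and "0 \<le> K"
    and bound: "\<And>x. x \<in> X \<Longrightarrow> (LINT y:ball x r|M. (f y)\<^sup>2) \<le> K * (LINT y:ball x r|M. g y)"
  shows "(l2_norm M f)\<^sup>2 \<le> K * (real N * (LINT x|M. g x))"
proof -
  have X: "finite X" by (rule lattice_finite[OF lattice \<open>0 < r\<close>])
  define s :: "'a \<Rightarrow> real" where "s y = (\<Sum>x\<in>X. indicator (ball x r) y)" for y
  have s_card: "s y = real (card {x \<in> X. y \<in> ball x r})" for y
    using X by (simp add: s_def indicator_def sum.If_cases Int_def)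
  have s_ge: "1 \<le> s y" for y
  proof -
    have "y \<in> (\<Union>x\<in>X. ball x r)" using lattice by (simp add: metric_lattice_def)
    then have "{x \<in> X. y \<in> ball x r} \<noteq> {}" by blast
    then have "0 < card {x \<in> X. y \<in> ball x r}" using X by (simp add: card_gt_0_iff)
    then show ?thesis by (simp add: s_card)
  qed
  have s_le: "s y \<le> real N" for y
    using lattice by (simp add: s_card metric_lattice_def)
  have int: "integrable M (\<lambda>y. s y * h y)" and
    sum: "(LINT y|M. s y * h y) = (\<Sum>x\<in>X. LINT y:ball x r|M. h y)"
    if h: "integrable M h" for h :: "'a \<Rightarrow> real"
  proof -
    have ind: "integrable M (\<lambda>y. indicator (ball x r) y *\<^sub>R h y)" for x
      using h by (intro integrable_mult_indicator) auto
    have eq: "(\<lambda>y. s y * h y) = (\<lambda>y. \<Sum>x\<in>X. indicator (ball x r) y *\<^sub>R h y)"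
      by (simp add: s_def sum_distrib_right)
    show "integrable M (\<lambda>y. s y * h y)" unfolding eq by (rule Bochner_Integration.integrable_sum[OF ind])
    show "(LINT y|M. s y * h y) = (\<Sum>x\<in>X. LINT y:ball x r|M. h y)"
      unfolding eq set_lebesgue_integral_def by (rule Bochner_Integration.integral_sum[OF ind])
  qed
  have f2: "integrable M (\<lambda>y. (f y)\<^sup>2)" using f by (rule L2_square_integrable)
  have "(l2_norm M f)\<^sup>2 = (LINT y|M. (f y)\<^sup>2)"
    unfolding l2_norm_square l2_inner_def by (simp add: power2_eq_square)
  also have "\<dots> \<le> (LINT y|M. s y * (f y)\<^sup>2)"
  proof (rule integral_mono[OF f2 int[OF f2]])
    show "(f y)\<^sup>2 \<le> s y * (f y)\<^sup>2" for y
      using mult_right_mono[OF s_ge, of "(f y)\<^sup>2" y] by simp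
  qed
  also have "\<dots> = (\<Sum>x\<in>X. LINT y:ball x r|M. (f y)\<^sup>2)" by (rule sum[OF f2])
  also have "\<dots> \<le> (\<Sum>x\<in>X. K * (LINT y:ball x r|M. g y))" by (intro sum_mono bound)
  also have "\<dots> = K * (LINT y|M. s y * g y)" by (simp add: sum[OF g(1)] sum_distrib_left)
  also have "\<dots> \<le> K * (LINT y|M. real N * g y)"
  proof (intro mult_left_mono integral_mono_AE int g(1) integrable_mult_right \<open>0 \<le> K\<close>)
    show "AE y in M. s y * g y \<le> real N * g y"
      using g(2) by eventually_elim (intro mult_right_mono s_le)
  qed
  finally show ?thesis by simp
qed

lemma ball_mean_sum:
  assumes "\<And>i. i \<in> I \<Longrightarrow> f i \<in> L2 M"
  shows "ball_mean M x r (\<lambda>y. \<Sum>i\<in>I. a i * f i y) = (\<Sum>i\<in>I. a i * ball_mean M x r (f i))"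
proof -
  have "(LINT y:ball x r|M. (\<Sum>i\<in>I. a i * f i y)) = l2_inner M (\<lambda>y. \<Sum>i\<in>I. a i * f i y) (indicator (ball x r))"
    by (simp add: set_lebesgue_integral_def l2_inner_def mult.commute)
  also have "\<dots> = (\<Sum>i\<in>I. a i * l2_inner M (f i) (indicator (ball x r)))"
    using assms by (intro l2_inner_sum_left) auto
  also have "\<dots> = (\<Sum>i\<in>I. a i * (LINT y:ball x r|M. f i y))"
    by (simp add: set_lebesgue_integral_def l2_inner_def mult.commute)
  finally show ?thesis
    by (simp add: ball_mean_def sum_distrib_left sum_divide_distrib)
qed

end

locale heat_doubling_space = doubling_space M A + heat_flow M L T
  for M :: "'a::metric_space measure" and A L T
begin

lemma l2_apply_L: "f \<in> Domain L \<Longrightarrow> (f, l2_apply L f) \<in> L"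
  unfolding l2_apply_def by (auto intro: someI[where P="\<lambda>g. (f, g) \<in> L"])

lemma smooth_domain_L: "f \<in> smooth_domain L \<Longrightarrow> (f, l2_apply L f) \<in> L"
proof (rule l2_apply_L)
  assume "f \<in> smooth_domain L"
  then have "f \<in> Domain (L ^^ 1)" unfolding smooth_domain_def by blast
  then show "f \<in> Domain L" by simp
qed

text \<open>The subalgebra property puts the square of f in the domain, so that L of the square is a
  genuine L2 function and not an arbitrary choice.\<close>

lemma carre_du_champ_integrable:
  assumes "subalgebra_of_continuous M (smooth_domain L)" and f: "f \<in> smooth_domain L"
  shows "integrable M (carre_du_champ L f f)"
proof -
  have ff: "(\<lambda>x. f x * f x) \<in> smooth_domain L"
    using assms unfolding subalgebra_of_continuous_def by blast
  have L2s: "f \<in> L2 M" "l2_apply L f \<in> L2 M" "l2_apply L (\<lambda>x. f x * f x) \<in> L2 M"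
    using smooth_domain_L[OF f] smooth_domain_L[OF ff] L_L2 by blast+
  have "integrable M (\<lambda>x. 1 / 2 * (f x * l2_apply L f x + f x * l2_apply L f x - l2_apply L (\<lambda>y. f y * f y) x))"
    using L2s by (intro integrable_mult_right Bochner_Integration.integrable_diff
        Bochner_Integration.integrable_add L2_mult_integrable L2_integrable)
  then show ?thesis unfolding carre_du_champ_def .
qed

text \<open>The product in \<open>small\<close> collects the Poincare constant, the multiplicity and
  the energy bound. Once it is below 1, low-frequency functions with vanishing ball means are null,
  so the means over the balls serve as the functionals in
  \<open>independent_eigenfunctions_le\<close>.\<close>

lemma eigenvalue_count_le_lattice:
  fixes X :: "'a set"
  assumes sub: "subalgebra_of_continuous M (smooth_domain L)"
    and S: "nonneg_sqrt M L S"
    and energy: "0 < c0" "\<And>f. f \<in> smooth_domain L \<Longrightarrow>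
      (LINT x|M. carre_du_champ L f f x) \<le> c0 * (l2_norm M (l2_apply S f))\<^sup>2"
    and poincare: "0 < C" "0 < r0" "\<And>f x r. f \<in> smooth_domain L \<Longrightarrow> 0 < r \<Longrightarrow> r < r0 \<Longrightarrow>
      (LINT y:ball x r|M. \<bar>f y - ball_mean M x r f\<bar>\<^sup>2)
        \<le> C * r\<^sup>2 * (LINT y:ball x r|M. carre_du_champ L f f y)"
    and lattice: "metric_lattice r N X" and r: "0 < r" "r < r0"
    and small: "C * r\<^sup>2 * (real N * (c0 * w)) < 1"
  shows "eigenvalue_count M L w \<le> enat (card X)"
proof -
  have X: "finite X" by (rule lattice_finite[OF lattice r(1)])
  have carre_nonneg: "AE x in M. 0 \<le> carre_du_champ L f f x" if f: "f \<in> smooth_domain L" for f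
  proof (rule AE_nonneg_if_ball_integrals_nonneg[OF carre_du_champ_integrable[OF sub f] poincare(2)])
    fix x s assume s: "0 < s" "s < r0"
    have "0 \<le> (LINT y:ball x s|M. \<bar>f y - ball_mean M x s f\<bar>\<^sup>2)"
      unfolding set_lebesgue_integral_def by (intro Bochner_Integration.integral_nonneg) auto
    also have "\<dots> \<le> C * s\<^sup>2 * (LINT y:ball x s|M. carre_du_champ L f f y)"
      by (rule poincare(3)[OF f s])
    finally have nonneg: "0 \<le> C * s\<^sup>2 * (LINT y:ball x s|M. carre_du_champ L f f y)" .
    have "0 < C * s\<^sup>2" using poincare(1) s by simp
    from mult_le_cancel_left_pos[OF this, of 0] nonneg
    show "0 \<le> (LINT y:ball x s|M. carre_du_champ L f f y)" by simp
  qed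
  have null: "l2_norm M (\<lambda>y. \<Sum>l\<in>\<Lambda>. f l y) = 0"
    if \<Lambda>: "finite \<Lambda>" "\<Lambda> \<subseteq> {0..w}" and f: "\<And>l. l \<in> \<Lambda> \<Longrightarrow> f l \<in> eigenspace L l"
      and mean: "\<And>x. x \<in> X \<Longrightarrow> ball_mean M x r (\<lambda>y. \<Sum>l\<in>\<Lambda>. f l y) = 0" for \<Lambda> f
  proof -
    let ?F = "\<lambda>y. \<Sum>l\<in>\<Lambda>. f l y"
    have smooth: "?F \<in> smooth_domain L" by (rule eigensum_smooth[OF \<Lambda>(1) f])
    have FL: "(?F, (\<lambda>y. \<Sum>l\<in>\<Lambda>. l * f l y)) \<in> L" by (rule eigensum_L[OF \<Lambda>(1) f])
    have "(LINT x|M. carre_du_champ L ?F ?F x) \<le> c0 * (l2_norm M (l2_apply S ?F))\<^sup>2"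
      by (rule energy(2)[OF smooth])
    also have "(l2_norm M (l2_apply S ?F))\<^sup>2 = l2_inner M (\<lambda>y. \<Sum>l\<in>\<Lambda>. l * f l y) ?F"
      by (rule nonneg_sqrt_norm[OF S FL])
    also have "c0 * \<dots> \<le> c0 * (w * (l2_norm M ?F)\<^sup>2)"
      using energy(1) \<Lambda>(2) by (intro mult_left_mono eigensum_energy[OF \<Lambda>(1) f]) auto
    finally have E: "(LINT x|M. carre_du_champ L ?F ?F x) \<le> c0 * (w * (l2_norm M ?F)\<^sup>2)" .
    have "(l2_norm M ?F)\<^sup>2 \<le> C * r\<^sup>2 * (real N * (LINT x|M. carre_du_champ L ?F ?F x))"
    proof (rule norm_le_of_local_bounds[OF lattice r(1) _ carre_du_champ_integrable[OF sub smooth] carre_nonneg[OF smooth]])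
      show "?F \<in> L2 M" using FL L_L2 by blast
      show "0 \<le> C * r\<^sup>2" using poincare(1) by simp
      fix x assume "x \<in> X"
      \<comment> \<open>With vanishing mean the left side of Poincare is the integral of the square
        itself.\<close>
      from poincare(3)[OF smooth r, of x] mean[OF this]
      show "(LINT y:ball x r|M. (?F y)\<^sup>2) \<le> C * r\<^sup>2 * (LINT y:ball x r|M. carre_du_champ L ?F ?F y)"
        by simp
    qed
    also have "\<dots> \<le> C * r\<^sup>2 * (real N * (c0 * (w * (l2_norm M ?F)\<^sup>2)))"
      using poincare(1) by (intro mult_left_mono E) auto
    also have "\<dots> = (C * r\<^sup>2 * (real N * (c0 * w))) * (l2_norm M ?F)\<^sup>2" by (simp add: ac_simps)
    finally have le: "(l2_norm M ?F)\<^sup>2 \<le> (C * r\<^sup>2 * (real N * (c0 * w))) * (l2_norm M ?F)\<^sup>2" .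
    show ?thesis
    proof (rule ccontr)
      assume "l2_norm M ?F \<noteq> 0"
      then have "(C * r\<^sup>2 * (real N * (c0 * w))) * (l2_norm M ?F)\<^sup>2 < 1 * (l2_norm M ?F)\<^sup>2"
        by (intro mult_strict_right_mono small) simp
      with le show False by linarith
    qed
  qed
  show ?thesis
  proof (rule eigenvalue_count_le)
    fix \<Lambda> F
    assume \<Lambda>: "finite \<Lambda>" "\<Lambda> \<subseteq> {0..w}"
      and F: "\<And>l. l \<in> \<Lambda> \<Longrightarrow> F l \<subseteq> eigenspace L l" "\<And>l. l \<in> \<Lambda> \<Longrightarrow> ae_independent M (F l)"
    show "(\<Sum>l\<in>\<Lambda>. card (F l)) \<le> card X"
    proof (rule independent_eigenfunctions_le[OF X _ null \<Lambda> F])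
      show "ball_mean M x r (\<lambda>y. \<Sum>i\<in>I. a i * f i y) = (\<Sum>i\<in>I. a i * ball_mean M x r (f i))"
        if "x \<in> X" "finite I" "\<And>i. i \<in> I \<Longrightarrow> f i \<in> L2 M"
        for x and I :: "(real \<times> ('a \<Rightarrow> real)) set" and a f
        using that(3) by (rule ball_mean_sum)
    qed
  qed
qed

text \<open>
  The heat flow at time \<open>4 ^ p r\<^sup>2 = 4 ^ p / w\<close> shrinks the part of a normalised indicator of a ball
  off the low eigenfunctions by \<open>exp (- 4 ^ p)\<close>, whereas the Gaussian lower bound only loses a factor
  exponential in \<open>p\<close>. So for large \<open>p\<close> each indicator has a substantial low-frequency part, and
  Bessel's inequality bounds the number of disjoint balls.
\<close>

lemma lattice_card_le_eigenvalue_count: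
  fixes X :: "'a set"
  assumes kernel: "heat_kernel M T P"
    and gauss: "0 < C1" "0 < c1" "\<And>t x y. 0 < t \<Longrightarrow> t < 1 \<Longrightarrow>
      C1 * exp (- c1 * (dist x y)\<^sup>2 / t) / sqrt (measure M (ball x (sqrt t)) * measure M (ball y (sqrt t)))
        \<le> P t x y"
    and lattice: "metric_lattice r N X" and r: "0 < r" "4 ^ p * r\<^sup>2 < 1" and w: "w * r\<^sup>2 = 1"
    and count: "eigenvalue_count M L w \<le> enat n"
    and \<kappa>: "\<kappa> = C1 * exp (- c1) / A ^ (p + 2)" and p: "exp (- (4 ^ p)) \<le> \<kappa> / 2"
  obtains m where "enat m \<le> eigenvalue_count M L w" "\<kappa>\<^sup>2 / 4 * real (card X) \<le> real m"
proof -
  have X: "finite X" by (rule lattice_finite[OF lattice r(1)])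
  have A: "0 < A" using A_ge_1 by simp
  have "0 < \<kappa>" using gauss A by (simp add: \<kappa>)
  obtain l \<Phi> where \<Phi>: "complete_eigensystem w l \<Phi>" "enat (card \<Phi>) \<le> eigenvalue_count M L w"
    using complete_eigensystem_exists[OF count] by blast
  note ortho = eigensystem_orthonormal[OF \<Phi>(1)]
  define t where "t = 4 ^ p * r\<^sup>2"
  have t: "0 < t" "t < 1" using r by (simp_all add: t_def)
  have "w * t = 4 ^ p * (w * r\<^sup>2)" by (simp add: t_def)
  then have wt: "w * t = 4 ^ p" by (simp add: w)
  have sqrt_t: "sqrt t = 2 ^ p * r"
  proof -
    have "t = (2 ^ p * r)\<^sup>2" by (simp add: t_def power_mult_distrib power2_eq_square flip: power_mult_distrib)
    then show ?thesis using r(1) by simp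
  qed
  define B where "B x = ball x (r / 2)" for x :: 'a
  define V where "V x = measure M (B x)" for x
  have V: "0 < V x" for x using r(1) by (simp add: V_def B_def ball_pos)
  have B_sets: "B x \<in> sets M" for x by (simp add: B_def)
  define g where "g x = (\<lambda>y. 1 / sqrt (V x) * indicator (B x) y :: real)" for x
  have g_L2: "g x \<in> L2 M" for x
    unfolding g_def by (intro L2_scale L2_indicator B_sets)
  have g_inner: "l2_inner M (g x) (g y) = 1 / sqrt (V x) * (1 / sqrt (V y) * measure M (B x \<inter> B y))" for x y
    unfolding g_def l2_inner_scale_left l2_inner_scale_right
    using B_sets by (simp add: l2_inner_def space_M flip: indicator_inter_arith)
  have g_self: "l2_inner M (g x) (g x) = 1" for x
    using V[of x] by (simp add: g_inner flip: V_def)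
  have g_disj: "l2_inner M (g x) (g y) = 0" if "x \<in> X" "y \<in> X" "x \<noteq> y" for x y
  proof -
    have "B x \<inter> B y = {}"
      using lattice that unfolding metric_lattice_def disjoint_family_on_def B_def by blast
    then show ?thesis by (simp add: g_inner)
  qed
  have g_inj: "inj_on g X"
    using g_self g_disj by (intro inj_onI) (metis zero_neq_one)
  have G: "l2_orthonormal M (g ` X)"
    unfolding l2_orthonormal_def using X g_L2 g_self g_disj by auto
  have lower: "\<kappa> \<le> l2_norm M (T t (g x))" for x
  proof -
    have kernel_lower: "\<kappa> / V x \<le> P t u v" if u: "u \<in> B x" and v: "v \<in> B x" for u v
    proof -
      \<comment> \<open>From radius r / 2 to 2^(p + 2) (r / 2) takes p + 2 doublings, and the latter
        ball contains every ball of radius 2^p r centred in B x. This is the origin of the exponent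
        in \<kappa>.\<close>
      have vol: "measure M (ball z (sqrt t)) \<le> A ^ (p + 2) * V x" if z: "z \<in> B x" for z
      proof -
        have "1 * r \<le> 2 ^ p * r" using r(1) by (intro mult_right_mono) auto
        then have "r / 2 \<le> 2 ^ p * r" using r(1) by linarith
        have "ball z (sqrt t) \<subseteq> ball x (2 ^ (p + 2) * (r / 2))"
        proof (intro subsetI)
          fix y assume "y \<in> ball z (sqrt t)"
          then have "dist z y < 2 ^ p * r" "dist x z < r / 2" using z by (simp_all add: sqrt_t B_def)
          then have "dist x y < r / 2 + 2 ^ p * r" using dist_triangle[of x y z] by linarith
          also have "\<dots> \<le> 2 ^ (p + 2) * (r / 2)" using \<open>r / 2 \<le> 2 ^ p * r\<close> by (simp add: mult.commute)
          finally show "y \<in> ball x (2 ^ (p + 2) * (r / 2))" by simp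
        qed
        then have "measure M (ball z (sqrt t)) \<le> measure M (ball x (2 ^ (p + 2) * (r / 2)))"
          by (rule ball_mono)
        also have "\<dots> \<le> A ^ (p + 2) * V x"
          unfolding V_def B_def using r(1) by (intro doubling_iterate) simp
        finally show ?thesis .
      qed
      let ?R = "sqrt (measure M (ball u (sqrt t)) * measure M (ball v (sqrt t)))"
      have R_pos: "0 < ?R" using t by (simp add: ball_pos)
      have "measure M (ball u (sqrt t)) * measure M (ball v (sqrt t)) \<le> (A ^ (p + 2) * V x)\<^sup>2"
        unfolding power2_eq_square using A V[of x] by (intro mult_mono vol u v) auto
      then have R_le: "?R \<le> A ^ (p + 2) * V x"
        using A V[of x] by (intro real_le_lsqrt) auto
      have "dist u v < r"
        using u v dist_triangle_half_r[of x u r v] by (simp add: B_def dist_commute)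
      \<comment> \<open>Two points of B x are closer than r, which is at most sqrt t, so the
        Gaussian factor is at least exp (- c1).\<close>
      then have "(dist u v)\<^sup>2 \<le> r\<^sup>2" by (intro power_mono) auto
      also have "\<dots> \<le> t" using r(1) by (simp add: t_def)
      finally have "c1 * ((dist u v)\<^sup>2 / t) \<le> c1 * 1"
        using gauss(2) t by (intro mult_left_mono) (auto simp: divide_le_eq)
      then have "exp (- c1) \<le> exp (- c1 * (dist u v)\<^sup>2 / t)" by simp
      then have "C1 * exp (- c1) / (A ^ (p + 2) * V x) \<le> C1 * exp (- c1 * (dist u v)\<^sup>2 / t) / ?R"
        using gauss(1) R_pos R_le by (intro frac_le mult_left_mono) auto
      also have "\<dots> \<le> P t u v" by (rule gauss(3)[OF t])
      finally show ?thesis by (simp add: \<kappa>)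
    qed
    have "AE u in M. integrable M (\<lambda>v. P t u v * g x v) \<and> T t (g x) u = (LINT v|M. P t u v * g x v)"
      using kernel t g_L2 by (simp add: heat_kernel_def)
    then have ptw: "AE u in M. indicator (B x) u * (\<kappa>\<^sup>2 / V x) \<le> T t (g x) u * T t (g x) u"
    proof eventually_elim
      case (elim u)
      show ?case
      proof (cases "u \<in> B x")
        case True
        \<comment> \<open>The integral of g x is sqrt (V x), so T t (g x) is at least \<kappa> /
          sqrt (V x) on B x; squaring and integrating over B x gives \<kappa>^2.\<close>
        have "\<kappa> / V x * (1 / sqrt (V x) * V x) = (LINT v|M. \<kappa> / V x * g x v)"
          using B_sets[of x] by (simp add: g_def V_def space_M)
        also have "\<dots> \<le> (LINT v|M. P t u v * g x v)"
        proof (rule integral_mono)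
          show "integrable M (\<lambda>v. \<kappa> / V x * g x v)" using L2_integrable[OF g_L2] by (rule integrable_mult_right)
          show "\<kappa> / V x * g x v \<le> P t u v * g x v" for v
          proof (cases "v \<in> B x")
            case v: True
            have "0 \<le> g x v" using V[of x] by (simp add: g_def)
            then show ?thesis by (rule mult_right_mono[OF kernel_lower[OF True v]])
          qed (simp add: g_def)
        qed (use elim in simp)
        finally have "\<kappa> / sqrt (V x) \<le> T t (g x) u" using elim V[of x] by simp
        then have "(\<kappa> / sqrt (V x))\<^sup>2 \<le> (T t (g x) u)\<^sup>2"
          using \<open>0 < \<kappa>\<close> V[of x] by (intro power_mono) auto
        then show ?thesis using True V[of x] by (simp add: power_divide power2_eq_square[of "T t (g x) u"])
      qed simp
    qed
    have "(LINT u|M. indicator (B x) u * (\<kappa>\<^sup>2 / V x)) \<le> (LINT u|M. T t (g x) u * T t (g x) u)"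
    proof (rule integral_mono_AE[OF _ _ ptw])
      show "integrable M (\<lambda>u. indicator (B x) u * (\<kappa>\<^sup>2 / V x))"
        using L2_integrable[OF L2_indicator[OF B_sets]] by (rule integrable_mult_left)
      show "integrable M (\<lambda>u. T t (g x) u * T t (g x) u)"
        using t g_L2 by (intro L2_mult_integrable T_L2) auto
    qed
    moreover have "(LINT u|M. indicator (B x) u * (\<kappa>\<^sup>2 / V x)) = \<kappa>\<^sup>2"
      using B_sets[of x] V[of x] by (simp add: space_M flip: V_def)
    ultimately have "\<kappa>\<^sup>2 \<le> (l2_norm M (T t (g x)))\<^sup>2"
      by (simp add: l2_norm_square l2_inner_def)
    then show ?thesis by (rule power2_le_imp_le) simp
  qed
  have proj_lower: "\<kappa>\<^sup>2 / 4 \<le> (\<Sum>\<phi>\<in>\<Phi>. (l2_inner M \<phi> (g x))\<^sup>2)" for x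
  proof -
    have norm_g: "l2_norm M (g x) = 1" by (simp add: l2_norm_def g_self)
    have "\<kappa> \<le> l2_norm M (l2_proj M \<Phi> (g x)) + exp (- w * t)"
      using T_decay_off_eigensystem[OF \<Phi>(1) g_L2[of x], of t] lower[of x] t norm_g by simp
    \<comment> \<open>Here w t = 4^p, so by the choice of p the part off \<Phi> accounts for at most
      half of \<kappa>.\<close>
    then have "\<kappa> / 2 \<le> l2_norm M (l2_proj M \<Phi> (g x))" using p wt by simp
    then have "(\<kappa> / 2)\<^sup>2 \<le> (l2_norm M (l2_proj M \<Phi> (g x)))\<^sup>2"
      using \<open>0 < \<kappa>\<close> by (intro power_mono) auto
    also have "\<dots> = (\<Sum>\<phi>\<in>\<Phi>. (l2_inner M (g x) \<phi>)\<^sup>2)" by (rule l2_norm_proj[OF ortho])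
    also have "\<dots> = (\<Sum>\<phi>\<in>\<Phi>. (l2_inner M \<phi> (g x))\<^sup>2)" by (simp only: l2_inner_commute[of M "g x"])
    finally show ?thesis by (simp add: power_divide)
  qed
  have "\<kappa>\<^sup>2 / 4 * real (card X) = (\<Sum>x\<in>X. \<kappa>\<^sup>2 / 4)" by simp
  also have "\<dots> \<le> (\<Sum>x\<in>X. \<Sum>\<phi>\<in>\<Phi>. (l2_inner M \<phi> (g x))\<^sup>2)" by (intro sum_mono proj_lower)
  also have "\<dots> = (\<Sum>\<phi>\<in>\<Phi>. \<Sum>x\<in>X. (l2_inner M \<phi> (g x))\<^sup>2)" by (rule sum.swap)
  \<comment> \<open>Bessel with the roles exchanged: each unit vector \<phi> is measured against the
    orthonormal indicators.\<close>
  also have "\<dots> \<le> (\<Sum>\<phi>\<in>\<Phi>. 1)"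
  proof (rule sum_mono)
    fix \<phi> assume \<phi>: "\<phi> \<in> \<Phi>"
    have "(\<Sum>x\<in>X. (l2_inner M \<phi> (g x))\<^sup>2) = (\<Sum>\<psi>\<in>g ` X. (l2_inner M \<phi> \<psi>)\<^sup>2)"
      using g_inj by (simp add: sum.reindex)
    also have "\<dots> \<le> (l2_norm M \<phi>)\<^sup>2" by (rule Bessel[OF G orthonormal_L2[OF ortho \<phi>]])
    also have "\<dots> = 1" using ortho \<phi> by (simp add: l2_norm_square l2_orthonormal_def)
    finally show "(\<Sum>x\<in>X. (l2_inner M \<phi> (g x))\<^sup>2) \<le> 1" .
  qed
  also have "\<dots> = real (card \<Phi>)" by simp
  finally show thesis by (rule that[OF \<Phi>(2)])
qed

end

section \<open>From the stated assumptions to the abstract setting, and the choice of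
  constants\<close>

lemma doubling_space_of_doubling:
  fixes M :: "'a::metric_space measure"
  assumes compact: "compact (UNIV :: 'a set)" and radon: "radon_measure M" and doubling: "doubling M"
  obtains A where "doubling_space M A"
proof -
  have sets: "sets M = sets borel" using radon by (simp add: radon_measure_def)
  have space: "space M = UNIV" using sets_eq_imp_space_eq[OF sets] by simp
  have "emeasure M UNIV < \<infinity>" using radon compact unfolding radon_measure_def by blast
  then have fin: "finite_measure M" by (intro finite_measureI) (simp add: space)
  obtain D where D: "\<And>x r. 0 < r \<Longrightarrow> 0 < measure M (ball x (2 * r)) \<and>
      measure M (ball x (2 * r)) \<le> 2 powr D * measure M (ball x r)"
    using doubling unfolding doubling_def by blast
  have "doubling_space M (2 powr D)"
  proof (intro doubling_space.intro doubling_space_axioms.intro fin compact sets)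
    show "0 < measure M (ball x r)" if "0 < r" for x r using D[of "r / 2" x] that by simp
    show "measure M (ball x (2 * r)) \<le> 2 powr D * measure M (ball x r)" if "0 < r" for x r
      using D[OF that] by blast
    show "emeasure M B = (SUP K\<in>{K. compact K \<and> K \<subseteq> B}. emeasure M K)" if "B \<in> sets M" for B
      using radon that unfolding radon_measure_def by blast
  qed
  then show thesis by (rule that)
qed

text \<open>For t >= a the volumes in the Gaussian upper bound are uniformly bounded below; the
  lower Gaussian bound supplies non-negativity of P.\<close>

lemma (in doubling_space) short_time_kernel_bounded:
  assumes "0 < C1" "0 < C2" "0 < c2"
    and lower: "\<And>t x y. 0 < t \<Longrightarrow> t < 1 \<Longrightarrow>
      C1 * exp (- c1 * (dist x y)\<^sup>2 / t) / sqrt (measure M (ball x (sqrt t)) * measure M (ball y (sqrt t)))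
        \<le> P t x y"
    and upper: "\<And>t x y. 0 < t \<Longrightarrow> t < 1 \<Longrightarrow>
      P t x y \<le> C2 * exp (- c2 * (dist x y)\<^sup>2 / t)
        / sqrt (measure M (ball x (sqrt t)) * measure M (ball y (sqrt t)))"
    and "0 < a"
  shows "\<exists>K. \<forall>t x y. a \<le> t \<and> t < 1 \<longrightarrow> \<bar>P t x y\<bar> \<le> K"
proof -
  obtain m where m: "0 < m" "\<And>x. m \<le> measure M (ball x (sqrt a))"
    using ball_measure_lower_bound[of "sqrt a"] \<open>0 < a\<close> by auto
  have "\<bar>P t x y\<bar> \<le> C2 / m" if t: "a \<le> t" "t < 1" for t x y
  proof -
    have "0 < t" using t \<open>0 < a\<close> by simp
    let ?R = "sqrt (measure M (ball x (sqrt t)) * measure M (ball y (sqrt t)))"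
    have vol: "m \<le> measure M (ball z (sqrt t))" for z
      using order_trans[OF m(2) ball_mono[OF subset_ball]] t by simp
    have "m * m \<le> measure M (ball x (sqrt t)) * measure M (ball y (sqrt t))"
      using m(1) by (intro mult_mono vol) auto
    then have R: "m \<le> ?R" using m(1) by (intro real_le_rsqrt) (simp add: power2_eq_square)
    have "exp (- c2 * (dist x y)\<^sup>2 / t) \<le> 1"
      using \<open>0 < c2\<close> \<open>0 < t\<close> by (simp add: divide_nonpos_pos)
    then have "C2 * exp (- c2 * (dist x y)\<^sup>2 / t) / ?R \<le> C2 / m"
      using R m(1) \<open>0 < C2\<close> by (intro frac_le) auto
    then have "P t x y \<le> C2 / m" using upper[OF \<open>0 < t\<close> t(2), of x y] by linarith
    moreover have "0 \<le> C1 * exp (- c1 * (dist x y)\<^sup>2 / t) / ?R" using \<open>0 < C1\<close> by simp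
    then have "0 \<le> P t x y" using lower[OF \<open>0 < t\<close> t(2), of x y] by linarith
    ultimately show ?thesis by simp
  qed
  then show ?thesis by blast
qed

text \<open>The bound makes the supremum a maximum, so multiplication by c never has to be exchanged
  with it. Over the empty set the supremum is 0.\<close>

lemma ereal_SUP_enat_le:
  fixes f :: "'b \<Rightarrow> nat" and c :: real
  assumes "0 < c" and bound: "\<And>x. x \<in> S \<Longrightarrow> c * real (f x) \<le> real m"
  shows "ereal c * ereal_of_enat (SUP x\<in>S. enat (f x)) \<le> ereal (real m)"
proof (cases "S = {}")
  case True
  then show ?thesis by (simp add: bot_enat_def)
next
  case False
  have "(SUP x\<in>S. enat (f x)) \<in> (\<lambda>x. enat (f x)) ` S"
  proof (rule enat_Sup_attained)
    fix e assume "e \<in> (\<lambda>x. enat (f x)) ` S"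
    then obtain x where x: "x \<in> S" "e = enat (f x)" by blast
    have "real (f x) \<le> real m / c"
      using bound[OF x(1)] \<open>0 < c\<close> by (simp add: le_divide_eq mult.commute)
    then have "f x \<le> nat \<lceil>real m / c\<rceil>" by linarith
    then show "e \<le> enat (nat \<lceil>real m / c\<rceil>)" by (simp add: x(2))
  qed (use False in simp)
  then obtain x where x: "x \<in> S" "(SUP x\<in>S. enat (f x)) = enat (f x)" by blast
  then show ?thesis using bound[OF x(1)] by simp
qed

theorem theorem5p4:
  fixes M :: "'a::metric_space measure"
    and L\<^sub>0 L S :: "('a \<Rightarrow> real) rel"
    and T :: "real \<Rightarrow> ('a \<Rightarrow> real) \<Rightarrow> ('a \<Rightarrow> real)"
    and P :: "real \<Rightarrow> 'a \<Rightarrow> 'a \<Rightarrow> real"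
    and N :: nat
  assumes "compact (UNIV :: 'a set)"
    and "radon_measure M"
    and "doubling M"
    and "l2_operator M L\<^sub>0" and "densely_defined M L\<^sub>0"
    and "symmetric_operator M L\<^sub>0" and "nonneg_operator M L\<^sub>0"
    and "L = l2_closure M L\<^sub>0" and "selfadjoint_operator M L"
    and "subalgebra_of_continuous M (smooth_domain L)"
    and "nonneg_sqrt M L S" and "energy_bound M L S"
    and "local_poincare M L"
    and "heat_semigroup M L T" and "heat_kernel M T P" and "short_time_gaussian M P"
    and "\<exists>r0>0. \<forall>r. 0 < r \<and> r < r0 \<longrightarrow> (\<exists>X :: 'a set. metric_lattice r N X)"
  shows "\<exists>c \<gamma>. 0 < c \<and> c < 1 \<and> 0 < \<gamma> \<and> \<gamma> < 1 \<and>
    (\<forall>\<^sub>F \<omega> in at_top.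
       ereal c * ereal_of_enat
           (SUP X\<in>{X :: 'a set. metric_lattice (\<omega> powr (- 1 / 2)) N X}. enat (card X))
         \<le> ereal_of_enat (eigenvalue_count M L \<omega>) \<and>
       eigenvalue_count M L \<omega>
         \<le> (INF X\<in>{X :: 'a set. metric_lattice (\<gamma> * \<omega> powr (- 1 / 2)) N X}. enat (card X)))"
proof -
  obtain A where "doubling_space M A"
    using doubling_space_of_doubling[OF assms(1-3)] by blast
  then interpret doubling_space M A .
  obtain C1 C2 c1 c2 where C: "0 < C1" "0 < C2" "0 < c1" "0 < c2"
    and gauss: "\<forall>t x y. 0 < t \<and> t < 1 \<longrightarrow>
      C1 * exp (- c1 * (dist x y)\<^sup>2 / t) / sqrt (measure M (ball x (sqrt t)) * measure M (ball y (sqrt t)))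
        \<le> P t x y \<and>
      P t x y \<le> C2 * exp (- c2 * (dist x y)\<^sup>2 / t)
        / sqrt (measure M (ball x (sqrt t)) * measure M (ball y (sqrt t)))"
    using \<open>short_time_gaussian M P\<close> unfolding short_time_gaussian_def
    by (elim exE conjE) (rule that)
  have lower: "C1 * exp (- c1 * (dist x y)\<^sup>2 / t)
      / sqrt (measure M (ball x (sqrt t)) * measure M (ball y (sqrt t))) \<le> P t x y"
    and upper: "P t x y \<le> C2 * exp (- c2 * (dist x y)\<^sup>2 / t)
      / sqrt (measure M (ball x (sqrt t)) * measure M (ball y (sqrt t)))"
    if "0 < t" "t < 1" for t x y
    using gauss that by blast+
  obtain G :: "'a set set" where G: "countable G" "Int_stable G" "sets borel = sigma_sets UNIV G"
    using compact_metric_countable_generator[OF assms(1)] by blast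
  have "heat_flow M L T"
  proof (rule heat_flow_of_bounded_kernel[OF finite_measure_axioms space_M G(1,2) _ assms(9) _ assms(14,15)])
    show "sets M = sigma_sets UNIV G" using G(3) sets_M by simp
    show "nonneg_operator M L" by (rule nonneg_sqrt_imp_nonneg[OF assms(11)])
    show "\<exists>K. \<forall>t x y. a \<le> t \<and> t < 1 \<longrightarrow> \<bar>P t x y\<bar> \<le> K" if "0 < a" for a
      by (rule short_time_kernel_bounded[OF C(1,2,4) lower upper that])
  qed
  then interpret heat_flow M L T .
  interpret heat_doubling_space M A L T ..
  obtain c0 where energy: "0 < c0" "\<And>f. f \<in> smooth_domain L \<Longrightarrow>
      (LINT x|M. carre_du_champ L f f x) \<le> c0 * (l2_norm M (l2_apply S f))\<^sup>2"
    using \<open>energy_bound M L S\<close> unfolding energy_bound_def by blast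
  obtain C r0 where poincare: "0 < C" "0 < r0" "\<And>f x r. f \<in> smooth_domain L \<Longrightarrow> 0 < r \<Longrightarrow> r < r0 \<Longrightarrow>
      (LINT y:ball x r|M. \<bar>f y - ball_mean M x r f\<bar>\<^sup>2)
        \<le> C * r\<^sup>2 * (LINT y:ball x r|M. carre_du_champ L f f y)"
    using \<open>local_poincare M L\<close> unfolding local_poincare_def by blast
  obtain r1 where r1: "0 < r1" "\<And>r. 0 < r \<Longrightarrow> r < r1 \<Longrightarrow> \<exists>X :: 'a set. metric_lattice r N X"
    using assms(17) by blast
  obtain p where p: "exp (- (4 ^ p)) \<le> (C1 * exp (- c1) / 2) / A ^ (p + 2)"
    using exp_neg_power4_le[of "C1 * exp (- c1) / 2" A] C A_ge_1 by auto
  define \<kappa> where "\<kappa> = C1 * exp (- c1) / A ^ (p + 2)"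
  have \<kappa>: "0 < \<kappa>" "exp (- (4 ^ p)) \<le> \<kappa> / 2" using C A_ge_1 p by (simp_all add: \<kappa>_def)
  \<comment> \<open>The value 1/2 only secures c < 1; the other is the constant from the lower
    bound.\<close>
  define c where "c = min (1 / 2) (\<kappa>\<^sup>2 / 4)"
  have c: "0 < c" "c < 1" "c \<le> \<kappa>\<^sup>2 / 4" using \<kappa> by (auto simp: c_def)
  define k where "k = C * (real N * c0)"
  have "0 \<le> k" using poincare energy by (simp add: k_def)
  \<comment> \<open>At r = w powr (- 1/2) the smallness condition for radius \<gamma> r becomes
    \<gamma>^2 k < 1, which this choice meets together with \<gamma> < 1.\<close>
  define \<gamma> where "\<gamma> = 1 / (2 + k)"
  have \<gamma>: "0 < \<gamma>" "\<gamma> < 1" "\<gamma>\<^sup>2 * k < 1"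
  proof -
    show "0 < \<gamma>" "\<gamma> < 1" using \<open>0 \<le> k\<close> by (simp_all add: \<gamma>_def)
    have "k < 1 * (2 + k)" by simp
    also have "\<dots> \<le> (2 + k) * (2 + k)" using \<open>0 \<le> k\<close> by (intro mult_right_mono) auto
    finally have "k < (2 + k) * (2 + k)" .
    then show "\<gamma>\<^sup>2 * k < 1" using \<open>0 \<le> k\<close> by (simp add: \<gamma>_def power2_eq_square divide_less_eq)
  qed
  let ?Q = "\<lambda>\<omega>. ereal c * ereal_of_enat
           (SUP X\<in>{X :: 'a set. metric_lattice (\<omega> powr (- 1 / 2)) N X}. enat (card X))
         \<le> ereal_of_enat (eigenvalue_count M L \<omega>) \<and>
       eigenvalue_count M L \<omega>
         \<le> (INF X\<in>{X :: 'a set. metric_lattice (\<gamma> * \<omega> powr (- 1 / 2)) N X}. enat (card X))"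
  have lim: "((\<lambda>\<omega>::real. \<omega> powr (- 1 / 2)) \<longlongrightarrow> 0) at_top"
    by (intro tendsto_neg_powr) (auto simp: filterlim_ident)
  \<comment> \<open>Large \<omega> means: radii small enough for Poincare and for lattices to exist,
    and \<omega> > 4^p, so that the waiting time 4^p / \<omega> is below 1.\<close>
  have "\<forall>\<^sub>F \<omega> in at_top. ?Q \<omega>"
    using order_tendstoD(2)[OF lim poincare(2)] order_tendstoD(2)[OF lim r1(1)]
      eventually_gt_at_top[of "4 ^ p"] eventually_gt_at_top[of 0]
  proof eventually_elim
    fix w :: real
    assume small: "w powr (- 1 / 2) < r0" "w powr (- 1 / 2) < r1" and w: "4 ^ p < w" "0 < w"
    define r where "r = w powr (- 1 / 2)"
    have r: "0 < r" using w by (simp add: r_def)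
    have "r\<^sup>2 = w powr (- 1)"
      by (simp add: r_def power2_eq_square flip: powr_add)
    then have r2: "r\<^sup>2 = 1 / w" using w by (simp add: powr_minus_divide)
    have \<gamma>r: "0 < \<gamma> * r" "\<gamma> * r < r0" "\<gamma> * r < r1"
    proof -
      have "\<gamma> * r \<le> 1 * r" using \<gamma> r by (intro mult_right_mono) auto
      then show "\<gamma> * r < r0" "\<gamma> * r < r1" using small by (simp_all add: r_def)
    qed (use \<gamma> r in simp)
    have small_\<gamma>: "C * (\<gamma> * r)\<^sup>2 * (real N * (c0 * w)) < 1"
    proof -
      have "C * (\<gamma> * r)\<^sup>2 * (real N * (c0 * w)) = \<gamma>\<^sup>2 * k * (r\<^sup>2 * w)"
        by (simp add: k_def power_mult_distrib ac_simps)
      also have "r\<^sup>2 * w = 1" using w by (simp add: r2)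
      finally show ?thesis using \<gamma>(3) by simp
    qed
    have count_le: "eigenvalue_count M L w \<le> enat (card X)" if "metric_lattice (\<gamma> * r) N X" for X :: "'a set"
      by (rule eigenvalue_count_le_lattice[OF assms(10,11) energy poincare that \<gamma>r(1,2) small_\<gamma>])
    \<comment> \<open>One existing lattice makes the count finite, as the lower bound
      requires.\<close>
    obtain X0 :: "'a set" where "metric_lattice (\<gamma> * r) N X0" using r1(2)[OF \<gamma>r(1,3)] by blast
    note count0 = count_le[OF this]
    then obtain m where m: "eigenvalue_count M L w = enat m" by (cases "eigenvalue_count M L w") auto
    have lower_bound: "c * real (card X) \<le> real m" if X: "metric_lattice r N X" for X :: "'a set"
    proof -
      have "4 ^ p * r\<^sup>2 < 1" "w * r\<^sup>2 = 1" using w by (simp_all add: r2 divide_less_eq)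
      then obtain m' where m': "enat m' \<le> eigenvalue_count M L w" "\<kappa>\<^sup>2 / 4 * real (card X) \<le> real m'"
        using lattice_card_le_eigenvalue_count[OF assms(15) C(1,3) lower X r _ _ count0 \<kappa>_def \<kappa>(2)]
        by blast
      have "c * real (card X) \<le> \<kappa>\<^sup>2 / 4 * real (card X)" using c(3) by (intro mult_right_mono) auto
      also have "\<dots> \<le> real m'" by (rule m'(2))
      also have "\<dots> \<le> real m" using m'(1) m by simp
      finally show ?thesis .
    qed
    have "ereal c * ereal_of_enat (SUP X\<in>{X :: 'a set. metric_lattice r N X}. enat (card X)) \<le> ereal (real m)"
      using c(1) lower_bound by (intro ereal_SUP_enat_le) auto
    moreover have "eigenvalue_count M L w \<le> (INF X\<in>{X :: 'a set. metric_lattice (\<gamma> * r) N X}. enat (card X))"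
      using count_le by (intro INF_greatest) auto
    ultimately show "?Q w" by (simp add: m r_def)
  qed
  with c \<gamma> show ?thesis by blast
qed

end
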